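(* Let $\Delta=[\boldsymbol p_1,\boldsymbol p_2,\boldsymbol p_3]$ be a nondegenerate triangle with Powell–Sabin 12-split, let $\boldsymbol s_0,\boldsymbol s_1,\boldsymbol s_2,\boldsymbol s_3$ be the vectors of simplex splines, and $\boldsymbol R_1,\boldsymbol R_2,\boldsymbol R_3$ the matrices with entries in $\mathbb P_1$, of sizes $12\times10$, $10\times12$, $12\times16$, defined in the context. Then on $\Delta$ $$\boldsymbol s_d^{\mathrm T}=\boldsymbol s_{d-1}^{\mathrm T}\boldsymbol R_d,\qquad d=1,2,3.$$ Moreover, $\boldsymbol R_d(i,j)(\boldsymbol x)\,S_{i,d-1}(\boldsymbol x)\ge0$ for all $i,j$, all $d=1,2,3$ and all $\boldsymbol x\in\Delta$.
   Context: **The 12-split.** $\boldsymbol p_4=\frac{\boldsymbol p_1+\boldsymbol p_2}2$, $\boldsymbol p_5=\frac{\boldsymbol p_2+\boldsymbol p_3}2$, $\boldsymbol p_6=\frac{\boldsymbol p_3+\boldsymbol p_1}2$, $\boldsymbol p_7=\frac{\boldsymbol p_4+\boldsymbol p_6}2$, $\boldsymbol p_8=\frac{\boldsymbol p_4+\boldsymbol p_5}2$, $\boldsymbol p_9=\frac{\boldsymbol p_5+\boldsymbol p_6}2$, $\boldsymbol p_{10}=\frac{\boldsymbol p_1+\boldsymbol p_2+\boldsymbol p_3}3$. The subtriangles (by vertex indices), in order $k=1,\dots,12$, are $[1,6,7],[1,4,7],[2,4,8],[2,5,8],[3,5,9],[3,6,9],[6,7,10],[4,7,10],[4,8,10],[5,8,10],[5,9,10],[6,9,10]$.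 They are taken half-open: every point of $\Delta$ is assigned to exactly one subtriangle $\Delta_k$ containing it, so $\Delta=\bigsqcup_k\Delta_k$. **Simplex splines.** For a multiset $\mathcal K=\{\boldsymbol k_1,\dots,\boldsymbol k_{d+3}\}$ of points $\boldsymbol p_i$, not all on one line, $d\ge1$, choose a simplex $\sigma=[\overline{\boldsymbol k}_1,\dots,\overline{\boldsymbol k}_{d+3}]\subset\mathbb R^{d+2}$ with $\boldsymbol P(\overline{\boldsymbol k}_i)=\boldsymbol k_i$, $\boldsymbol P$ the projection onto the first two coordinates, and set $Q[\mathcal K](\boldsymbol x)=\mathrm{area}(\Delta)\binom{d+2}2^{-1}\frac{\mathrm{vol}_d(\sigma\cap\boldsymbol P^{-1}(\boldsymbol x))}{\mathrm{vol}_{d+2}(\sigma)}$. Write $Q[ijklmn]=Q[\boldsymbol p_1^i\boldsymbol p_2^j\boldsymbol p_3^k\boldsymbol p_4^l\boldsymbol p_5^m\boldsymbol p_6^n]$ and $Q[ijklmn;o]$ if additionally $\boldsymbol p_{10}$ has multiplicity $o$ (exponents are multiplicities). **Bases** $\boldsymbol s_d^{\mathrm T}=[S_{1,d},\dots,S_{n_d,d}]$, $(n_0,n_1,n_2,n_3)=(12,10,12,16)$: - $S_{j,0}=\mathbf 1_{\Delta_j}$. - $\boldsymbol s_1$: $\frac14Q[200101]$, $\frac14Q[020110]$, $\frac14Q[002011]$, $\frac13Q[110100;1]$, $\frac13Q[011010;1]$, $\frac13Q[101001;1]$, $\frac13Q[100101;1]$, $\frac13Q[010110;1]$, $\frac13Q[001011;1]$,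 $\frac14Q[000111;1]$ (the nodal basis of the continuous piecewise linears: $S_{j,1}(\boldsymbol p_i)=\delta_{ij}$). - $\boldsymbol s_2$: $\frac14Q[300101]$, $\frac12Q[210101]$, $\frac34Q[110111]$, $\frac12Q[120110]$, $\frac14Q[030110]$, $\frac12Q[021110]$, $\frac34Q[011111]$, $\frac12Q[012011]$, $\frac14Q[003011]$, $\frac12Q[102011]$, $\frac34Q[101111]$, $\frac12Q[201101]$. - $\boldsymbol s_3$: $\frac14Q[400101]$, $\frac12Q[310101]$, $Q[221100]$, $\frac12Q[130110]$, $\frac14Q[040110]$, $\frac12Q[031110]$, $Q[122010]$, $\frac12Q[013011]$, $\frac14Q[004011]$, $\frac12Q[103011]$, $Q[212001]$, $\frac12Q[301101]$, $Q[211101]$, $Q[121110]$, $Q[112011]$, $\frac14Q[111111]$. **Matrices.** Let $(\beta_1,\beta_2,\beta_3)$ be the barycentric coordinates of $\boldsymbol x$ with respect to $\Delta$, $\gamma_j=2\beta_j-1$, $\beta_{i,j}=\beta_i-\beta_j$, $\sigma_{i,j}=\beta_i+\beta_j$. $\mathbb P_1$ is the space of bivariate polynomials of degree $\le1$. The nonzero entries are listed row by row as "column: entry". $\boldsymbol R_1$ ($12\times10$): row 1: $1:\gamma_1,\ 6:2\beta_{3,2},\ 7:4\beta_2$. Row 2: $1:\gamma_1,\ 4:2\beta_{2,3},\ 7:4\beta_3$. Row 3: $2:\gamma_2,\ 4:2\beta_{1,3},\ 8:4\beta_3$. Row 4: $2:\gamma_2,\ 5:2\beta_{3,1},\ 8:4\beta_1$.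 Row 5: $3:\gamma_3,\ 5:2\beta_{2,1},\ 9:4\beta_1$. Row 6: $3:\gamma_3,\ 6:2\beta_{1,2},\ 9:4\beta_2$. Row 7: $6:2\beta_{3,2},\ 7:4\beta_{1,3},\ 10:-3\gamma_1$. Row 8: $4:2\beta_{2,3},\ 7:4\beta_{1,2},\ 10:-3\gamma_1$. Row 9: $4:2\beta_{1,3},\ 8:4\beta_{2,1},\ 10:-3\gamma_2$. Row 10: $5:2\beta_{3,1},\ 8:4\beta_{2,3},\ 10:-3\gamma_2$. Row 11: $5:2\beta_{2,1},\ 9:4\beta_{3,2},\ 10:-3\gamma_3$. Row 12: $6:2\beta_{1,2},\ 9:4\beta_{3,1},\ 10:-3\gamma_3$. $\boldsymbol R_2$ ($10\times12$): row 1: $1:\gamma_1,\ 2:2\beta_2,\ 12:2\beta_3$. Row 2: $4:2\beta_1,\ 5:\gamma_2,\ 6:2\beta_3$. Row 3: $8:2\beta_2,\ 9:\gamma_3,\ 10:2\beta_1$. Row 4: $2:\beta_{1,3},\ 3:3\beta_3,\ 4:\beta_{2,3}$. Row 5: $6:\beta_{2,1},\ 7:3\beta_1,\ 8:\beta_{3,1}$. Row 6: $10:\beta_{3,2},\ 11:3\beta_2,\ 12:\beta_{1,2}$. Row 7: $2:\frac{\beta_{1,3}}2,\ 3:\frac{3\beta_2}2,\ 11:\frac{3\beta_3}2,\ 12:\frac{\beta_{1,2}}2$. Row 8: $3:\frac{3\beta_1}2,\ 4:\frac{\beta_{2,3}}2,\ 6:\frac{\beta_{2,1}}2,\ 7:\frac{3\beta_3}2$.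 Row 9: $7:\frac{3\beta_2}2,\ 8:\frac{\beta_{3,1}}2,\ 10:\frac{\beta_{3,2}}2,\ 11:\frac{3\beta_1}2$. Row 10: $3:-\gamma_3,\ 7:-\gamma_1,\ 11:-\gamma_2$. $\boldsymbol R_3$ ($12\times16$): row 1: $1:\gamma_1,\ 2:2\beta_2,\ 12:2\beta_3$. Row 2: $2:\beta_{1,3},\ 3:\beta_2,\ 13:2\beta_3$. Row 3: $3:\frac{\sigma_{1,2}}3,\ 7:\frac{\beta_3}3,\ 11:\frac{\beta_3}3,\ 13:\frac{2\beta_1}3,\ 14:\frac{2\beta_2}3,\ 16:\frac{\beta_3}3$. Row 4: $3:\beta_1,\ 4:\beta_{2,3},\ 14:2\beta_3$. Row 5: $4:2\beta_1,\ 5:\gamma_2,\ 6:2\beta_3$. Row 6: $6:\beta_{2,1},\ 7:\beta_3,\ 14:2\beta_1$. Row 7: $3:\frac{\beta_1}3,\ 7:\frac{\sigma_{2,3}}3,\ 11:\frac{\beta_1}3,\ 14:\frac{2\beta_2}3,\ 15:\frac{2\beta_3}3,\ 16:\frac{\beta_1}3$. Row 8: $7:\beta_2,\ 8:\beta_{3,1},\ 15:2\beta_1$. Row 9: $8:2\beta_2,\ 9:\gamma_3,\ 10:2\beta_1$. Row 10: $10:\beta_{3,2},\ 11:\beta_1,\ 15:2\beta_2$. Row 11: $3:\frac{\beta_2}3,\ 7:\frac{\beta_2}3,\ 11:\frac{\sigma_{1,3}}3,\ 13:\frac{2\beta_1}3,\ 15:\frac{2\beta_3}3,\ 16:\frac{\beta_2}3$.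 Row 12: $11:\beta_3,\ 12:\beta_{1,2},\ 13:2\beta_2$. *)

theory Defs
  imports "HOL-Analysis.Analysis"
begin

definition ps12_pt :: "real^2 \<Rightarrow> real^2 \<Rightarrow> real^2 \<Rightarrow> nat \<Rightarrow> real^2" where
  "ps12_pt p1 p2 p3 i =
    (let p4 = midpoint p1 p2; p5 = midpoint p2 p3; p6 = midpoint p3 p1;
         p7 = midpoint p4 p6; p8 = midpoint p4 p5; p9 = midpoint p5 p6;
         p10 = (1/3) *\<^sub>R (p1 + p2 + p3)
     in [p1, p2, p3, p4, p5, p6, p7, p8, p9, p10] ! (i - 1))"

text \<open>The closed subtriangles, numbered from 1.\<close>

definition ps12_subtriangle :: "real^2 \<Rightarrow> real^2 \<Rightarrow> real^2 \<Rightarrow> nat \<Rightarrow> (real^2) set" where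
  "ps12_subtriangle p1 p2 p3 k =
    convex hull (ps12_pt p1 p2 p3 `
      ([{1,6,7}, {1,4,7}, {2,4,8}, {2,5,8}, {3,5,9}, {3,6,9},
        {6,7,10}, {4,7,10}, {4,8,10}, {5,8,10}, {5,9,10}, {6,9,10}] ! (k - 1)))"

text \<open>
  \<open>T 1, \<dots>, T 12\<close> are half-open subtriangles: each point of the triangle is assigned to
  exactly one of the closed subtriangles containing it. No particular rule
  for the points on common edges is singled out.
\<close>

definition ps12_partition ::
    "real^2 \<Rightarrow> real^2 \<Rightarrow> real^2 \<Rightarrow> (nat \<Rightarrow> (real^2) set) \<Rightarrow> bool" where
  "ps12_partition p1 p2 p3 T \<longleftrightarrow>
    (\<forall>k\<in>{1..12}. T k \<subseteq> ps12_subtriangle p1 p2 p3 k) \<and>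
    disjoint_family_on T {1..12} \<and>
    (\<Union>k\<in>{1..12}. T k) = convex hull {p1, p2, p3}"

text \<open>
  The space \<open>\<real>\<^bsup>d+2\<^esup>\<close> is represented as \<open>(real^2) \<times> (real^'d)\<close> with \<open>d = CARD('d)\<close>, so that
  the projection onto the first two coordinates is \<^const>\<open>fst\<close>. The set \<open>V\<close> consists of
  the \<open>d + 3\<close> vertices of a (nondegenerate) simplex, and these project onto the
  knots in \<open>K\<close>, counted with multiplicity.
\<close>

definition simplex_lift :: "((real^2) \<times> (real^'d)) set \<Rightarrow> (real^2) multiset \<Rightarrow> bool" where
  "simplex_lift V K \<longleftrightarrow>
    card V = CARD('d) + 3 \<and> \<not> affine_dependent V \<and> image_mset fst (mset_set V) = K"

text \<open>
  The simplex spline with knot multiset \<open>K\<close>, normalised with respect to the triangle \<open>\<Delta>\<close>.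
  The fibre of the simplex over \<open>x\<close> is measured in \<open>real^'d\<close>. The choice of the
  simplex is only meaningful for \<open>size K = CARD('d) + 3\<close> and knots not all on one line.
\<close>

definition simplex_spline ::
    "'d::finite itself \<Rightarrow> (real^2) set \<Rightarrow> (real^2) multiset \<Rightarrow> real^2 \<Rightarrow> real" where
  "simplex_spline _ \<Delta> K x =
    (let \<sigma> = convex hull (SOME V :: ((real^2) \<times> (real^'d)) set. simplex_lift V K)
     in measure lebesgue \<Delta> / real ((CARD('d) + 2) choose 2)
          * (measure lebesgue {h :: real^'d. (x, h) \<in> \<sigma>} / measure lebesgue \<sigma>))"

text \<open>\<open>Q[ijklmn;r]\<close>, and \<open>Q[ijklmn]\<close> for \<open>r = 0\<close>.\<close>

definition ps12_Q :: "'d::finite itself \<Rightarrow> real^2 \<Rightarrow> real^2 \<Rightarrow> real^2 \<Rightarrow>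
    nat \<Rightarrow> nat \<Rightarrow> nat \<Rightarrow> nat \<Rightarrow> nat \<Rightarrow> nat \<Rightarrow> nat \<Rightarrow> real^2 \<Rightarrow> real" where
  "ps12_Q D p1 p2 p3 i j k l m n r x =
    (let p = ps12_pt p1 p2 p3 in
     simplex_spline D (convex hull {p1, p2, p3})
      (replicate_mset i (p 1) + replicate_mset j (p 2) + replicate_mset k (p 3) +
       replicate_mset l (p 4) + replicate_mset m (p 5) + replicate_mset n (p 6) +
       replicate_mset r (p 10)) x)"

definition ps12_s0 :: "(nat \<Rightarrow> (real^2) set) \<Rightarrow> real^2 \<Rightarrow> real list" where
  "ps12_s0 T x = map (\<lambda>k. indicator (T k) x) [1..<13]"

definition ps12_s1 :: "real^2 \<Rightarrow> real^2 \<Rightarrow> real^2 \<Rightarrow> real^2 \<Rightarrow> real list" where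
  "ps12_s1 p1 p2 p3 x =
    (let Q = (\<lambda>i j k l m n r. ps12_Q TYPE(1) p1 p2 p3 i j k l m n r x) in
     [1/4 * Q 2 0 0 1 0 1 0,
      1/4 * Q 0 2 0 1 1 0 0,
      1/4 * Q 0 0 2 0 1 1 0,
      1/3 * Q 1 1 0 1 0 0 1,
      1/3 * Q 0 1 1 0 1 0 1,
      1/3 * Q 1 0 1 0 0 1 1,
      1/3 * Q 1 0 0 1 0 1 1,
      1/3 * Q 0 1 0 1 1 0 1,
      1/3 * Q 0 0 1 0 1 1 1,
      1/4 * Q 0 0 0 1 1 1 1])"

definition ps12_s2 :: "real^2 \<Rightarrow> real^2 \<Rightarrow> real^2 \<Rightarrow> real^2 \<Rightarrow> real list" where
  "ps12_s2 p1 p2 p3 x =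
    (let Q = (\<lambda>i j k l m n. ps12_Q TYPE(2) p1 p2 p3 i j k l m n 0 x) in
     [1/4 * Q 3 0 0 1 0 1,
      1/2 * Q 2 1 0 1 0 1,
      3/4 * Q 1 1 0 1 1 1,
      1/2 * Q 1 2 0 1 1 0,
      1/4 * Q 0 3 0 1 1 0,
      1/2 * Q 0 2 1 1 1 0,
      3/4 * Q 0 1 1 1 1 1,
      1/2 * Q 0 1 2 0 1 1,
      1/4 * Q 0 0 3 0 1 1,
      1/2 * Q 1 0 2 0 1 1,
      3/4 * Q 1 0 1 1 1 1,
      1/2 * Q 2 0 1 1 0 1])"

definition ps12_s3 :: "real^2 \<Rightarrow> real^2 \<Rightarrow> real^2 \<Rightarrow> real^2 \<Rightarrow> real list" where
  "ps12_s3 p1 p2 p3 x =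
    (let Q = (\<lambda>i j k l m n. ps12_Q TYPE(3) p1 p2 p3 i j k l m n 0 x) in
     [1/4 * Q 4 0 0 1 0 1,
      1/2 * Q 3 1 0 1 0 1,
      Q 2 2 1 1 0 0,
      1/2 * Q 1 3 0 1 1 0,
      1/4 * Q 0 4 0 1 1 0,
      1/2 * Q 0 3 1 1 1 0,
      Q 1 2 2 0 1 0,
      1/2 * Q 0 1 3 0 1 1,
      1/4 * Q 0 0 4 0 1 1,
      1/2 * Q 1 0 3 0 1 1,
      Q 2 1 2 0 0 1,
      1/2 * Q 3 0 1 1 0 1,
      Q 2 1 1 1 0 1,
      Q 1 2 1 1 1 0,
      Q 1 1 2 0 1 1,
      1/4 * Q 1 1 1 1 1 1])"

definition ps12_dim :: "nat \<Rightarrow> nat" where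
  "ps12_dim d = [12, 10, 12, 16] ! d"

text \<open>\<open>S\<^bsub>j,d\<^esub>(x)\<close> for \<open>d \<le> 3\<close> and \<open>1 \<le> j \<le> ps12_dim d\<close>.\<close>

definition ps12_S :: "real^2 \<Rightarrow> real^2 \<Rightarrow> real^2 \<Rightarrow> (nat \<Rightarrow> (real^2) set) \<Rightarrow>
    nat \<Rightarrow> nat \<Rightarrow> real^2 \<Rightarrow> real" where
  "ps12_S p1 p2 p3 T d j x =
    [ps12_s0 T x, ps12_s1 p1 p2 p3 x, ps12_s2 p1 p2 p3 x, ps12_s3 p1 p2 p3 x] ! d ! (j - 1)"

definition barycentric :: "real^2 \<Rightarrow> real^2 \<Rightarrow> real^2 \<Rightarrow> real^2 \<Rightarrow> real \<times> real \<times> real" where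
  "barycentric p1 p2 p3 x =
    (THE (b1, b2, b3). b1 + b2 + b3 = 1 \<and> x = b1 *\<^sub>R p1 + b2 *\<^sub>R p2 + b3 *\<^sub>R p3)"

text \<open>
  The matrices are sparse: each row is the list of its nonzero entries as pairs
  (column, entry), columns numbered from 1, in terms of the barycentric coordinates.
\<close>

definition R1_rows :: "real \<Rightarrow> real \<Rightarrow> real \<Rightarrow> (nat \<times> real) list list" where
  "R1_rows b1 b2 b3 =
    (let g1 = 2 * b1 - 1; g2 = 2 * b2 - 1; g3 = 2 * b3 - 1 in
     [[(1, g1), (6, 2 * (b3 - b2)), (7, 4 * b2)],
      [(1, g1), (4, 2 * (b2 - b3)), (7, 4 * b3)],
      [(2, g2), (4, 2 * (b1 - b3)), (8, 4 * b3)],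
      [(2, g2), (5, 2 * (b3 - b1)), (8, 4 * b1)],
      [(3, g3), (5, 2 * (b2 - b1)), (9, 4 * b1)],
      [(3, g3), (6, 2 * (b1 - b2)), (9, 4 * b2)],
      [(6, 2 * (b3 - b2)), (7, 4 * (b1 - b3)), (10, - 3 * g1)],
      [(4, 2 * (b2 - b3)), (7, 4 * (b1 - b2)), (10, - 3 * g1)],
      [(4, 2 * (b1 - b3)), (8, 4 * (b2 - b1)), (10, - 3 * g2)],
      [(5, 2 * (b3 - b1)), (8, 4 * (b2 - b3)), (10, - 3 * g2)],
      [(5, 2 * (b2 - b1)), (9, 4 * (b3 - b2)), (10, - 3 * g3)],
      [(6, 2 * (b1 - b2)), (9, 4 * (b3 - b1)), (10, - 3 * g3)]])"

definition R2_rows :: "real \<Rightarrow> real \<Rightarrow> real \<Rightarrow> (nat \<times> real) list list" where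
  "R2_rows b1 b2 b3 =
    (let g1 = 2 * b1 - 1; g2 = 2 * b2 - 1; g3 = 2 * b3 - 1 in
     [[(1, g1), (2, 2 * b2), (12, 2 * b3)],
      [(4, 2 * b1), (5, g2), (6, 2 * b3)],
      [(8, 2 * b2), (9, g3), (10, 2 * b1)],
      [(2, b1 - b3), (3, 3 * b3), (4, b2 - b3)],
      [(6, b2 - b1), (7, 3 * b1), (8, b3 - b1)],
      [(10, b3 - b2), (11, 3 * b2), (12, b1 - b2)],
      [(2, (b1 - b3) / 2), (3, 3 * b2 / 2), (11, 3 * b3 / 2), (12, (b1 - b2) / 2)],
      [(3, 3 * b1 / 2), (4, (b2 - b3) / 2), (6, (b2 - b1) / 2), (7, 3 * b3 / 2)],
      [(7, 3 * b2 / 2), (8, (b3 - b1) / 2), (10, (b3 - b2) / 2), (11, 3 * b1 / 2)],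
      [(3, - g3), (7, - g1), (11, - g2)]])"

definition R3_rows :: "real \<Rightarrow> real \<Rightarrow> real \<Rightarrow> (nat \<times> real) list list" where
  "R3_rows b1 b2 b3 =
    (let g1 = 2 * b1 - 1; g2 = 2 * b2 - 1; g3 = 2 * b3 - 1 in
     [[(1, g1), (2, 2 * b2), (12, 2 * b3)],
      [(2, b1 - b3), (3, b2), (13, 2 * b3)],
      [(3, (b1 + b2) / 3), (7, b3 / 3), (11, b3 / 3),
       (13, 2 * b1 / 3), (14, 2 * b2 / 3), (16, b3 / 3)],
      [(3, b1), (4, b2 - b3), (14, 2 * b3)],
      [(4, 2 * b1), (5, g2), (6, 2 * b3)],
      [(6, b2 - b1), (7, b3), (14, 2 * b1)],
      [(3, b1 / 3), (7, (b2 + b3) / 3), (11, b1 / 3),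
       (14, 2 * b2 / 3), (15, 2 * b3 / 3), (16, b1 / 3)],
      [(7, b2), (8, b3 - b1), (15, 2 * b1)],
      [(8, 2 * b2), (9, g3), (10, 2 * b1)],
      [(10, b3 - b2), (11, b1), (15, 2 * b2)],
      [(3, b2 / 3), (7, b2 / 3), (11, (b1 + b3) / 3),
       (13, 2 * b1 / 3), (15, 2 * b3 / 3), (16, b2 / 3)],
      [(11, b3), (12, b1 - b2), (13, 2 * b2)]])"

text \<open>\<open>R\<^sub>d(i,j)(x)\<close> for \<open>d \<in> {1, 2, 3}\<close>, \<open>1 \<le> i \<le> ps12_dim (d - 1)\<close> and \<open>1 \<le> j \<le> ps12_dim d\<close>.\<close>

definition ps12_R :: "real^2 \<Rightarrow> real^2 \<Rightarrow> real^2 \<Rightarrow> nat \<Rightarrow> nat \<Rightarrow> nat \<Rightarrow> real^2 \<Rightarrow> real" where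
  "ps12_R p1 p2 p3 d i j x =
    (case barycentric p1 p2 p3 x of (b1, b2, b3) \<Rightarrow>
      (case map_of ([R1_rows b1 b2 b3, R2_rows b1 b2 b3, R3_rows b1 b2 b3] ! (d - 1) ! (i - 1)) j of
        None \<Rightarrow> 0
      | Some r \<Rightarrow> r))"

end

theory Submission
  imports Defs
begin

section \<open>Recurrence relations for simplex splines on the 12-split\<close>

text \<open>
  Write the vertices of the simplex defining \<open>Q[K]\<close> in terms of three of them whose projections
  \<open>a, b, c\<close> are not collinear. In barycentric coordinates of the simplex the fibre over \<open>x\<close> becomes
  the polytope of all \<open>t \<ge> 0\<close> for which \<open>x - \<Sum>i. t i *\<^sub>R k i\<close> still has nonnegative homogeneous
  coordinates with respect to \<open>a, b, c\<close>, the \<open>k i\<close> being the remaining knots. The Jacobian of this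
  change of coordinates does not depend on \<open>x\<close>, so it cancels from the quotient
  of the volume of the fibre by the volume of the simplex; in particular the choice of the simplex is irrelevant.
  For the knots of the 12-split these polytopes have dimension at most 3, and iterated integration
  yields every basis function as an explicit combination of truncated powers of
  linear forms in the barycentric coordinates of \<open>x\<close>. Up to permutations of the vertices of the
  triangle there are only twelve of them, and the recurrence relations become polynomial identities
  on each of the twelve regions cut out by the medians and by the lines \<open>2 * b i = 1\<close>.
\<close>

subsection \<open>Volumes by sections\<close>

text \<open>\<open>simplex_spline\<close> takes its simplex from \<open>SOME\<close>: a lift must be
  shown to exist, and the quotient must be computed for an arbitrary lift with the given knots. The
  normalising volume is found by slicing the family of all polytopes the other way. For fixed
  \<open>t\<close> the admissible \<open>x\<close> form an affine image of a slice of the standard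
  simplex of dimension d + 2, whose volume is 1/(d+2)!. The three base knots can be any
  non-collinear ones; each spline gets a base in which its other knots have simple coordinates. All
  identities are pointwise, edges of the split included. For d = 2, 3 the truncated powers agree on
  the borders of closed regions; for d = 1 only membership in a closed subtriangle enters, so every
  assignment of edge points is covered. Signs: wherever an entry of the second or third matrix is
  negative, the spline that it multiplies vanishes. For d = 1 the product is 0 or the value of a
  nonnegative hat function.\<close>

lemma sections_compact:
  fixes A :: "('a::euclidean_space \<times> 'b::euclidean_space) set"
  assumes "compact A"
  shows "compact {y. (x, y) \<in> A}" and "compact {x. (x, y) \<in> A}"
proof -
  have "compact (snd ` (A \<inter> {x} \<times> UNIV))"
    by (intro compact_continuous_image continuous_intros compact_Int_closed assms closed_Times
      closed_singleton closed_UNIV)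
  moreover have "snd ` (A \<inter> {x} \<times> UNIV) = {y. (x, y) \<in> A}"
    by force
  ultimately show "compact {y. (x, y) \<in> A}" by simp
  have "compact (fst ` (A \<inter> UNIV \<times> {y}))"
    by (intro compact_continuous_image continuous_intros compact_Int_closed assms closed_Times
      closed_singleton closed_UNIV)
  moreover have "fst ` (A \<inter> UNIV \<times> {y}) = {x. (x, y) \<in> A}"
    by force
  ultimately show "compact {x. (x, y) \<in> A}" by simp
qed

text \<open>Cavalieri's principle in both directions. Compactness makes all measures finite, so real
  measures can replace \<open>emeasure\<close>; keeping the integral in \<open>ennreal\<close>
  spares integrability arguments.\<close>

lemma measure_lborel_sections:
  fixes A :: "('a::euclidean_space \<times> 'b::euclidean_space) set"
  assumes "compact A"
  shows "ennreal (measure lborel A) =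
    (\<integral>\<^sup>+x. ennreal (measure lborel {y. (x, y) \<in> A}) \<partial>lborel)"
    and "ennreal (measure lborel A) =
      (\<integral>\<^sup>+y. ennreal (measure lborel {x. (x, y) \<in> A}) \<partial>lborel)"
    and "(\<lambda>x. ennreal (measure lborel {y. (x, y) \<in> A})) \<in> borel_measurable lborel"
    and "(\<lambda>y. ennreal (measure lborel {x. (x, y) \<in> A})) \<in> borel_measurable lborel"
proof -
  have A: "A \<in> sets (lborel \<Otimes>\<^sub>M lborel)"
    using assms unfolding lborel_prod by (simp add: borel_compact)
  have eq: "ennreal (measure lborel A) = emeasure (lborel \<Otimes>\<^sub>M lborel) A"
    using emeasure_compact_finite[OF assms] by (simp add: lborel_prod emeasure_eq_ennreal_measure)
  have s1: "emeasure lborel (Pair x -` A) = ennreal (measure lborel {y. (x, y) \<in> A})" for x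
    using emeasure_compact_finite[OF sections_compact(1)[OF assms, of x]]
    by (simp add: emeasure_eq_ennreal_measure vimage_def)
  have s2: "emeasure lborel ((\<lambda>x. (x, y)) -` A) = ennreal (measure lborel {x. (x, y) \<in> A})" for y
    using emeasure_compact_finite[OF sections_compact(2)[OF assms, of y]]
    by (simp add: emeasure_eq_ennreal_measure vimage_def)
  show "ennreal (measure lborel A) =
    (\<integral>\<^sup>+x. ennreal (measure lborel {y. (x, y) \<in> A}) \<partial>lborel)"
    using lborel.emeasure_pair_measure_alt[OF A] by (simp add: eq s1)
  show "ennreal (measure lborel A) =
    (\<integral>\<^sup>+y. ennreal (measure lborel {x. (x, y) \<in> A}) \<partial>lborel)"
    using lborel_pair.emeasure_pair_measure_alt2[OF A] by (simp add: eq s2)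
  show "(\<lambda>x. ennreal (measure lborel {y. (x, y) \<in> A})) \<in> borel_measurable lborel"
    using lborel.measurable_emeasure_Pair[OF A] by (simp add: s1)
  show "(\<lambda>y. ennreal (measure lborel {x. (x, y) \<in> A})) \<in> borel_measurable lborel"
    using lborel_pair.measurable_emeasure_Pair2[OF A] by (simp add: s2)
qed

lemma measure_lebesgue_compact: "compact A \<Longrightarrow> measure lebesgue A = measure lborel A"
  by (simp add: borel_compact)

text \<open>The first rule compares a simplex with its family of fibre polytopes, sliced over the
  plane; the second compares that family with the standard simplex, sliced over the fibre
  coordinates. In both, the factor is a determinant common to all slices.\<close>

lemma measure_lebesgue_sections_scale:
  fixes A B :: "('a::euclidean_space \<times> 'b::euclidean_space) set"
  assumes "compact A" "compact B" and c: "0 \<le> c"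
  shows "(\<And>x. measure lebesgue {y. (x, y) \<in> A} = c * measure lebesgue {y. (x, y) \<in> B})
      \<Longrightarrow> measure lebesgue A = c * measure lebesgue B"
    and "(\<And>y. measure lebesgue {x. (x, y) \<in> A} = c * measure lebesgue {x. (x, y) \<in> B})
      \<Longrightarrow> measure lebesgue A = c * measure lebesgue B"
proof -
  note cs = sections_compact[OF assms(1)] sections_compact[OF assms(2)]
  note m = measure_lebesgue_compact
  assume *: "\<And>x. measure lebesgue {y. (x, y) \<in> A} = c * measure lebesgue {y. (x, y) \<in> B}"
  have "ennreal (measure lborel A) = ennreal c * ennreal (measure lborel B)"
    unfolding measure_lborel_sections(1)[OF assms(1)] measure_lborel_sections(1)[OF assms(2)]
    using * cs c measure_lborel_sections(3)[OF assms(2)]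
    by (simp add: m ennreal_mult' nn_integral_cmult)
  then show "measure lebesgue A = c * measure lebesgue B"
    using c assms by (simp add: m ennreal_mult'[symmetric])
next
  note cs = sections_compact[OF assms(1)] sections_compact[OF assms(2)]
  note m = measure_lebesgue_compact
  assume *: "\<And>y. measure lebesgue {x. (x, y) \<in> A} = c * measure lebesgue {x. (x, y) \<in> B}"
  have "ennreal (measure lborel A) = ennreal c * ennreal (measure lborel B)"
    unfolding measure_lborel_sections(2)[OF assms(1)] measure_lborel_sections(2)[OF assms(2)]
    using * cs c measure_lborel_sections(4)[OF assms(2)]
    by (simp add: m ennreal_mult' nn_integral_cmult)
  then show "measure lebesgue A = c * measure lebesgue B"
    using c assms by (simp add: m ennreal_mult'[symmetric])
qed

subsection \<open>Lifting knots to a simplex\<close>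

lemma noncollinear_unique:
  fixes a b c :: "real^2"
  assumes "\<not> collinear {a, b, c}" and "r + s + t = 0" and "r *\<^sub>R a + s *\<^sub>R b + t *\<^sub>R c = 0"
  shows "r = 0" "s = 0" "t = 0"
proof -
  have ab: "a \<noteq> b" "a \<noteq> c" "b \<noteq> c" using assms(1) by (auto simp: collinear_2 insert_commute)
  have "\<not> affine_dependent {a, b, c}"
    using assms(1) affine_dependent_imp_collinear_3 by blast
  then have *: "\<And>U. sum U {a, b, c} =
    0 \<Longrightarrow> (\<Sum>v\<in>{a, b, c}. U v *\<^sub>R v) =
    0 \<Longrightarrow> \<forall>v\<in>{a, b, c}. U v = 0"
    by (subst (asm) affine_dependent_explicit_finite) auto
  have "\<forall>v\<in>{a, b, c}. (if v = a then r else if v = b then s else t) = 0"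
    by (rule *) (use ab assms in \<open>auto simp: add.assoc\<close>)
  then show "r = 0" "s = 0" "t = 0" using ab by auto
qed

lemma noncollinear_cong:
  fixes a b c :: "real^2"
  assumes "\<not> collinear {a, b, c}" and "r + s + t = r' + s' + t'"
    and "r *\<^sub>R a + s *\<^sub>R b + t *\<^sub>R c = r' *\<^sub>R a + s' *\<^sub>R b + t' *\<^sub>R c"
  shows "r = r'" "s = s'" "t = t'"
proof -
  have e: "(r - r') + (s - s') + (t - t') = 0"
    using assms(2) by simp
  have e': "(r - r') *\<^sub>R a + (s - s') *\<^sub>R b + (t - t') *\<^sub>R c = 0"
    using assms(3) by (simp add: algebra_simps)
  show "r = r'" "s = s'" "t = t'"
    using noncollinear_unique[OF assms(1) e e'] by auto
qed

text \<open>Knots may coincide while the vertices above them differ. The induction removes one knot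
  at a time together with one vertex above it, so the vertices inherit the indices of the
  knots.\<close>

lemma image_mset_fst_enum:
  assumes "finite I" and "image_mset f N = image_mset k (mset_set I)"
  shows "\<exists>v. N = image_mset v (mset_set I) \<and> (\<forall>i\<in>I. f (v i) = k i)"
  using assms
proof (induction I arbitrary: N rule: finite_induct)
  case empty
  then show ?case by simp
next
  case (insert j I)
  then have "image_mset f N = add_mset (k j) (image_mset k (mset_set I))" by simp
  from msed_map_invR[OF this] obtain y N1 where N: "N = add_mset y N1" "f y = k j"
    "image_mset f N1 = image_mset k (mset_set I)" by auto
  from insert.IH[OF N(3)] obtain v where v: "N1 = image_mset v (mset_set I)" "\<forall>i\<in>I. f (v i) = k i"
    by auto
  have "image_mset (v(j := y)) (mset_set I) = image_mset v (mset_set I)"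
    using insert.hyps by (intro image_mset_cong) auto
  then show ?case
    using N v insert.hyps by (intro exI[of _ "v(j := y)"]) (auto simp: fun_upd_def)
qed

text \<open>Splits off one vertex above each base knot and indexes the rest like \<open>k\<close>.
  The equation for \<open>mset_set V\<close> also records that the vertices are distinct; sums over
  \<open>V\<close> are evaluated through it.\<close>

lemma simplex_lift_enum:
  fixes V :: "((real^2) \<times> (real^'d)) set" and k :: "'d::finite \<Rightarrow> real^2"
  assumes "simplex_lift V (add_mset a (add_mset b (add_mset c (image_mset k (mset_set UNIV)))))"
  obtains A B C v where "fst A = a" "fst B = b" "fst C = c" "\<And>i. fst (v i) = k i"
    "finite V" "mset_set V = add_mset A (add_mset B (add_mset C (image_mset v (mset_set UNIV))))"
proof -
  have fin: "finite V" using assms by (auto simp: simplex_lift_def intro: card_ge_0_finite)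
  have "image_mset fst (mset_set V) = add_mset a (add_mset b (add_mset c (image_mset k (mset_set UNIV))))"
    using assms by (simp add: simplex_lift_def)
  from msed_map_invR[OF this] obtain A N1 where 1: "mset_set V = add_mset A N1" "fst A = a"
    "image_mset fst N1 = add_mset b (add_mset c (image_mset k (mset_set UNIV)))" by auto
  from msed_map_invR[OF 1(3)] obtain B N2 where 2: "N1 = add_mset B N2" "fst B = b"
    "image_mset fst N2 = add_mset c (image_mset k (mset_set UNIV))" by auto
  from msed_map_invR[OF 2(3)] obtain C N3 where 3: "N2 = add_mset C N3" "fst C = c"
    "image_mset fst N3 = image_mset k (mset_set UNIV)" by auto
  from image_mset_fst_enum[OF finite 3(3)] obtain v where
    "N3 = image_mset v (mset_set UNIV)" "\<forall>i. fst (v i) = k i" by auto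
  with 1 2 3 fin show ?thesis by (intro that[of A B C v]) auto
qed

lemma simplex_lift_exists:
  fixes k :: "'d::finite \<Rightarrow> real^2"
  assumes nc: "\<not> collinear {a, b, c :: real^2}"
  shows "\<exists>V :: ((real^2) \<times> (real^'d)) set.
    simplex_lift V (add_mset a (add_mset b (add_mset c (image_mset k (mset_set UNIV)))))"
proof -
  \<comment> \<open>The base knots stay at height 0 and the other knots are raised to the unit
    vectors. This keeps repeated knots apart, and in an affine relation the heights force the
    coefficients of all raised vertices to be 0.\<close>
  define v :: "'d \<Rightarrow> (real^2) \<times> (real^'d)" where "v i = (k i, axis i 1)" for i
  define V where "V = insert (a, 0) (insert (b, 0) (insert (c, 0) (range v)))"
  have inj: "inj v" by (auto simp: inj_def v_def axis_eq_axis)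
  have ne: "(p, 0) \<notin> range v" for p by (auto simp: v_def)
  have d: "a \<noteq> b" "a \<noteq> c" "b \<noteq> c" using nc by (auto simp: collinear_2 insert_commute)
  have sumV: "sum f V = f (a, 0) + f (b, 0) + f (c, 0) + (\<Sum>i\<in>UNIV. f (v i))"
    for f :: "_ \<Rightarrow> 'z::ab_group_add"
    unfolding V_def using d ne by (simp add: sum.reindex[OF inj] algebra_simps)
  have "card V = CARD('d) + 3"
    unfolding V_def using d ne by (simp add: card_image[OF inj])
  moreover have "image_mset fst (mset_set V) = add_mset a (add_mset b (add_mset c (image_mset k (mset_set UNIV))))"
    unfolding V_def using d ne
    by (simp add: image_mset_mset_set[OF inj, symmetric] multiset.map_comp o_def) (simp add: v_def)
  moreover have "\<not> affine_dependent V"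
  proof
    assume "affine_dependent V"
    then obtain U where U: "sum U V = 0" "\<exists>z\<in>V. U z \<noteq> 0" "(\<Sum>z\<in>V. U z *\<^sub>R z) = 0"
      by (subst (asm) affine_dependent_explicit_finite) (auto simp: V_def)
    have "(\<Sum>z\<in>V. U z *\<^sub>R snd z) = 0"
      using arg_cong[OF U(3), of snd] by (simp add: snd_sum)
    then have "(\<Sum>i\<in>UNIV. U (v i) *\<^sub>R axis i (1::real)) = 0"
      unfolding sumV by (simp add: v_def)
    then have *: "U (v j) = 0" for j
      by (simp add: vec_eq_iff axis_def if_distrib cong: if_cong)
    have f: "(\<Sum>z\<in>V. U z *\<^sub>R fst z) = 0"
      using arg_cong[OF U(3), of fst] by (simp add: fst_sum)
    have "U (a,0) = 0" "U (b,0) = 0" "U (c,0) = 0"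
      using noncollinear_unique[OF nc, of "U (a,0)" "U (b,0)" "U (c,0)"] U(1) f
      unfolding sumV by (simp_all add: *)
    with U(2) * show False by (auto simp: V_def)
  qed
  ultimately show ?thesis by (auto simp: simplex_lift_def)
qed

lemma sum_UNIV_option:
  fixes f :: "'a::finite option \<Rightarrow> 'b::comm_monoid_add"
  shows "sum f UNIV = f None + (\<Sum>i\<in>UNIV. f (Some i))"
  unfolding UNIV_option_conv by (subst sum.insert) (auto simp: sum.reindex)

lemma convex_hull_mset_enum:
  fixes v :: "'d::finite \<Rightarrow> 'a::real_vector"
  assumes fin: "finite V"
    and V: "mset_set V = add_mset A (add_mset B (add_mset C (image_mset v (mset_set UNIV))))"
  shows "convex hull V = {r *\<^sub>R A + s *\<^sub>R B + t *\<^sub>R C +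
    (\<Sum>i\<in>UNIV. w i *\<^sub>R v i) | r s t w.
    0 \<le> r \<and> 0 \<le> s \<and> 0 \<le> t \<and> (\<forall>i. 0 \<le> w i) \<and>
      r + s + t + (\<Sum>i\<in>UNIV. w i) = 1}"
    (is "_ = ?R")
proof (intro equalityI subsetI)
  have sumV: "sum f V = f A + f B + f C +
    (\<Sum>i\<in>UNIV. f (v i))" for f :: "_ \<Rightarrow> 'z::comm_monoid_add"
    by (simp add: sum_unfold_sum_mset V multiset.map_comp o_def add.assoc)
  have "set_mset (mset_set V) = {A, B, C} \<union> range v" unfolding V by auto
  then have setV: "V = {A, B, C} \<union> range v" using fin by simp
  have sub: "A \<in> V" "B \<in> V" "C \<in> V" "v i \<in> V" for i
    by (auto simp: setV)
  {
    fix x assume "x \<in> convex hull V"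
    then obtain U where U: "\<forall>z\<in>V. 0 \<le> U z" "sum U V = 1" "(\<Sum>z\<in>V. U z *\<^sub>R z) = x"
      by (auto simp: convex_hull_finite[OF fin])
    then have "x = U A *\<^sub>R A + U B *\<^sub>R B + U C *\<^sub>R C + (\<Sum>i\<in>UNIV. U (v i) *\<^sub>R v i)"
      "U A + U B + U C + (\<Sum>i\<in>UNIV. U (v i)) = 1"
      by (simp_all add: sumV)
    moreover have "0 \<le> U A" "0 \<le> U B" "0 \<le> U C" "\<forall>i. 0 \<le> U (v i)"
      using U(1) sub by auto
    ultimately show "x \<in> ?R"
      by (intro CollectI exI[of _ "U A"] exI[of _ "U B"] exI[of _ "U C"] exI[of _ "\<lambda>i. U (v i)"] conjI)
  next
    fix x assume "x \<in> ?R"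
    then obtain r s t w where nn: "0 \<le> r" "0 \<le> s" "0 \<le> t" "\<And>i. 0 \<le> w i"
      and s1: "r + s + t + (\<Sum>i\<in>UNIV. w i) = 1"
      and x: "x = r *\<^sub>R A + s *\<^sub>R B + t *\<^sub>R C + (\<Sum>i\<in>UNIV. w i *\<^sub>R v i)"
      by blast
    \<comment> \<open>Indexing by three nested options over \<open>'d\<close> gives extra indices
      for \<open>A\<close>, \<open>B\<close>, \<open>C\<close>, so \<open>convex_sum\<close> applies
      without inverting the enumeration of \<open>V\<close>.\<close>
    define c where "c = case_option r (case_option s (case_option t w))"
    define y where "y = case_option A (case_option B (case_option C v))"
    have "(\<Sum>i\<in>UNIV. c i *\<^sub>R y i) \<in> convex hull V"
    proof (rule convex_sum)
      show "sum c UNIV = 1"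
        using s1 by (simp add: c_def sum_UNIV_option algebra_simps)
      show "0 \<le> c i" for i using nn by (auto simp: c_def split: option.splits)
      show "y i \<in> convex hull V" for i
        using sub by (auto simp: y_def hull_inc split: option.splits)
    qed auto
    then show "x \<in> convex hull V"
      by (simp add: x c_def y_def sum_UNIV_option algebra_simps)
  }
qed

subsection \<open>Fibres of the simplex\<close>

definition fibre_polytope :: "(real^2 \<Rightarrow> real) \<Rightarrow> (real^2 \<Rightarrow> real)
  \<Rightarrow> (real^2 \<Rightarrow> real) \<Rightarrow>
    ('d::finite \<Rightarrow> real^2) \<Rightarrow> real^2 \<Rightarrow> (real^'d) set" where
  "fibre_polytope la lb lc k x = {t. (\<forall>i. 0 \<le> t $ i) \<and>
    (\<Sum>i\<in>UNIV. t $ i * la (k i)) \<le> la x \<and>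
     (\<Sum>i\<in>UNIV. t $ i * lb (k i)) \<le> lb x \<and> (\<Sum>i\<in>UNIV. t $ i * lc (k i)) \<le> lc x}"

context
  fixes a b c :: "real^2" and la lb lc :: "real^2 \<Rightarrow> real"
  assumes nc: "\<not> collinear {a, b, c}"
    and bary: "\<And>y. la y + lb y + lc y = 1" "\<And>y. la y *\<^sub>R a + lb y *\<^sub>R b +
      lc y *\<^sub>R c = y"
begin

text \<open>The coordinates sum to 1 at every knot, so the slacks of the last three inequalities in
  \<open>fibre_polytope\<close> and the weights \<open>t\<close> add up to 1 by themselves. This is
  why that definition contains no equation for the total weight.\<close>

lemma sum_bary:
  fixes t :: "'d::finite \<Rightarrow> real"
  shows "(\<Sum>i\<in>UNIV. t i) = (\<Sum>i\<in>UNIV. t i * la (k i)) +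
    (\<Sum>i\<in>UNIV. t i * lb (k i)) + (\<Sum>i\<in>UNIV. t i * lc (k i))"
    and "(\<Sum>i\<in>UNIV. t i *\<^sub>R k i) = (\<Sum>i\<in>UNIV. t i * la (k i)) *\<^sub>R a
        + (\<Sum>i\<in>UNIV. t i * lb (k i)) *\<^sub>R b + (\<Sum>i\<in>UNIV. t i * lc (k i)) *\<^sub>R c"
proof -
  show "(\<Sum>i\<in>UNIV. t i) = (\<Sum>i\<in>UNIV. t i * la (k i)) +
    (\<Sum>i\<in>UNIV. t i * lb (k i)) + (\<Sum>i\<in>UNIV. t i * lc (k i))"
    by (simp add: sum.distrib[symmetric] distrib_left[symmetric] bary(1))
  have "(\<Sum>i\<in>UNIV. t i *\<^sub>R k i) = (\<Sum>i\<in>UNIV. t i *\<^sub>R (la (k i) *\<^sub>R a +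
    lb (k i) *\<^sub>R b + lc (k i) *\<^sub>R c))"
    by (simp only: bary(2))
  then show "(\<Sum>i\<in>UNIV. t i *\<^sub>R k i) = (\<Sum>i\<in>UNIV. t i * la (k i)) *\<^sub>R a
        + (\<Sum>i\<in>UNIV. t i * lb (k i)) *\<^sub>R b + (\<Sum>i\<in>UNIV. t i * lc (k i)) *\<^sub>R c"
    by (simp add: scaleR_right_distrib sum.distrib scaleR_sum_left)
qed

text \<open>Given \<open>t\<close>, the projection to \<open>x\<close> determines the weights of
  \<open>A\<close>, \<open>B\<close>, \<open>C\<close>. The height is then affine in
  \<open>t\<close> with a linear part free of \<open>x\<close>: the point enters only through the
  translation and the polytope.\<close>

lemma fibre_eq_image:
  fixes k :: "'d::finite \<Rightarrow> real^2" and v :: "'d \<Rightarrow> (real^2) \<times> (real^'d)"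
  assumes fst: "fst A = a" "fst B = b" "fst C = c" "\<And>i. fst (v i) = k i"
    and fin: "finite V"
    and V: "mset_set V = add_mset A (add_mset B (add_mset C (image_mset v (mset_set UNIV))))"
  shows "{h. (x, h) \<in> convex hull V} =
    (+) (la x *\<^sub>R snd A + lb x *\<^sub>R snd B + lc x *\<^sub>R snd C) `
    (\<lambda>t. \<Sum>i\<in>UNIV. t $ i *\<^sub>R (snd (v i) - la (k i) *\<^sub>R snd A - lb (k i)
      *\<^sub>R snd B - lc (k i) *\<^sub>R snd C)) `
    fibre_polytope la lb lc k x" (is "_ = (+) ?H ` ?L ` ?P")
proof -
  have L: "?L t = (\<Sum>i\<in>UNIV. t $ i *\<^sub>R snd (v i)) - (\<Sum>i\<in>UNIV. t $ i * la (k i))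
    *\<^sub>R snd A
     - (\<Sum>i\<in>UNIV. t $ i * lb (k i)) *\<^sub>R snd B - (\<Sum>i\<in>UNIV. t $ i * lc (k i))
       *\<^sub>R snd C" for t
    by (simp add: scaleR_right_diff_distrib sum_subtractf scaleR_sum_left)
  show ?thesis
  proof (intro equalityI subsetI)
    fix h assume "h \<in> {h. (x, h) \<in> convex hull V}"
    then obtain r s q w where nn: "0 \<le> r" "0 \<le> s" "0 \<le> q" "\<And>i. 0 \<le> w i"
      and s1: "r + s + q + (\<Sum>i\<in>UNIV. w i) = 1"
      and xh: "(x, h) = r *\<^sub>R A + s *\<^sub>R B + q *\<^sub>R C + (\<Sum>i\<in>UNIV. w i *\<^sub>R v i)"
      unfolding convex_hull_mset_enum[OF fin V] by blast
    define t :: "real^'d" where "t = (\<chi> i. w i)"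
    have w: "w i = t $ i" for i by (simp add: t_def)
    have x: "r *\<^sub>R a + s *\<^sub>R b + q *\<^sub>R c + (\<Sum>i\<in>UNIV. t $ i *\<^sub>R k i) = x"
      using arg_cong[OF xh, of fst] by (simp add: fst_sum fst w)
    have h: "h = r *\<^sub>R snd A + s *\<^sub>R snd B + q *\<^sub>R snd C +
      (\<Sum>i\<in>UNIV. t $ i *\<^sub>R snd (v i))"
      using arg_cong[OF xh, of snd] by (simp add: snd_sum w)
    note sb = sum_bary[where t="\<lambda>i. t $ i" and k=k]
    \<comment> \<open>With the knots expanded in \<open>a, b, c\<close>, both sides are combinations
      of the base with equal coefficient sums, so the coefficients can be compared one by
      one.\<close>
    have 1: "(r + (\<Sum>i\<in>UNIV. t $ i * la (k i))) + (s + (\<Sum>i\<in>UNIV. t $ i * lb (k i)))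
        + (q + (\<Sum>i\<in>UNIV. t $ i * lc (k i))) = la x + lb x + lc x"
      using s1 sb(1) by (simp add: bary(1) w)
    have 2: "(r + (\<Sum>i\<in>UNIV. t $ i * la (k i))) *\<^sub>R a + (s +
      (\<Sum>i\<in>UNIV. t $ i * lb (k i))) *\<^sub>R b
        + (q + (\<Sum>i\<in>UNIV. t $ i * lc (k i))) *\<^sub>R c = la x *\<^sub>R a + lb x *\<^sub>R b +
          lc x *\<^sub>R c"
      unfolding bary(2) using x sb(2) by (simp add: algebra_simps)
    note e = noncollinear_cong[OF nc 1 2]
    have "t \<in> ?P"
      using nn e w by (simp add: fibre_polytope_def)
    moreover have "h = ?H + ?L t"
      unfolding h L e[symmetric] by (simp add: algebra_simps)
    ultimately show "h \<in> (+) ?H ` ?L ` ?P" by blast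
  next
    fix h assume "h \<in> (+) ?H ` ?L ` ?P"
    then obtain t where t: "t \<in> ?P" and h: "h = ?H + ?L t" by blast
    define r where "r = la x - (\<Sum>i\<in>UNIV. t $ i * la (k i))"
    define s where "s = lb x - (\<Sum>i\<in>UNIV. t $ i * lb (k i))"
    define q where "q = lc x - (\<Sum>i\<in>UNIV. t $ i * lc (k i))"
    note sb = sum_bary[where t="\<lambda>i. t $ i" and k=k]
    have nn: "0 \<le> r" "0 \<le> s" "0 \<le> q" "\<forall>i. 0 \<le> t $ i"
      using t by (auto simp: fibre_polytope_def r_def s_def q_def)
    have s1: "r + s + q + (\<Sum>i\<in>UNIV. t $ i) = 1"
      using sb(1) bary(1)[of x] by (simp add: r_def s_def q_def)
    have "r *\<^sub>R a + s *\<^sub>R b + q *\<^sub>R c + (\<Sum>i\<in>UNIV. t $ i *\<^sub>R k i) = x"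
      using bary(2)[of x] unfolding sb(2) r_def s_def q_def by (simp add: algebra_simps)
    moreover have "r *\<^sub>R snd A + s *\<^sub>R snd B + q *\<^sub>R snd C +
      (\<Sum>i\<in>UNIV. t $ i *\<^sub>R snd (v i)) = h"
      unfolding h L r_def s_def q_def by (simp add: algebra_simps)
    ultimately have "(x, h) = r *\<^sub>R A + s *\<^sub>R B + q *\<^sub>R C +
      (\<Sum>i\<in>UNIV. t $ i *\<^sub>R v i)"
      by (intro prod_eqI) (simp_all add: fst_sum snd_sum fst)
    then show "h \<in> {h. (x, h) \<in> convex hull V}"
      unfolding convex_hull_mset_enum[OF fin V] using nn s1 by blast
  qed
qed

end

section \<open>Total volume of the simplex and the normalised quotient\<close>

lemma std_simplex_prod:
  "convex hull (insert 0 Basis) = {(p :: real^2, t :: real^'d::finite).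
     0 \<le> p $ 1 \<and> 0 \<le> p $ 2 \<and> (\<forall>i. 0 \<le> t $ i) \<and>
       p $ 1 + p $ 2 + (\<Sum>i\<in>UNIV. t $ i) \<le> 1}"
proof -
  have B: "(Basis :: ((real^2) \<times> (real^'d)) set) =
     (\<lambda>i. (axis i 1, 0)) ` UNIV \<union> (\<lambda>i. (0, axis i 1)) ` UNIV"
    by (auto simp: Basis_prod_def Basis_vec_def)
  have disj: "(\<lambda>i. (axis i 1, 0)) ` UNIV \<inter> (\<lambda>i. (0, axis i 1)) ` UNIV
      = ({} :: ((real^2) \<times> (real^'d)) set)"
    by auto
  have inj: "inj (\<lambda>i. (axis i 1, 0) :: (real^2) \<times> (real^'d))"
    "inj (\<lambda>i. (0, axis i 1) :: (real^2) \<times> (real^'d))"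
    by (auto simp: inj_def axis_eq_axis)
  have "sum ((\<bullet>) z) Basis = fst z $ 1 + fst z $ 2 + (\<Sum>i\<in>UNIV. snd z $ i)"
    for z :: "(real^2) \<times> (real^'d)"
    unfolding B
    by (subst sum.union_disjoint[OF _ _ disj])
       (auto simp: sum.reindex[OF inj(1)] sum.reindex[OF inj(2)] inner_prod_def inner_axis sum_2)
  moreover have "(\<forall>i\<in>Basis. 0 \<le> z \<bullet> i) \<longleftrightarrow> 0 \<le> fst z $ 1
    \<and> 0 \<le> fst z $ 2 \<and> (\<forall>i. 0 \<le> snd z $ i)"
    for z :: "(real^2) \<times> (real^'d)"
    unfolding B ball_Un by (simp add: inner_prod_def inner_axis forall_2)
  ultimately show ?thesis
    unfolding std_simplex by auto
qed

text \<open>Twice the signed area, and the determinant of the linear map with columns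
  \<open>b - a\<close> and \<open>c - a\<close>.\<close>

definition tri_det :: "real^2 \<Rightarrow> real^2 \<Rightarrow> real^2 \<Rightarrow> real" where
  "tri_det a b c = (b $ 1 - a $ 1) * (c $ 2 - a $ 2) - (c $ 1 - a $ 1) * (b $ 2 - a $ 2)"

lemma measure_triangle:
  "measure lebesgue (convex hull {a, b, c :: real^2}) = \<bar>tri_det a b c\<bar> / 2"
proof -
  have "compact (convex hull {a, b, c})"
    by (intro finite_imp_compact_convex_hull) auto
  then have "measure lebesgue (convex hull {a, b, c}) = measure lborel (convex hull {a, b, c})"
    by (rule measure_lebesgue_compact)
  then show ?thesis
    by (simp add: content_triangle tri_det_def abs_minus_commute mult.commute)
qed

context
  fixes a b c :: "real^2" and la lb lc :: "real^2 \<Rightarrow> real"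
  assumes nc: "\<not> collinear {a, b, c}"
    and bary: "\<And>y. la y + lb y + lc y = 1" "\<And>y. la y *\<^sub>R a + lb y *\<^sub>R b +
      lc y *\<^sub>R c = y"
begin

text \<open>Here \<open>p\<close> holds the weights of \<open>b\<close> and \<open>c\<close>, and
  the weight of \<open>a\<close> is the slack in the last inequality of the standard simplex. The
  pairs \<open>(x, t)\<close> are thus an image of that simplex under a map that leaves
  \<open>t\<close> fixed.\<close>

lemma fibre_polytope_total:
  fixes k :: "'d::finite \<Rightarrow> real^2"
  shows "t \<in> fibre_polytope la lb lc k x \<longleftrightarrow>
    (\<exists>p :: real^2. (p, t) \<in> convex hull (insert 0 Basis) \<and>
      x = (a + (\<Sum>i\<in>UNIV. t $ i *\<^sub>R (k i - a))) + (p $ 1 *\<^sub>R (b - a) +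
        p $ 2 *\<^sub>R (c - a)))"
    (is "_ \<longleftrightarrow> (\<exists>p. _ \<and> x = ?\<psi> p)")
proof -
  note sb = sum_bary[OF nc bary, where t="\<lambda>i. t $ i" and k=k]
  define S where "S = (\<Sum>i\<in>UNIV. t $ i)"
  have \<psi>: "?\<psi> p = (1 - p $ 1 - p $ 2 - S + (\<Sum>i\<in>UNIV. t $ i * la (k i))) *\<^sub>R a
     + (p $ 1 + (\<Sum>i\<in>UNIV. t $ i * lb (k i))) *\<^sub>R b + (p $ 2 +
       (\<Sum>i\<in>UNIV. t $ i * lc (k i))) *\<^sub>R c"
    for p :: "real^2"
  proof -
    have "(\<Sum>i\<in>UNIV. t $ i *\<^sub>R (k i - a)) = (\<Sum>i\<in>UNIV. t $ i *\<^sub>R k i) - S *\<^sub>R a"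
      by (simp add: scaleR_right_diff_distrib sum_subtractf scaleR_sum_left S_def)
    then show ?thesis unfolding sb(2) by (simp add: algebra_simps)
  qed
  have eq: "x = ?\<psi> p \<longleftrightarrow> la x = 1 - p $ 1 - p $ 2 - S +
    (\<Sum>i\<in>UNIV. t $ i * la (k i)) \<and>
      lb x = p $ 1 + (\<Sum>i\<in>UNIV. t $ i * lb (k i)) \<and> lc x = p $ 2 +
        (\<Sum>i\<in>UNIV. t $ i * lc (k i))" for p
  proof
    assume x: "x = ?\<psi> p"
    have "la x + lb x + lc x = (1 - p $ 1 - p $ 2 - S + (\<Sum>i\<in>UNIV. t $ i * la (k i)))
      + (p $ 1 + (\<Sum>i\<in>UNIV. t $ i * lb (k i))) + (p $ 2 + (\<Sum>i\<in>UNIV. t $ i * lc (k i)))"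
      using sb(1) by (simp add: bary(1) S_def)
    from noncollinear_cong[OF nc this] show "la x = 1 - p $ 1 - p $ 2 - S +
      (\<Sum>i\<in>UNIV. t $ i * la (k i)) \<and>
      lb x = p $ 1 + (\<Sum>i\<in>UNIV. t $ i * lb (k i)) \<and> lc x = p $ 2 +
        (\<Sum>i\<in>UNIV. t $ i * lc (k i))"
      using x unfolding \<psi> bary(2) by simp
  next
    assume *: "la x = 1 - p $ 1 - p $ 2 - S + (\<Sum>i\<in>UNIV. t $ i * la (k i)) \<and>
      lb x = p $ 1 + (\<Sum>i\<in>UNIV. t $ i * lb (k i)) \<and> lc x = p $ 2 +
        (\<Sum>i\<in>UNIV. t $ i * lc (k i))"
    show "x = ?\<psi> p"
      unfolding \<psi> using bary(2)[of x] * by metis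
  qed
  show ?thesis
  proof
    assume t: "t \<in> fibre_polytope la lb lc k x"
    define p :: "real^2" where "p =
      vector [lb x - (\<Sum>i\<in>UNIV. t $ i * lb (k i)), lc x - (\<Sum>i\<in>UNIV. t $ i * lc (k i))]"
    have "(p, t) \<in> convex hull (insert 0 Basis)"
      using t bary(1)[of x] sb(1) by (simp add: std_simplex_prod fibre_polytope_def p_def)
    moreover have "x = ?\<psi> p"
      unfolding eq using bary(1)[of x] sb(1) by (simp add: p_def S_def)
    ultimately show "\<exists>p. (p, t) \<in> convex hull (insert 0 Basis) \<and> x = ?\<psi> p" by blast
  next
    assume "\<exists>p. (p, t) \<in> convex hull (insert 0 Basis) \<and> x = ?\<psi> p"
    then obtain p where p: "(p, t) \<in> convex hull (insert 0 Basis)" "x = ?\<psi> p" by blast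
    from p(2) show "t \<in> fibre_polytope la lb lc k x"
      using p(1) unfolding eq by (simp add: std_simplex_prod fibre_polytope_def S_def)
  qed
qed

text \<open>Over a fixed \<open>t\<close> the parametrisation of \<open>x\<close> is a translation
  by \<open>\<tau> t\<close> after the linear map \<open>\<phi>\<close>, so every slice of the
  standard simplex is scaled by the determinant of \<open>\<phi>\<close>, which is
  \<open>tri_det a b c\<close>.\<close>

lemma fibre_polytope_compact_measure:
  fixes k :: "'d::finite \<Rightarrow> real^2"
  shows "compact {(x, t). t \<in> fibre_polytope la lb lc k x}" (is "compact ?P")
    and "measure lebesgue {(x, t). t \<in> fibre_polytope la lb lc k x} =
      \<bar>tri_det a b c\<bar> / fact (CARD('d) + 2)"
proof -
  define std where "std = convex hull (insert 0 Basis :: ((real^2) \<times> (real^'d)) set)"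
  have cstd: "compact std"
    unfolding std_def by (intro finite_imp_compact_convex_hull) auto
  define \<phi> where "\<phi> p = p $ 1 *\<^sub>R (b - a) + p $ 2 *\<^sub>R (c - a)" for p :: "real^2"
  define \<tau> where "\<tau> t = a + (\<Sum>i\<in>UNIV. t $ i *\<^sub>R (k i - a))" for t :: "real^'d"
  have P: "?P = (\<lambda>(p, t). (\<tau> t + \<phi> p, t)) ` std"
    by (auto simp: fibre_polytope_total std_def \<tau>_def \<phi>_def)
  show cP: "compact ?P"
    unfolding P by (rule compact_continuous_image[OF _ cstd])
      (auto simp: split_beta \<tau>_def \<phi>_def intro!: continuous_intros)
  have lin: "linear \<phi>"
    by (rule linearI) (simp_all add: \<phi>_def algebra_simps)
  have det: "det (matrix \<phi>) = tri_det a b c"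
    by (simp add: det_2 matrix_def \<phi>_def axis_def tri_det_def)
  have "measure lebesgue ?P = \<bar>tri_det a b c\<bar> * measure lebesgue std"
  proof (rule measure_lebesgue_sections_scale(2)[OF cP cstd])
    fix t
    have "{x. (x, t) \<in> ?P} = (+) (\<tau> t) ` \<phi> ` {p. (p, t) \<in> std}"
      unfolding P by force
    then have "measure lebesgue {x. (x, t) \<in> ?P} = measure lebesgue (\<phi> ` {p. (p, t) \<in> std})"
      by (simp only: measure_translation)
    also have "\<dots> = \<bar>tri_det a b c\<bar> * measure lebesgue {p. (p, t) \<in> std}"
      unfolding det[symmetric]
      by (rule measure_linear_image[OF lin lmeasurable_compact[OF sections_compact(2)[OF cstd]]])
    finally show "measure lebesgue {x. (x, t) \<in> ?P} =
      \<bar>tri_det a b c\<bar> * measure lebesgue {p. (p, t) \<in> std}" .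
  qed simp
  also have "measure lebesgue std = 1 / fact (CARD('d) + 2)"
    unfolding measure_lebesgue_compact[OF cstd] unfolding std_def content_std_simplex by (simp add: add.commute)
  finally show "measure lebesgue ?P = \<bar>tri_det a b c\<bar> / fact (CARD('d) + 2)" by simp
qed

text \<open>The determinant of \<open>L\<close> scales each fibre, hence also the total volume, and
  cancels. The constant arises from (d+2)! = 2 d! binom(d+2, 2). The sort \<open>wellorder\<close>
  is that of the change of variables for linear maps.\<close>

lemma simplex_spline_eq:
  fixes k :: "'d::{finite,wellorder} \<Rightarrow> real^2"
  shows "simplex_spline TYPE('d) \<Delta>
      (add_mset a (add_mset b (add_mset c (image_mset k (mset_set UNIV))))) x =
    2 * measure lebesgue \<Delta> / \<bar>tri_det a b c\<bar> * fact CARD('d) * measure lebesgue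
      (fibre_polytope la lb lc k x)"
proof -
  define K where "K = add_mset a (add_mset b (add_mset c (image_mset k (mset_set UNIV))))"
  define V :: "((real^2) \<times> ((real, 'd) vec)) set" where "V = (SOME V. simplex_lift V K)"
  have V: "simplex_lift V K"
    unfolding V_def by (rule someI_ex) (unfold K_def, rule simplex_lift_exists[OF nc])
  from V[unfolded K_def] obtain A B C v where e: "fst A = a" "fst B = b" "fst C = c" "\<And>i. fst (v i) = k i"
    "finite V" "mset_set V = add_mset A (add_mset B (add_mset C (image_mset v (mset_set UNIV))))"
    by (rule simplex_lift_enum) (rule that)
  let ?\<sigma> = "convex hull V"
  define P where "P = {(x, t). t \<in> fibre_polytope la lb lc k x}"
  define H where "H x = la x *\<^sub>R snd A + lb x *\<^sub>R snd B + lc x *\<^sub>R snd C" for x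
  define L where "L t = (\<Sum>i\<in>UNIV. t $ i *\<^sub>R (snd (v i) - la (k i) *\<^sub>R snd A - lb (k
    i) *\<^sub>R snd B - lc (k i) *\<^sub>R snd C))"
    for t :: "(real, 'd) vec"
  have lin: "linear L"
    unfolding L_def by (rule linearI) (simp_all add: scaleR_left_distrib sum.distrib scaleR_sum_right)
  have cP: "compact P" unfolding P_def by (rule fibre_polytope_compact_measure)
  have c\<sigma>: "compact ?\<sigma>" by (intro finite_imp_compact_convex_hull e)
  have fib: "measure lebesgue {h. (x, h) \<in> ?\<sigma>} =
    \<bar>det (matrix L)\<bar> * measure lebesgue (fibre_polytope la lb lc k x)" for x
  proof -
    have "{h. (x, h) \<in> ?\<sigma>} = (+) (H x) ` L ` fibre_polytope la lb lc k x"
      unfolding H_def L_def by (rule fibre_eq_image[OF nc bary e])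
    then have "measure lebesgue {h. (x, h) \<in> ?\<sigma>} = measure lebesgue (L ` fibre_polytope la lb lc k x)"
      by (simp only: measure_translation)
    also have "\<dots> = \<bar>det (matrix L)\<bar> * measure lebesgue (fibre_polytope la lb lc k x)"
      using lmeasurable_compact[OF sections_compact(1)[OF cP, of x]]
      by (intro measure_linear_image[OF lin]) (simp add: P_def)
    finally show ?thesis .
  qed
  have tot: "measure lebesgue ?\<sigma> = \<bar>det (matrix L)\<bar> * measure lebesgue P"
    by (rule measure_lebesgue_sections_scale(1)[OF c\<sigma> cP]) (simp_all add: fib P_def)
  \<comment> \<open>The determinant is nonzero because the volume is: an affinely independent vertex
    set spans a simplex with interior points, and its measure is a multiple of the
    determinant.\<close>
  have "interior ?\<sigma> \<noteq> {}"
    using V by (subst interior_convex_hull_eq_empty) (auto simp: simplex_lift_def)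
  then have "\<not> negligible ?\<sigma>"
    using open_not_negligible negligible_subset[OF _ interior_subset] by blast
  then have "measure lebesgue ?\<sigma> \<noteq> 0"
    using negligible_iff_measure0[OF lmeasurable_compact[OF c\<sigma>]] by simp
  then have d0: "\<bar>det (matrix L)\<bar> \<noteq> 0" unfolding tot by auto
  have "fact (n + 2) = 2 * fact n * ((n + 2) choose 2)" for n :: nat
    using binomial_fact_lemma[of 2 "n + 2"] by (simp only: diff_add_inverse2 fact_2 le_add2)
  from arg_cong[OF this[of "CARD('d)"], of real]
  have bin: "(fact (CARD('d) + 2) :: real) = 2 * fact CARD('d) * real ((CARD('d) + 2) choose 2)"
    by (simp only: of_nat_mult of_nat_fact of_nat_numeral)
  have "simplex_spline TYPE('d) \<Delta> K x = measure lebesgue \<Delta> / real ((CARD('d) + 2) choose 2)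
     * (measure lebesgue {h. (x, h) \<in> ?\<sigma>} / measure lebesgue ?\<sigma>)"
    by (simp add: simplex_spline_def V_def Let_def)
  also have "\<dots> = measure lebesgue \<Delta> / real ((CARD('d) + 2) choose 2) *
      (measure lebesgue (fibre_polytope la lb lc k x) / measure lebesgue P)"
    unfolding fib tot using d0 by simp
  also have "measure lebesgue P = \<bar>tri_det a b c\<bar> / fact (CARD('d) + 2)"
    unfolding P_def by (rule fibre_polytope_compact_measure)
  finally show ?thesis
    unfolding K_def bin by (simp add: field_simps)
qed

end

subsection \<open>Volumes of the fibres\<close>

text \<open>The fibres live in \<open>real^n\<close>, the iterated integrals in products of
  \<open>real\<close>. A linear map that matches the two bases pulls boxes back to boxes with the
  same side lengths, and boxes determine \<open>lborel\<close>.\<close>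

lemma measure_lborel_isometry:
  fixes f :: "'a::euclidean_space \<Rightarrow> 'b::euclidean_space"
  assumes lin: "linear f" and bij: "bij_betw f Basis Basis" and S: "compact S"
  shows "measure lebesgue S = measure lborel (f -` S)" and "compact (f -` S)"
proof -
  have fin: "f b \<in> Basis" if "b \<in> Basis" for b using bij that by (auto simp: bij_betw_def)
  have inn: "f x \<bullet> f b = x \<bullet> b" if b: "b \<in> Basis" for x b
  proof -
    have "f x = (\<Sum>c\<in>Basis. (x \<bullet> c) *\<^sub>R f c)"
      by (subst euclidean_representation[of x, symmetric]) (simp only: linear_sum[OF lin] linear_cmul[OF lin])
    then have "f x \<bullet> f b = (\<Sum>c\<in>Basis. (x \<bullet> c) * (f c \<bullet> f b))"
      by (simp add: inner_sum_left)
    also have "\<dots> = (\<Sum>c\<in>Basis. if c = b then x \<bullet> b else 0)"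
    proof (rule sum.cong[OF refl])
      fix c :: 'a assume c: "c \<in> Basis"
      have "f c = f b \<longleftrightarrow> c = b"
        by (rule inj_on_eq_iff[OF bij_betw_imp_inj_on[OF bij] c b])
      then show "(x \<bullet> c) * (f c \<bullet> f b) = (if c = b then x \<bullet> b else 0)"
        by (simp add: inner_Basis fin b c)
    qed
    finally show ?thesis using b by simp
  qed
  have cont: "continuous_on UNIV f"
    by (rule linear_continuous_on[OF lin[unfolded linear_conv_bounded_linear]])
  then have meas: "f \<in> measurable lborel borel"
    by (simp add: borel_measurable_continuous_onI)
  have "lborel = distr lborel borel f"
  proof (rule lborel_eqI)
    fix l u :: 'b assume lu: "\<And>b. b \<in> Basis \<Longrightarrow> l \<bullet> b \<le> u \<bullet> b"
    define l' where "l' = (\<Sum>b\<in>Basis. (l \<bullet> f b) *\<^sub>R b)"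
    define u' where "u' = (\<Sum>b\<in>Basis. (u \<bullet> f b) *\<^sub>R b)"
    have l': "l' \<bullet> b = l \<bullet> f b" and u': "u' \<bullet> b = u \<bullet> f b" if "b \<in> Basis" for b
      using that by (simp_all add: l'_def u'_def)
    have "f x \<in> box l u \<longleftrightarrow> x \<in> box l' u'" for x
    proof -
      have "f x \<in> box l u \<longleftrightarrow> (\<forall>c\<in>f ` Basis. l \<bullet> c < f x
        \<bullet> c \<and> f x \<bullet> c < u \<bullet> c)"
        using bij by (simp add: mem_box bij_betw_def)
      then show ?thesis by (simp add: mem_box l' u' inn)
    qed
    then have "f -` box l u = box l' u'"
      by (intro set_eqI) (simp only: vimage_eq)
    then have "emeasure (distr lborel borel f) (box l u) = emeasure lborel (box l' u')"
      by (simp add: emeasure_distr[OF meas])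
    also have "\<dots> = (\<Prod>b\<in>Basis. (u' - l') \<bullet> b)"
      by (rule emeasure_lborel_box) (simp add: l' u' lu fin)
    also have "(\<Prod>b\<in>Basis. (u' - l') \<bullet> b) = (\<Prod>b\<in>Basis. (u - l) \<bullet> f b)"
      by (intro prod.cong) (simp_all add: inner_diff_left l' u')
    also have "\<dots> = (\<Prod>b\<in>Basis. (u - l) \<bullet> b)"
      by (rule prod.reindex_bij_betw[OF bij])
    finally show "emeasure (distr lborel borel f) (box l u) = (\<Prod>b\<in>Basis. (u - l) \<bullet> b)" .
  qed simp
  then have "measure lborel S = measure (distr lborel borel f) S" by simp
  also have "\<dots> = measure lborel (f -` S)"
    using S by (subst measure_distr[OF meas]) (simp_all add: borel_compact)
  finally show "measure lebesgue S = measure lborel (f -` S)"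
    by (simp add: measure_lebesgue_compact[OF S])
  obtain B where B: "\<And>y. y \<in> S \<Longrightarrow> norm y \<le> B"
    using compact_imp_bounded[OF S] unfolding bounded_iff by blast
  have "norm x \<le> (\<Sum>b\<in>(Basis :: 'a set). B)" if x: "x \<in> f -` S" for x
  proof -
    have "norm x \<le> (\<Sum>b\<in>Basis. \<bar>x \<bullet> b\<bar>)" by (rule norm_le_l1)
    also have "\<dots> \<le> (\<Sum>b\<in>(Basis :: 'a set). B)"
    proof (rule sum_mono)
      fix b :: 'a assume b: "b \<in> Basis"
      have "\<bar>x \<bullet> b\<bar> \<le> norm (f x)"
        unfolding inn[OF b, symmetric] by (rule Basis_le_norm[OF fin[OF b]])
      also have "\<dots> \<le> B" using B x by blast
      finally show "\<bar>x \<bullet> b\<bar> \<le> B" .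
    qed
    finally show ?thesis .
  qed
  then have "bounded (f -` S)"
    unfolding bounded_iff by blast
  moreover have "closed (f -` S)"
    using continuous_closed_vimage[OF compact_imp_closed[OF S], of f] cont
    by (simp add: continuous_on_eq_continuous_at)
  ultimately show "compact (f -` S)" by (simp add: compact_eq_bounded_closed)
qed

lemma measure_real1:
  fixes S :: "(real^1) set"
  assumes "compact S"
  shows "measure lebesgue S = measure lborel {t. vector [t] \<in> S}"
proof -
  have b: "bij_betw (\<lambda>t::real. vector [t] :: real^1) Basis Basis"
    by (auto simp: bij_betw_def Basis_vec_def vec_eq_iff axis_def)
  have l: "linear (\<lambda>t::real. vector [t] :: real^1)"
    by (rule linearI) (simp_all add: vec_eq_iff)
  show ?thesis
    using measure_lborel_isometry(1)[OF l b assms] by (simp add: vimage_def)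
qed

lemma measure_real2:
  fixes S :: "(real^2) set"
  assumes "compact S"
  shows "measure lebesgue S = measure lborel {(t, u). vector [t, u] \<in> S}"
proof -
  let ?f = "\<lambda>z::real \<times> real. vector [fst z, snd z] :: real^2"
  have "?f (1, 0) = axis 1 1" "?f (0, 1) = axis 2 1"
    by (simp_all add: vec_eq_iff forall_2 axis_def)
  moreover have "(axis 1 1 :: real^2) \<noteq> axis 2 1" by (simp add: axis_eq_axis)
  ultimately have b: "bij_betw ?f Basis Basis"
    by (simp add: bij_betw_def Basis_vec_def Basis_prod_def UNIV_2)
  have l: "linear ?f"
    by (rule linearI) (simp_all add: vec_eq_iff forall_2)
  show ?thesis
    using measure_lborel_isometry(1)[OF l b assms] by (simp add: vimage_def case_prod_unfold)
qed

lemma measure_real3: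
  fixes S :: "(real^3) set"
  assumes "compact S"
  shows "measure lebesgue S = measure lborel {(t, u, v). vector [t, u, v] \<in> S}"
proof -
  let ?f = "\<lambda>z::real \<times> real \<times> real. vector [fst z, fst (snd z), snd (snd z)] :: real^3"
  have "?f (1, 0, 0) = axis 1 1" "?f (0, 1, 0) = axis 2 1" "?f (0, 0, 1) = axis 3 1"
    by (simp_all add: vec_eq_iff forall_3 axis_def)
  moreover have "(axis 1 1 :: real^3) \<noteq> axis 2 1" "(axis 1 1 :: real^3) \<noteq> axis 3 1" "(axis
    2 1 :: real^3) \<noteq> axis 3 1"
    by (simp_all add: axis_eq_axis)
  ultimately have b: "bij_betw ?f Basis Basis"
    by (simp add: bij_betw_def Basis_vec_def Basis_prod_def UNIV_3 zero_prod_def)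
  have l: "linear ?f"
    by (rule linearI) (simp_all add: vec_eq_iff forall_3)
  show ?thesis
    using measure_lborel_isometry(1)[OF l b assms] by (simp add: vimage_def case_prod_unfold)
qed

text \<open>Every volume below is one application of this: slices along the first variable have a
  known measure \<open>f\<close>, and \<open>F\<close> is an antiderivative. Outside
  \<open>{0..m}\<close> the slices are empty.\<close>

lemma measure_lborel_FTC:
  fixes A :: "(real \<times> 'b::euclidean_space) set"
  assumes A: "compact A" and m: "0 \<le> m" and
    sub: "\<And>x y. (x, y) \<in> A \<Longrightarrow> 0 \<le> x \<and> x \<le> m"
    and sec: "\<And>x. 0 \<le> x \<Longrightarrow> x \<le> m \<Longrightarrow> measure lborel {y. (x, y)
      \<in> A} = f x"
    and F: "\<And>x. 0 \<le> x \<Longrightarrow> x \<le> m \<Longrightarrow> (F has_real_derivative f x) (at x)"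
  shows "measure lborel A = F m - F 0"
proof -
  define g where "g x = measure lborel {y. (x, y) \<in> A}" for x
  have f0: "0 \<le> f x" if "0 \<le> x" "x \<le> m" for x
    unfolding sec[OF that, symmetric] by (rule measure_nonneg)
  have "(\<lambda>x. enn2real (ennreal (g x))) \<in> borel_measurable lborel"
    unfolding g_def using measure_lborel_sections(3)[OF A] by measurable
  then have meas: "g \<in> borel_measurable borel"
    by (simp add: g_def[abs_def])
  have "g x = 0" if "\<not> (0 \<le> x \<and> x \<le> m)" for x
  proof -
    have "{y. (x, y) \<in> A} = {}" using sub that by blast
    then show ?thesis by (simp add: g_def)
  qed
  then have ind: "ennreal (g x) = ennreal (g x) * indicator {0..m} x" for x
    by (cases "x \<in> {0..m}") simp_all
  have "ennreal (measure lborel A) = (\<integral>\<^sup>+x. ennreal (g x) * indicator {0..m} x \<partial>lborel)"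
    unfolding measure_lborel_sections(1)[OF A] g_def[symmetric] by (intro nn_integral_cong ind)
  also have "\<dots> = ennreal (F m - F 0)"
  proof (rule nn_integral_FTC_Icc[OF meas _ _ m])
    fix x assume "x \<in> {0..m}"
    then have x: "0 \<le> x" "x \<le> m" by auto
    show "(F has_real_derivative g x) (at x)"
      unfolding g_def sec[OF x] by (rule F[OF x])
    show "0 \<le> g x"
      unfolding g_def by (rule measure_nonneg)
  qed
  finally have *: "ennreal (measure lborel A) = ennreal (F m - F 0)" .
  \<comment> \<open>\<open>ennreal\<close> sends negative reals to 0, so it can be stripped only
    when the right-hand side is known to be nonnegative.\<close>
  have "F 0 \<le> F m"
  proof (rule DERIV_nonneg_imp_nondecreasing[OF m])
    fix x assume "0 \<le> x" "x \<le> m"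
    then show "\<exists>y. (F has_real_derivative y) (at x) \<and> 0 \<le> y"
      using F f0 by blast
  qed
  then show ?thesis using * by simp
qed

text \<open>Away from 0 the truncated square is locally 0 or the square itself; at 0 its difference
  quotient is bounded by the absolute value of the increment.\<close>

lemma DERIV_max0_power2:
  assumes "(g has_real_derivative g') (at x)"
  shows "((\<lambda>x. (max 0 (g x))\<^sup>2) has_real_derivative 2 * max 0 (g x) * g') (at x)"
proof -
  have "((\<lambda>y. (max 0 y)\<^sup>2) has_real_derivative 2 * max 0 y) (at y)" for y :: real
  proof (cases y "0 :: real" rule: linorder_cases)
    case less
    have "((\<lambda>y. 0) has_real_derivative 2 * max 0 y) (at y)"
      using less by (auto intro!: derivative_eq_intros)
    then show ?thesis
      by (rule has_field_derivative_transform_within_open[of _ _ _ "{..<0}"]) (use less in auto)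
  next
    case greater
    have "((\<lambda>y. y\<^sup>2) has_real_derivative 2 * max 0 y) (at y)"
      using greater by (auto intro!: derivative_eq_intros)
    then show ?thesis
      by (rule has_field_derivative_transform_within_open[of _ _ _ "{0<..}"]) (use greater in auto)
  next
    case equal
    have "((\<lambda>h::real. (max 0 h)\<^sup>2 / h) \<longlongrightarrow> 0) (at 0)"
    proof (rule Lim_null_comparison)
      show "\<forall>\<^sub>F h in at 0. norm ((max 0 h)\<^sup>2 / h) \<le> \<bar>h::real\<bar>"
        by (intro always_eventually allI) (auto simp: max_def power2_eq_square)
      show "((\<lambda>h::real. \<bar>h\<bar>) \<longlongrightarrow> 0) (at 0)" by (rule tendsto_rabs_zero) simp
    qed
    then show ?thesis by (simp add: equal has_field_derivative_iff)
  qed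
  from DERIV_chain2[OF this assms] show ?thesis by simp
qed

text \<open>Product rule for the truncated square times \<open>y\<close>, so the kink at 0 is not
  analysed again.\<close>

lemma DERIV_max0_power3:
  assumes "(g has_real_derivative g') (at x)"
  shows "((\<lambda>x. (max 0 (g x))^3) has_real_derivative 3 * (max 0 (g x))\<^sup>2 * g') (at x)"
proof -
  have e: "(max 0 y)^3 = (max 0 y)\<^sup>2 * y" for y :: real
    by (auto simp: max_def power3_eq_cube power2_eq_square)
  have "y * max 0 y = (max 0 y)\<^sup>2" for y :: real
    by (auto simp: max_def power2_eq_square)
  then have "2 * max 0 (g x) * g' * g x + g' * (max 0 (g x))\<^sup>2 = 3 * (max 0 (g x))\<^sup>2 * g'"
    by (simp add: algebra_simps)
  then show ?thesis
    unfolding e using DERIV_mult[OF DERIV_max0_power2[OF assms] assms] by (simp only: ac_simps)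
qed

definition tpow :: "nat \<Rightarrow> real \<Rightarrow> real" where
  "tpow n x = (max 0 x) ^ n"

text \<open>The derivative is a variable pinned down by an equation, the shape in which rules chain
  with \<open>derivative_eq_intros\<close>. For squares it is phrased with \<open>max 0\<close>, to
  match interval lengths.\<close>

lemma DERIV_tpow:
  assumes "(g has_real_derivative g') (at x)"
  shows "D = 2 * max 0 (g x) * g' \<Longrightarrow> ((\<lambda>x. tpow 2 (g x)) has_real_derivative D) (at x)"
    and "E = 3 * tpow 2 (g x) * g' \<Longrightarrow> ((\<lambda>x. tpow 3 (g x)) has_real_derivative E) (at x)"
  using DERIV_max0_power2[OF assms] DERIV_max0_power3[OF assms] by (simp_all add: tpow_def)

lemma tpow_nonneg: "0 \<le> x \<Longrightarrow> tpow n x = x ^ n"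
  by (simp add: tpow_def)

lemma tpow_nonpos: "x \<le> 0 \<Longrightarrow> 0 < n \<Longrightarrow> tpow n x = 0"
  by (simp add: tpow_def max_def)

lemma tpow_2_mult: "tpow n (2 * x) = 2 ^ n * tpow n x"
proof -
  have "max 0 (2 * x) = 2 * max 0 x" by (simp add: max_def)
  then show ?thesis by (simp add: tpow_def power_mult_distrib)
qed

lemma compact_subset_box2:
  fixes A :: "(real \<times> real) set"
  assumes "closed A" "A \<subseteq> {0..m} \<times> {0..n}"
  shows "compact A"
  using assms compact_Times[OF compact_Icc compact_Icc] by (metis compact_Int_closed inf.absorb2)

lemma compact_subset_box3:
  fixes A :: "(real \<times> real \<times> real) set"
  assumes "closed A" "A \<subseteq> {0..m} \<times> {0..n} \<times> {0..q}"
  shows "compact A"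
  using assms compact_Times[OF compact_Icc compact_Times[OF compact_Icc compact_Icc]] by (metis
    compact_Int_closed inf.absorb2)

section \<open>Lengths, areas and volumes of the concrete fibres\<close>

lemma length_Icc_max0: "measure lborel {u::real. 0 \<le> u \<and> u \<le> a} = max 0 a"
proof -
  have "{u. 0 \<le> u \<and> u \<le> a} = {0..a}" by auto
  then show ?thesis by (simp add: measure_def emeasure_lborel_Icc_eq)
qed

lemma area_triangle:
  "measure lborel {(t::real, u). 0 \<le> t \<and> 0 \<le> u \<and> t + u \<le> a} =
    tpow 2 a / 2" (is "measure _ ?A = _")
proof (cases "0 \<le> a")
  case True
  define F where "F t = - tpow 2 (a - t) / 2" for t :: real
  have "closed ?A" unfolding case_prod_unfold
    by (intro closed_Collect_conj closed_Collect_le continuous_intros)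
  then have "compact ?A" by (rule compact_subset_box2[of _ a a]) auto
  then have "measure lborel ?A = F a - F 0"
  proof (rule measure_lborel_FTC)
    fix t :: real assume t: "0 \<le> t" "t \<le> a"
    have "{u. (t, u) \<in> ?A} = {u. 0 \<le> u \<and> u \<le> a - t}" using t by auto
    then show "measure lborel {u. (t, u) \<in> ?A} = max 0 (a - t)"
      by (simp add: length_Icc_max0)
    show "(F has_real_derivative max 0 (a - t)) (at t)"
      unfolding F_def by (auto intro!: derivative_eq_intros DERIV_tpow)
  qed (use True in auto)
  then show ?thesis using True by (simp add: F_def tpow_nonpos)
next
  case False
  then have "?A = {}" by auto
  then have "measure lborel ?A = 0" by (simp only: measure_empty)
  then show ?thesis using False by (simp add: tpow_nonpos)
qed

lemma volume_tetrahedron: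
  "measure lborel {(t::real, u, v). 0 \<le> t \<and> 0 \<le> u \<and> 0 \<le> v \<and>
    t + u + v \<le> a} = tpow 3 a / 6"
    (is "measure _ ?A = _")
proof (cases "0 \<le> a")
  case True
  define F where "F t = - tpow 3 (a - t) / 6" for t :: real
  have "closed ?A" unfolding case_prod_unfold
    by (intro closed_Collect_conj closed_Collect_le continuous_intros)
  then have "compact ?A" by (rule compact_subset_box3[of _ a a a]) auto
  then have "measure lborel ?A = F a - F 0"
  proof (rule measure_lborel_FTC)
    fix t :: real assume t: "0 \<le> t" "t \<le> a"
    have "{z. (t, z) \<in> ?A} = {(u, v). 0 \<le> u \<and> 0 \<le> v \<and> u + v \<le> a - t}" using t by auto
    then show "measure lborel {z. (t, z) \<in> ?A} = tpow 2 (a - t) / 2"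
      by (simp only: area_triangle)
    show "(F has_real_derivative tpow 2 (a - t) / 2) (at t)"
      unfolding F_def by (auto intro!: derivative_eq_intros DERIV_tpow)
  qed (use True in auto)
  then show ?thesis using True by (simp add: F_def tpow_nonpos)
next
  case False
  then have "?A = {}" by auto
  then have "measure lborel ?A = 0" by (simp only: measure_empty)
  then show ?thesis using False by (simp add: tpow_nonpos)
qed

text \<open>The right triangle with legs \<open>2 * a\<close> and \<open>a\<close>, minus its part
  beyond \<open>t = 2 * b\<close>, which is a translate of the same shape for
  \<open>a - b\<close>.\<close>

lemma area_trapezoid:
  assumes "0 \<le> b"
  shows "measure lborel {(t::real, u). 0 \<le> t \<and> 0 \<le> u \<and> t \<le> 2 * b \<and> t / 2 + u \<le> a}
    = tpow 2 a - tpow 2 (a - b)" (is "measure _ ?A = _")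
proof -
  define F where "F t = - tpow 2 (a - t / 2)" for t :: real
  have "closed ?A" unfolding case_prod_unfold
    by (intro closed_Collect_conj closed_Collect_le continuous_intros) auto
  then have "compact ?A" by (rule compact_subset_box2[of _ "2 * b" a]) auto
  then have "measure lborel ?A = F (2 * b) - F 0"
  proof (rule measure_lborel_FTC)
    fix t :: real assume t: "0 \<le> t" "t \<le> 2 * b"
    have "{u. (t, u) \<in> ?A} = {u. 0 \<le> u \<and> u \<le> a - t / 2}" using t by auto
    then show "measure lborel {u. (t, u) \<in> ?A} = max 0 (a - t / 2)"
      by (simp add: length_Icc_max0)
    show "(F has_real_derivative max 0 (a - t / 2)) (at t)"
      unfolding F_def by (auto intro!: derivative_eq_intros DERIV_tpow)
  qed (use assms in auto)
  then show ?thesis by (simp add: F_def)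
qed

text \<open>Adding the bounds on \<open>u - t\<close> and \<open>t + u\<close> gives
  \<open>u \<le> a + b - c\<close>, so the region is empty when that number is negative; the
  truncated power formula is valid only in the other case.\<close>

lemma area_pentagon:
  assumes "0 \<le> c" "0 \<le> b"
  shows "measure lborel {(t::real, u). 0 \<le> t \<and> 0 \<le> u \<and> t \<le> 2 * c \<and>
    u - t \<le> 2 * (b - c) \<and> t + u \<le> 2 * a}
    = (if a + b - c < 0 then 0 else
       2 * b\<^sup>2 - 2 * tpow 2 (b - c) - tpow 2 (b + c - a) + tpow 2 (b - c - a)
       + 2 * tpow 2 (c - a) - 2 * tpow 2 (- a))" (is "measure _ ?A = _")
proof (cases "a + b - c < 0")
  case True
  then have "?A = {}" by auto
  then have "measure lborel ?A = 0" by (simp only: measure_empty)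
  then show ?thesis using True by simp
next
  case False
  define F where "F t = tpow 2 (2 * (b - c) + t) / 2 - tpow 2 (2 * t + 2 * (b - c) - 2 * a) / 4
     + tpow 2 (t - 2 * a) / 2" for t :: real
  have "closed ?A" unfolding case_prod_unfold
    by (intro closed_Collect_conj closed_Collect_le continuous_intros)
  then have "compact ?A" by (rule compact_subset_box2[of _ "2 * c" "2 * b"]) auto
  then have "measure lborel ?A = F (2 * c) - F 0"
  proof (rule measure_lborel_FTC)
    fix t :: real assume t: "0 \<le> t" "t \<le> 2 * c"
    have "{u. (t, u) \<in> ?A} = {u. 0 \<le> u \<and> u \<le> min (2 * (b - c) + t) (2 * a - t)}" using t by auto
    then have "measure lborel {u. (t, u) \<in> ?A} = max 0 (min (2 * (b - c) + t) (2 * a - t))"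
      by (simp only: length_Icc_max0)
    \<comment> \<open>With upper bounds y and z, this is max(0, min(y, z)) = max(0, y) - max(0, y -
      z) + max(0, -z). It fails if y and z are both negative, which \<open>a + b - c \<ge> 0\<close>
      excludes since y + z is twice that number.\<close>
    then show "measure lborel {u. (t, u) \<in> ?A} = max 0 (2 * (b - c) + t)
       - max 0 (2 * t + 2 * (b - c) - 2 * a) + max 0 (t - 2 * a)"
      using False t by (simp add: max_def min_def)
    show "(F has_real_derivative max 0 (2 * (b - c) + t)
       - max 0 (2 * t + 2 * (b - c) - 2 * a) + max 0 (t - 2 * a)) (at t)"
      unfolding F_def by (auto intro!: derivative_eq_intros DERIV_tpow)
  qed (use assms in auto)
  moreover have "F (2 * c) = 2 * tpow 2 b - tpow 2 (b + c - a) + 2 * tpow 2 (c - a)"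
    using tpow_2_mult[of 2 b] tpow_2_mult[of 2 "b + c - a"] tpow_2_mult[of 2 "c - a"]
    by (simp add: F_def algebra_simps)
  moreover have "F 0 = 2 * tpow 2 (b - c) - tpow 2 (b - c - a) + 2 * tpow 2 (- a)"
    using tpow_2_mult[of 2 "b - c"] tpow_2_mult[of 2 "b - c - a"] tpow_2_mult[of 2 "- a"]
    by (simp add: F_def algebra_simps)
  ultimately show ?thesis using False assms by (simp add: tpow_nonneg)
qed

text \<open>As for the trapezoid: a tetrahedron with legs \<open>2 * a\<close>, \<open>a\<close>,
  \<open>a\<close>, minus the similar one beyond \<open>t = 2 * b\<close>.\<close>

lemma volume_frustum:
  assumes "0 \<le> b"
  shows "measure lborel {(t::real, u, v). 0 \<le> t \<and> 0 \<le> u \<and> 0 \<le> v \<and>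
    t \<le> 2 * b \<and> t / 2 + u + v \<le> a}
    = (tpow 3 a - tpow 3 (a - b)) / 3" (is "measure _ ?A = _")
proof -
  define F where "F t = - tpow 3 (a - t / 2) / 3" for t :: real
  have "closed ?A" unfolding case_prod_unfold
    by (intro closed_Collect_conj closed_Collect_le continuous_intros) auto
  then have "compact ?A" by (rule compact_subset_box3[of _ "2 * b" a a]) auto
  then have "measure lborel ?A = F (2 * b) - F 0"
  proof (rule measure_lborel_FTC)
    fix t :: real assume t: "0 \<le> t" "t \<le> 2 * b"
    have "{z. (t, z) \<in> ?A} = {(u, v). 0 \<le> u \<and> 0 \<le> v \<and> u + v \<le> a - t / 2}" using t by auto
    then show "measure lborel {z. (t, z) \<in> ?A} = tpow 2 (a - t / 2) / 2"
      by (simp only: area_triangle)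
    show "(F has_real_derivative tpow 2 (a - t / 2) / 2) (at t)"
      unfolding F_def by (auto intro!: derivative_eq_intros DERIV_tpow)
  qed (use assms in auto)
  then show ?thesis by (simp add: F_def)
qed

lemma area_rectangle:
  "measure lborel {(t::real, u::real). 0 \<le> t \<and> 0 \<le> u \<and> t \<le> a \<and>
    u \<le> b} = max 0 a * max 0 b" (is "measure _ ?A = _")
proof (cases "0 \<le> a")
  case True
  have "closed ?A" unfolding case_prod_unfold
    by (intro closed_Collect_conj closed_Collect_le continuous_intros)
  then have "compact ?A" by (rule compact_subset_box2[of _ a b]) auto
  then have "measure lborel ?A = a * max 0 b - 0 * max 0 b"
  proof (rule measure_lborel_FTC)
    fix t :: real assume t: "0 \<le> t" "t \<le> a"
    have "{u. (t, u) \<in> ?A} = {u. 0 \<le> u \<and> u \<le> b}" using t by auto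
    then show "measure lborel {u. (t, u) \<in> ?A} = max 0 b"
      by (simp add: length_Icc_max0)
  qed (use True in \<open>auto intro!: derivative_eq_intros\<close>)
  then show ?thesis using True by simp
next
  case False
  then have "?A = {}" by auto
  then have "measure lborel ?A = 0" by (simp only: measure_empty)
  then show ?thesis using False by (simp add: tpow_nonpos)
qed

text \<open>The slices are rectangles with sides \<open>a - t / 2\<close> and
  \<open>b - t / 2\<close>. The first side to shrink to 0 ends the range of \<open>t\<close>, which
  is where the minimum comes from.\<close>

lemma volume_wedge:
  assumes "0 \<le> a" "0 \<le> b"
  shows "measure lborel {(t::real, u, v). 0 \<le> t \<and> 0 \<le> u \<and> 0 \<le> v \<and>
    t / 2 + u \<le> a \<and> t / 2 + v \<le> b}
    = 2 * a * b * min a b - (a + b) * (min a b)\<^sup>2 + 2 / 3 * (min a b)^3" (is "measure _ ?A = _")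
proof -
  define F where "F t = a * b * t - (a + b) * t\<^sup>2 / 4 + t^3 / 12" for t :: real
  have "closed ?A" unfolding case_prod_unfold
    by (intro closed_Collect_conj closed_Collect_le continuous_intros) auto
  then have "compact ?A" by (rule compact_subset_box3[of _ "2 * min a b" a b]) auto
  then have "measure lborel ?A = F (2 * min a b) - F 0"
  proof (rule measure_lborel_FTC)
    fix t :: real assume t: "0 \<le> t" "t \<le> 2 * min a b"
    have "{z. (t, z) \<in> ?A} = {(u, v). 0 \<le> u \<and> 0 \<le> v \<and> u \<le> a - t / 2 \<and>
      v \<le> b - t / 2}" using t by auto
    then show "measure lborel {z. (t, z) \<in> ?A} = (a - t / 2) * (b - t / 2)"
      using t by (simp add: area_rectangle)
    show "(F has_real_derivative (a - t / 2) * (b - t / 2)) (at t)"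
      unfolding F_def by (auto intro!: derivative_eq_intros simp: field_simps power2_eq_square)
  qed (use assms in auto)
  then show ?thesis by (simp add: F_def field_simps power_mult_distrib)
qed

text \<open>Inclusion-exclusion: a tetrahedron with legs \<open>2 * a\<close>, \<open>2 * a\<close>,
  \<open>a\<close>, minus the corners beyond \<open>t = 2 * b\<close> and beyond
  \<open>u = 2 * c\<close>, plus the overlap of these corners.\<close>

lemma volume_hexahedron:
  assumes "0 \<le> b" "0 \<le> c"
  shows "measure lborel {(t::real, u, v). 0 \<le> t \<and> 0 \<le> u \<and> 0 \<le> v \<and>
    t \<le> 2 * b \<and> u \<le> 2 * c \<and> t / 2 + u / 2 + v \<le> a}
    = 2 / 3 * (tpow 3 a - tpow 3 (a - b) - tpow 3 (a - c) + tpow 3 (a - b - c))" (is "measure _ ?A = _")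
proof -
  define F where "F t = 2 / 3 * (- tpow 3 (a - t / 2) + tpow 3 (a - t / 2 - c))" for t :: real
  have "closed ?A" unfolding case_prod_unfold
    by (intro closed_Collect_conj closed_Collect_le continuous_intros) auto
  then have "compact ?A" by (rule compact_subset_box3[of _ "2 * b" "2 * c" a]) auto
  then have "measure lborel ?A = F (2 * b) - F 0"
  proof (rule measure_lborel_FTC)
    fix t :: real assume t: "0 \<le> t" "t \<le> 2 * b"
    have "{z. (t, z) \<in> ?A} = {(u, v). 0 \<le> u \<and> 0 \<le> v \<and> u \<le> 2 * c \<and>
      u / 2 + v \<le> a - t / 2}" using t by auto
    then show "measure lborel {z. (t, z) \<in> ?A} = tpow 2 (a - t / 2) - tpow 2 (a - t / 2 - c)"
      by (simp only: area_trapezoid[OF assms(2)])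
    show "(F has_real_derivative tpow 2 (a - t / 2) - tpow 2 (a - t / 2 - c)) (at t)"
      unfolding F_def by (auto intro!: derivative_eq_intros DERIV_tpow)
  qed (use assms in auto)
  then show ?thesis by (simp add: F_def algebra_simps)
qed

text \<open>Inclusion-exclusion again, now for a triangle with legs \<open>a\<close> and corners cut
  off at \<open>p\<close> and \<open>q\<close>. These are the slices of the next solid.\<close>

lemma area_cut_rectangle:
  assumes "0 \<le> a" "0 \<le> p" "0 \<le> q"
  shows "measure lborel {(t::real, u). 0 \<le> t \<and> 0 \<le> u \<and> t \<le> p \<and>
    u \<le> q \<and> t + u \<le> a}
    = (a\<^sup>2 - tpow 2 (a - p) - tpow 2 (a - q) + tpow 2 (a - p - q)) / 2" (is "measure _ ?A = _")
proof -
  define F where "F t = - tpow 2 (a - t) / 2 + tpow 2 (a - q - t) / 2" for t :: real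
  have "closed ?A" unfolding case_prod_unfold
    by (intro closed_Collect_conj closed_Collect_le continuous_intros)
  then have "compact ?A" by (rule compact_subset_box2[of _ p q]) auto
  then have "measure lborel ?A = F p - F 0"
  proof (rule measure_lborel_FTC)
    fix t :: real assume t: "0 \<le> t" "t \<le> p"
    have "{u. (t, u) \<in> ?A} = {u. 0 \<le> u \<and> u \<le> min q (a - t)}" using t by auto
    then have "measure lborel {u. (t, u) \<in> ?A} = max 0 (min q (a - t))"
      by (simp only: length_Icc_max0)
    then show "measure lborel {u. (t, u) \<in> ?A} = max 0 (a - t) - max 0 (a - q - t)"
      using assms by (simp add: max_def min_def)
    show "(F has_real_derivative max 0 (a - t) - max 0 (a - q - t)) (at t)"
      unfolding F_def by (auto intro!: derivative_eq_intros DERIV_tpow)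
  qed (use assms in auto)
  then show ?thesis using assms by (simp add: F_def tpow_nonneg field_simps)
qed

lemma volume_pairwise_sums:
  assumes "0 \<le> a" "0 \<le> b" "0 \<le> c"
  shows "measure lborel {(t::real, u, v). 0 \<le> t \<and> 0 \<le> u \<and> 0 \<le> v \<and>
    u + v \<le> a \<and> u + t \<le> b \<and> t + v \<le> c}
    = (a\<^sup>2 * min b c - (tpow 3 (a - b + min b c) - tpow 3 (a - b)) / 3
       - (tpow 3 (a - c + min b c) - tpow 3 (a - c)) / 3
       + (tpow 3 (a - b - c + 2 * min b c) - tpow 3 (a - b - c)) / 6) / 2" (is "measure _ ?A = _")
proof -
  define F where "F t = (a\<^sup>2 * t - tpow 3 (a - b + t) / 3
       - tpow 3 (a - c + t) / 3 + tpow 3 (a - b - c + 2 * t) / 6) / 2" for t :: real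
  have "closed ?A" unfolding case_prod_unfold
    by (intro closed_Collect_conj closed_Collect_le continuous_intros)
  then have "compact ?A" by (rule compact_subset_box3[of _ "min b c" b c]) auto
  then have "measure lborel ?A = F (min b c) - F 0"
  proof (rule measure_lborel_FTC)
    fix t :: real assume t: "0 \<le> t" "t \<le> min b c"
    have "{z. (t, z) \<in> ?A} = {(u, v). 0 \<le> u \<and> 0 \<le> v \<and> u \<le> b - t \<and>
      v \<le> c - t \<and> u + v \<le> a}" using t by auto
    moreover have "0 \<le> b - t" "0 \<le> c - t" using t by auto
    note area_cut_rectangle[OF assms(1) this]
    moreover have "a - (b - t) = a - b + t" "a - (c - t) = a - c + t" "a - (b - t) - (c - t) = a - b - c + 2 * t"
      by simp_all
    ultimately show "measure lborel {z. (t, z) \<in> ?A} =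
      (a\<^sup>2 - tpow 2 (a - b + t) - tpow 2 (a - c + t) + tpow 2 (a - b - c + 2 * t)) / 2"
      by (simp only:)
    show "(F has_real_derivative
      (a\<^sup>2 - tpow 2 (a - b + t) - tpow 2 (a - c + t) + tpow 2 (a - b - c + 2 * t)) / 2) (at t)"
      unfolding F_def by (auto intro!: derivative_eq_intros DERIV_tpow)
  qed (use assms in auto)
  then show ?thesis by (simp add: F_def field_simps)
qed

subsection \<open>Simplex splines in barycentric coordinates\<close>

lemma noncollinear_iff_tri_det: "\<not> collinear {a, b, c :: real^2} \<longleftrightarrow> tri_det a b
  c \<noteq> 0"
proof
  assume nc: "\<not> collinear {a, b, c}"
  show "tri_det a b c \<noteq> 0"
  proof
    assume d: "tri_det a b c = 0"
    \<comment> \<open>A vanishing determinant says that differences of second coordinates are the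
      coefficients of an affine relation between the points, so they are 0. The first coordinates
      are treated the same way, and \<open>a = b\<close> follows.\<close>
    have "((b$2 - a$2) - (c$2 - a$2)) *\<^sub>R a + (c$2 - a$2) *\<^sub>R b + (- (b$2 - a$2)) *\<^sub>R c = 0"
      using d by (simp add: vec_eq_iff forall_2 tri_det_def algebra_simps)
    from noncollinear_unique[OF nc _ this] have 2: "b$2 = a$2" by simp
    have "((b$1 - a$1) - (c$1 - a$1)) *\<^sub>R a + (c$1 - a$1) *\<^sub>R b + (- (b$1 - a$1)) *\<^sub>R c = 0"
      using d by (simp add: vec_eq_iff forall_2 tri_det_def algebra_simps)
    from noncollinear_unique[OF nc _ this] have "b$1 = a$1" by simp
    with 2 have "a = b" by (simp add: vec_eq_iff forall_2)
    then show False using nc by (simp add: collinear_2)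
  qed
next
  assume d: "tri_det a b c \<noteq> 0"
  show "\<not> collinear {a, b, c}"
  proof
    assume "collinear {a, b, c}"
    then obtain u where u: "\<forall>x\<in>{a, b, c}. \<forall>y\<in>{a, b, c}. \<exists>k. x - y = k *\<^sub>R u"
      unfolding collinear_def by (rule exE)
    from u obtain k where k: "b - a = k *\<^sub>R u" by auto
    from u obtain l where l: "c - a = l *\<^sub>R u" by auto
    have "b$1 - a$1 = k * u$1" "b$2 - a$2 = k * u$2" "c$1 - a$1 = l * u$1" "c$2 - a$2 = l * u$2"
      using arg_cong[OF k, of "\<lambda>v. v$1"] arg_cong[OF k, of "\<lambda>v. v$2"]
        arg_cong[OF l, of "\<lambda>v. v$1"] arg_cong[OF l, of "\<lambda>v. v$2"] by simp_all
    then show False using d by (simp add: tri_det_def)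
  qed
qed

text \<open>Barycentric coordinates as a relation instead of the description in
  \<open>barycentric\<close>: the base triangle varies from spline to spline, and a proposed triple
  can be verified by simplification.\<close>

definition bary_comb :: "real^2 \<Rightarrow> real^2 \<Rightarrow> real^2 \<Rightarrow> real \<times>
  real \<times> real \<Rightarrow> real^2 \<Rightarrow> bool" where
  "bary_comb a b c = (\<lambda>(r, s, t) y. r + s + t = 1 \<and> y = r *\<^sub>R a + s *\<^sub>R b +
    t *\<^sub>R c)"

text \<open>Cramer's rule: each coordinate is the determinant with one vertex replaced by
  \<open>y\<close>, divided by the full determinant.\<close>

lemma barycentric_coordinates_exist:
  assumes "\<not> collinear {a, b, c :: real^2}"
  shows "\<exists>z. bary_comb a b c z y"
proof -
  define D where "D = tri_det a b c"
  have D: "D \<noteq> 0" using assms by (simp add: noncollinear_iff_tri_det D_def)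
  have "tri_det y b c + tri_det a y c + tri_det a b y = D"
    by (simp add: tri_det_def D_def algebra_simps)
  then have "tri_det y b c / D + tri_det a y c / D + tri_det a b y / D = 1"
    by (simp only: add_divide_distrib[symmetric] divide_self[OF D])
  moreover have "tri_det y b c *\<^sub>R a + tri_det a y c *\<^sub>R b + tri_det a b y *\<^sub>R c = D *\<^sub>R y"
    by (simp add: vec_eq_iff forall_2 tri_det_def D_def algebra_simps)
  then have "(1 / D) *\<^sub>R (tri_det y b c *\<^sub>R a + tri_det a y c *\<^sub>R b +
    tri_det a b y *\<^sub>R c) = y"
    using D by simp
  then have "y = (tri_det y b c / D) *\<^sub>R a + (tri_det a y c / D) *\<^sub>R b +
    (tri_det a b y / D) *\<^sub>R c"
    by (simp only: scaleR_add_right scaleR_scaleR mult_1_left times_divide_eq_left)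
  ultimately show ?thesis
    by (intro exI[of _ "(tri_det y b c / D, tri_det a y c / D, tri_det a b y / D)"]) (simp only:
      bary_comb_def prod.case)
qed

lemma bary_comb_unique:
  assumes "\<not> collinear {a, b, c :: real^2}" "bary_comb a b c z y" "bary_comb a b c z' y"
  shows "z = z'"
proof -
  obtain r s t r' s' t' where z: "z = (r, s, t)" "z' = (r', s', t')"
    by (cases z, cases z')
  show ?thesis
    using noncollinear_cong[OF assms(1), of r s t r' s' t'] assms(2,3) by (simp add: z bary_comb_def)
qed

lemma barycentric_eq:
  assumes "\<not> collinear {p1, p2, p3}" "bary_comb p1 p2 p3 z x"
  shows "barycentric p1 p2 p3 x = z"
proof -
  have eq: "barycentric p1 p2 p3 x = (THE z. bary_comb p1 p2 p3 z x)"
    by (simp add: barycentric_def bary_comb_def case_prod_unfold)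
  show ?thesis
    unfolding eq by (rule the_equality[where P="\<lambda>z. bary_comb p1 p2 p3 z x", OF assms(2)]) (rule
      bary_comb_unique[OF assms(1) _ assms(2)])
qed

context
  fixes a b c x :: "real^2" and xa xb xc :: real
  assumes nc: "\<not> collinear {a, b, c}" and x: "bary_comb a b c (xa, xb, xc) x"
begin

text \<open>Replaces the coordinate functions on the whole plane by given numbers for
  \<open>x\<close> and the knots. The functions are obtained by choice and agree with the numbers by
  uniqueness. Compactness is included because the transfer to products of \<open>real\<close>
  requires it.\<close>

lemma simplex_spline_coords:
  fixes k :: "'d::{finite,wellorder} \<Rightarrow> real^2"
  assumes k: "\<And>i. bary_comb a b c (ka i, kb i, kc i) (k i)"
    and K: "K = add_mset a (add_mset b (add_mset c (image_mset k (mset_set UNIV))))"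
  shows "simplex_spline TYPE('d) \<Delta> K x =
    2 * measure lebesgue \<Delta> / \<bar>tri_det a b c\<bar> * fact CARD('d) *
      measure lebesgue {t. (\<forall>i. 0 \<le> t $ i) \<and> (\<Sum>i\<in>UNIV. t $ i * ka i) \<le> xa \<and>
        (\<Sum>i\<in>UNIV. t $ i * kb i) \<le> xb \<and>
          (\<Sum>i\<in>UNIV. t $ i * kc i) \<le> xc}" (is "_ = _ * measure _ ?P")
    and "compact {t :: (real, 'd) vec. (\<forall>i. 0 \<le> t $ i) \<and>
      (\<Sum>i\<in>UNIV. t $ i * ka i) \<le> xa \<and>
        (\<Sum>i\<in>UNIV. t $ i * kb i) \<le> xb \<and> (\<Sum>i\<in>UNIV. t $ i * kc i) \<le> xc}"
proof -
  obtain f where f: "\<And>y. bary_comb a b c (f y) y"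
    using choice[of "\<lambda>y z. bary_comb a b c z y"] barycentric_coordinates_exist[OF nc] by blast
  define la lb lc where "la = fst \<circ> f" and "lb = fst \<circ> snd \<circ> f" and "lc =
    snd \<circ> snd \<circ> f"
  have l: "bary_comb a b c (la y, lb y, lc y) y" for y
    using f by (simp add: la_def lb_def lc_def)
  have "bary_comb a b c (r, s, t) y \<Longrightarrow> la y = r \<and> lb y = s \<and> lc y = t" for r s t y
    using bary_comb_unique[OF nc l] by auto
  note e = this[OF x] this[OF k]
  have bary: "la y + lb y + lc y = 1" "la y *\<^sub>R a + lb y *\<^sub>R b + lc y *\<^sub>R c = y" for y
    using l[of y] by (simp_all add: bary_comb_def)
  have P: "fibre_polytope la lb lc k x = ?P"
    by (simp add: fibre_polytope_def e)
  show "simplex_spline TYPE('d) \<Delta> K x =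
    2 * measure lebesgue \<Delta> / \<bar>tri_det a b c\<bar> * fact CARD('d) *
      measure lebesgue ?P"
    unfolding K P[symmetric] by (rule simplex_spline_eq[OF nc bary])
  have "compact {t. (x, t) \<in> {(x, t). t \<in> fibre_polytope la lb lc k x}}"
    by (rule sections_compact(1)[OF fibre_polytope_compact_measure(1)[OF nc bary]])
  then show "compact ?P" by (simp add: P)
qed

lemma simplex_spline_1:
  assumes "bary_comb a b c (qa, qb, qc) q"
    and K: "K = add_mset a (add_mset b (add_mset c {#q#}))"
  shows "simplex_spline TYPE(1) \<Delta> K x = 2 * measure lebesgue \<Delta> / \<bar>tri_det a b c\<bar> *
    measure lborel {t. 0 \<le> t \<and> t * qa \<le> xa \<and> t * qb \<le> xb \<and> t * qc \<le> xc}"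
proof -
  have *: "bary_comb a b c ((\<lambda>i. qa) i, (\<lambda>i. qb) i, (\<lambda>i. qc) i) ((\<lambda>i::1.
    q) i)" for i by (rule assms(1))
  have K': "K = add_mset a (add_mset b (add_mset c (image_mset (\<lambda>i::1. q) (mset_set UNIV))))"
    using K by (simp)
  show ?thesis
    unfolding simplex_spline_coords(1)[OF * K'] measure_real1[OF simplex_spline_coords(2)[OF * K']]
    by (simp add: sum_1)
qed

lemma simplex_spline_2:
  assumes "bary_comb a b c (qa, qb, qc) q" "bary_comb a b c (ra, rb, rc) r"
    and K: "K = add_mset a (add_mset b (add_mset c {#q, r#}))"
  shows "simplex_spline TYPE(2) \<Delta> K x = 2 * measure lebesgue \<Delta> / \<bar>tri_det a b c\<bar> * 2 *
    measure lborel {(t, u). 0 \<le> t \<and> 0 \<le> u \<and> t * qa + u * ra \<le> xa \<and>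
      t * qb + u * rb \<le> xb \<and> t * qc + u * rc \<le> xc}"
proof -
  have *: "bary_comb a b c ((\<lambda>i. if i = 1 then qa else ra) i, (\<lambda>i. if i = 1 then qb else rb) i,
     (\<lambda>i. if i = 1 then qc else rc) i) ((\<lambda>i::2. if i = 1 then q else r) i)" for i
    by (simp add: assms(1,2))
  have K': "K = add_mset a (add_mset b (add_mset c (image_mset (\<lambda>i::2. if i =
    1 then q else r) (mset_set UNIV))))"
    using K by (simp add: UNIV_2)
  show ?thesis
    unfolding simplex_spline_coords(1)[OF * K'] measure_real2[OF simplex_spline_coords(2)[OF * K']]
    by (simp add: sum_2 forall_2 conj_assoc)
qed

lemma simplex_spline_3:
  assumes "bary_comb a b c (qa, qb, qc) q" "bary_comb a b c (ra, rb, rc) r" "bary_comb a b c (sa, sb, sc) s"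
    and K: "K = add_mset a (add_mset b (add_mset c {#q, r, s#}))"
  shows "simplex_spline TYPE(3) \<Delta> K x = 2 * measure lebesgue \<Delta> / \<bar>tri_det a b c\<bar> * 6 *
    measure lborel {(t, u, v). 0 \<le> t \<and> 0 \<le> u \<and> 0 \<le> v \<and>
      t * qa + u * ra + v * sa \<le> xa \<and>
      t * qb + u * rb + v * sb \<le> xb \<and> t * qc + u * rc + v * sc \<le> xc}"
proof -
  have *: "bary_comb a b c ((\<lambda>i. if i = 1 then qa else if i = 2 then ra else sa) i,
     (\<lambda>i. if i = 1 then qb else if i = 2 then rb else sb) i,
     (\<lambda>i. if i = 1 then qc else if i = 2 then rc else sc) i)
     ((\<lambda>i::3. if i = 1 then q else if i = 2 then r else s) i)" for i
    by (simp add: assms(1,2,3))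
  have ne: "(2 :: 3) \<noteq> 1" "(3 :: 3) \<noteq> 1" "(3 :: 3) \<noteq> 2" "(1 :: 3) \<noteq> 2" "(1
    :: 3) \<noteq> 3" "(2 :: 3) \<noteq> 3"
    by simp_all
  have "mset_set {1, 2, 3 :: 3} = add_mset 1 (mset_set {2, 3})"
    by (rule mset_set.insert) (simp_all add: ne)
  also have "mset_set {2, 3 :: 3} = add_mset 2 (mset_set {3})"
    by (rule mset_set.insert) (simp_all add: ne)
  also have "mset_set {3 :: 3} = {#3#}" by simp
  finally have m: "mset_set (UNIV :: 3 set) = add_mset 1 (add_mset 2 {#3#})"
    unfolding UNIV_3 .
  have K': "K = add_mset a (add_mset b (add_mset c (image_mset (\<lambda>i::3. if i =
    1 then q else if i = 2 then r else s) (mset_set UNIV))))"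
    unfolding K m by (simp add: ne)
  show ?thesis
    unfolding simplex_spline_coords(1)[OF * K'] measure_real3[OF simplex_spline_coords(2)[OF * K']]
    by (simp add: sum_3 forall_3 conj_assoc fact_numeral)
qed

end

subsection \<open>The basis functions as truncated powers\<close>

text \<open>
  \<open>a, b, c\<close> are the barycentric coordinates of the point with respect to a permutation of the
  three vertices; the digit in the name is the degree.
\<close>

definition s1a :: "real \<Rightarrow> real \<Rightarrow> real \<Rightarrow> real" where
  "s1a a b c = max 0 (a - b - c)"

text \<open>Together with \<open>s1a\<close>, the hat functions of the split: this one is 1 at the
  edge midpoint with coordinates (1/2, 1/2, 0), \<open>s1c\<close> at (1/2, 1/4, 1/4), and
  \<open>s1d\<close> at the barycentre.\<close>

definition s1b :: "real \<Rightarrow> real \<Rightarrow> real \<Rightarrow> real" where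
  "s1b a b c = 2 * max 0 (min a b - c)"

definition s1c :: "real \<Rightarrow> real \<Rightarrow> real \<Rightarrow> real" where
  "s1c a b c = 4 * max 0 (min b c - max 0 (b + c - a))"

definition s1d :: "real \<Rightarrow> real \<Rightarrow> real \<Rightarrow> real" where
  "s1d a b c = 3 * max 0 (min (a + b - c) (min (b + c - a) (c + a - b)))"

definition s2a :: "real \<Rightarrow> real \<Rightarrow> real \<Rightarrow> real" where
  "s2a a b c = tpow 2 (a - b - c)"

definition s2b :: "real \<Rightarrow> real \<Rightarrow> real \<Rightarrow> real" where
  "s2b a b c = 2 * (tpow 2 (a - c) - tpow 2 (a - b - c))"

text \<open>Three times the area in \<open>area_pentagon\<close>, where 3 is 3/4 times d! = 2 times
  the inverse area ratio 2 of the base. The term \<open>tpow 2 (- a)\<close> of that area is left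
  out, being 0 for \<open>a \<ge> 0\<close>.\<close>

definition s2c :: "real \<Rightarrow> real \<Rightarrow> real \<Rightarrow> real" where
  "s2c a b c = (if a + b - c < 0 then 0 else
     3 * (2 * b\<^sup>2 - 2 * tpow 2 (b - c) - tpow 2 (b + c - a) + tpow 2 (b - c - a) + 2 * tpow 2 (c - a)))"

definition s3a :: "real \<Rightarrow> real \<Rightarrow> real \<Rightarrow> real" where
  "s3a a b c = tpow 3 (a - b - c)"

definition s3b :: "real \<Rightarrow> real \<Rightarrow> real \<Rightarrow> real" where
  "s3b a b c = 2 * (tpow 3 (a - c) - tpow 3 (a - b - c))"

definition s3c :: "real \<Rightarrow> real \<Rightarrow> real \<Rightarrow> real" where
  "s3c a b c = 6 * (2 * a * b * min a b - (a + b) * (min a b)\<^sup>2 + 2 / 3 * (min a b)^3)"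

definition s3d :: "real \<Rightarrow> real \<Rightarrow> real \<Rightarrow> real" where
  "s3d a b c = 4 * (a^3 - tpow 3 (a - b) - tpow 3 (a - c) + tpow 3 (a - b - c))"

text \<open>Twelve times the volume in \<open>volume_pairwise_sums\<close>: 12 = (1/4) * 6 * 2^3,
  the last factor because the bounds in the fibre are \<open>2 * a\<close>, \<open>2 * b\<close>,
  \<open>2 * c\<close>.\<close>

definition s3e :: "real \<Rightarrow> real \<Rightarrow> real \<Rightarrow> real" where
  "s3e a b c = 6 * a\<^sup>2 * min b c - 2 * (tpow 3 (a - b + min b c) - tpow 3 (a - b))
     - 2 * (tpow 3 (a - c + min b c) - tpow 3 (a - c))
     + (tpow 3 (a - b - c + 2 * min b c) - tpow 3 (a - b - c))"

text \<open>
  For \<open>a + b = c\<close> both branches in the definition of \<^const>\<open>s2c\<close> vanish, so that the regions below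
  can be closed.
\<close>

lemma s2c_outside: "0 \<le> a \<Longrightarrow> 0 \<le> b \<Longrightarrow> a +
  b \<le> c \<Longrightarrow> s2c a b c = 0"
proof (cases "a + b = c")
  case True
  assume "0 \<le> a" "0 \<le> b"
  have "s2c a b (a + b) = 0"
    using \<open>0 \<le> a\<close> \<open>0 \<le> b\<close>
    by (simp add: s2c_def tpow_nonneg tpow_nonpos)
  then show ?thesis by (simp add: True)
next
  case False
  assume "a + b \<le> c"
  with False show ?thesis by (simp add: s2c_def)
qed

lemma s2c_inside: "c \<le> a + b \<Longrightarrow> s2c a b c =
     3 * (2 * b\<^sup>2 - 2 * tpow 2 (b - c) - tpow 2 (b + c - a) + tpow 2 (b - c - a) + 2 * tpow 2 (c - a))"
  by (simp add: s2c_def)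

text \<open>The order of the three numbers, combined with whether the largest exceeds the sum of the
  other two, fixes the sign of every truncated argument. Stated homogeneously, so that all
  permutations of the coordinates are instances.\<close>

lemma region_cases:
  fixes a b c :: real
  obtains "c \<le> b" "b \<le> a" "b + c \<le> a" | "c \<le> b" "b \<le> a" "a \<le> b + c"
    | "b \<le> c" "c \<le> a" "b + c \<le> a" | "b \<le> c" "c \<le> a" "a \<le> b + c"
    | "c \<le> a" "a \<le> b" "a + c \<le> b" | "c \<le> a" "a \<le> b" "b \<le> a + c"
    | "a \<le> c" "c \<le> b" "a + c \<le> b" | "a \<le> c" "c \<le> b" "b \<le> a + c"
    | "a \<le> b" "b \<le> c" "a + b \<le> c" | "a \<le> b" "b \<le> c" "c \<le> a + b"
    | "b \<le> a" "a \<le> c" "a + b \<le> c" | "b \<le> a" "a \<le> c" "c \<le> a + b"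
proof -
  have "(c \<le> b \<and> b \<le> a) \<or> (b \<le> c \<and> c \<le> a) \<or> (c \<le> a \<and> a \<le> b)
      \<or> (a \<le> c \<and> c \<le> b) \<or> (a \<le> b \<and> b \<le> c) \<or> (b \<le> a \<and> a \<le> c)"
    using linear[of a b] linear[of b c] linear[of a c] by blast
  then show thesis
    using linear[of "b + c" a] linear[of "a + c" b] linear[of "a + b" c]
    by (elim disjE conjE) (rule that; assumption)+
qed

lemmas region_simps = max_absorb1 max_absorb2 min_absorb1 min_absorb2 tpow_nonneg tpow_nonpos
  s2c_inside s2c_outside

lemmas ring_powers = power2_eq_square power3_eq_cube field_simps

section \<open>Columns of the recurrence matrices in homogeneous form, and supports\<close>

context
  fixes a b c :: real
  assumes nn: "0 \<le> a" "0 \<le> b" "0 \<le> c"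
begin

text \<open>The spline is symmetric in its first two arguments; the formula is not, because its base
  triangle treats the two vertices differently.\<close>

lemma s2c_commute: "s2c a b c = s2c b a c"
  by (rule region_cases[of c b a]) (use nn in \<open>simp_all add: region_simps, simp_all add: ring_powers\<close>)

text \<open>This and the following identities are columns 1, 2, 3 of \<open>R2_rows\<close> and
  columns 1, 2, 3, 13, 16 of \<open>R3_rows\<close>; the other columns arise by permuting the
  variables.\<close>

lemma s2a_eq: "s2a a b c = (a - b - c) * s1a a b c"
  by (simp add: s2a_def s1a_def tpow_def power2_eq_square max_def)

lemma s2b_eq: "s2b a b c = 2 * b * s1a a b c + (a - c) * s1b a b c + (a - c) / 2 * s1c a b c"
  unfolding s2b_def s1a_def s1b_def s1c_def
  by (rule region_cases[of c b a]) (use nn in \<open>simp_all add: region_simps, simp_all add: ring_powers\<close>)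

lemma s2c_eq: "s2c a b c = 3 * c * s1b a b c + 3 * b / 2 * s1c a b c + 3 * a / 2 * s1c b c a
  + (a + b - c) * s1d a b c"
  unfolding s1d_def s1b_def s1c_def
  by (rule region_cases[of c b a]) (use nn in \<open>simp_all add: region_simps, simp_all add: ring_powers\<close>)

lemma s3a_eq: "s3a a b c = (a - b - c) * s2a a b c"
  by (simp add: s3a_def s2a_def tpow_def power2_eq_square power3_eq_cube max_def)

lemma s3b_eq: "s3b a b c = 2 * b * s2a a b c + (a - c) * s2b a b c"
  unfolding s3b_def s2a_def s2b_def
  by (rule region_cases[of c b a]) (use nn in \<open>simp_all add: region_simps, simp_all add: ring_powers\<close>)

lemma s3c_eq: "s3c a b c = b * s2b a b c + (a + b) / 3 * s2c a b c + a * s2b b a c + a / 3 * s2c b c a +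
  b / 3 * s2c c a b"
  unfolding s3c_def s2b_def
  by (rule region_cases[of c b a]) (use nn in \<open>simp_all add: region_simps, simp_all add: ring_powers\<close>)

lemma s3d_eq: "s3d a b c = 2 * c * s2b a b c + 2 * a / 3 * s2c a b c + 2 * a / 3 * s2c c a b + 2 * b * s2b a c b"
  unfolding s3d_def s2b_def
  by (rule region_cases[of c b a]) (use nn in \<open>simp_all add: region_simps, simp_all add: ring_powers\<close>)

lemma s3e_eq: "s3e a b c = c / 3 * s2c a b c + a / 3 * s2c b c a + b / 3 * s2c c a b"
  unfolding s3e_def
  by (rule region_cases[of c b a]) (use nn in \<open>simp_all add: region_simps, simp_all add: ring_powers\<close>)

lemma s1_nonneg: "0 \<le> s1a a b c" "0 \<le> s1b a b c" "0 \<le> s1c a b c" "0 \<le> s1d a b c"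
  by (simp_all add: s1a_def s1b_def s1c_def s1d_def)

text \<open>Each factor is an entry, up to a positive constant, that can become negative, and the
  hat function is 0 where it does: \<open>s1b\<close> lives on \<open>c \<le> min a b\<close>,
  \<open>s1c\<close> where \<open>a\<close> is the largest, \<open>s1d\<close> on the medial
  triangle.\<close>

lemma s1_support:
  "0 \<le> (a - b - c) * s1a a b c" "0 \<le> (a - c) * s1b a b c" "0 \<le> (b - c) * s1b a b c"
  "0 \<le> (a - b) * s1c a b c" "0 \<le> (a - c) * s1c a b c"
  "0 \<le> (a + b - c) * s1d a b c" "0 \<le> (b + c - a) * s1d a b c" "0 \<le> (c + a - b) * s1d a b c"
  unfolding s1a_def s1b_def s1c_def s1d_def
  by (rule region_cases[of c b a]; use nn in \<open>simp add: region_simps\<close>)+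

text \<open>For \<open>a \<le> c\<close> both truncated powers in \<open>s2b\<close> vanish.\<close>

lemma s2b_support: "0 \<le> (a - c) * s2b a b c"
  unfolding s2b_def
  by (rule region_cases[of c b a]) (use nn in \<open>simp_all add: region_simps\<close>)

end

subsection \<open>Evaluation of the splines\<close>

lemma ps12_pt_simps:
  "ps12_pt p1 p2 p3 (Suc 0) = p1" "ps12_pt p1 p2 p3 1 = p1" "ps12_pt p1 p2 p3 2 = p2" "ps12_pt p1 p2 p3 3 = p3"
  "ps12_pt p1 p2 p3 4 = midpoint p1 p2" "ps12_pt p1 p2 p3 5 = midpoint p2 p3"
  "ps12_pt p1 p2 p3 6 = midpoint p3 p1" "ps12_pt p1 p2 p3 7 = midpoint (midpoint p1 p2) (midpoint p3 p1)"
  "ps12_pt p1 p2 p3 8 = midpoint (midpoint p1 p2) (midpoint p2 p3)"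
  "ps12_pt p1 p2 p3 9 = midpoint (midpoint p2 p3) (midpoint p3 p1)"
  "ps12_pt p1 p2 p3 10 = (1/3) *\<^sub>R (p1 + p2 + p3)"
  by (simp_all add: ps12_pt_def Let_def)

text \<open>Relabelling the vertices permutes the edge midpoints and fixes triangle and barycentre.
  With the swap below this generates all permutations, so each type of spline is evaluated in one
  position only.\<close>

lemma ps12_Q_rotate: "ps12_Q D p1 p2 p3 i j k l m n r x = ps12_Q D p2 p3 p1 j k i m n l r x"
  by (simp add: ps12_Q_def Let_def ps12_pt_simps ac_simps insert_commute)

lemma ps12_Q_swap: "ps12_Q D p1 p2 p3 i j k l m n r x = ps12_Q D p2 p1 p3 j i k l n m r x"
  by (simp add: ps12_Q_def Let_def ps12_pt_simps ac_simps insert_commute midpoint_sym)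

context
  fixes p1 p2 p3 :: "real^2" and a b c :: "real^2" and r :: real
  assumes nc: "\<not> collinear {p1, p2, p3}"
    and det: "tri_det a b c = r * tri_det p1 p2 p3" and r: "0 < r"
begin

text \<open>\<open>r\<close> is the area of the base triangle relative to the whole one; the
  normalisation constant of the spline collapses to its inverse.\<close>

lemma base_ratio:
  shows "\<not> collinear {a, b, c}"
    and "2 * measure lebesgue (convex hull {p1, p2, p3}) / \<bar>tri_det a b c\<bar> = 1 / r"
  using nc r by (simp_all add: noncollinear_iff_tri_det det measure_triangle abs_mult)

lemma ps12_Q_1:
  assumes "bary_comb a b c (xa, xb, xc) x" and "bary_comb a b c (qa, qb, qc) q"
    and "replicate_mset i1 p1 + replicate_mset i2 p2 + replicate_mset i3 p3 + replicate_mset i4 (midpoint p1 p2)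
      + replicate_mset i5 (midpoint p2 p3) + replicate_mset i6 (midpoint p3 p1)
      + replicate_mset i7 ((1/3) *\<^sub>R (p1 + p2 + p3)) = {#a, b, c, q#}"
  shows "ps12_Q TYPE(1) p1 p2 p3 i1 i2 i3 i4 i5 i6 i7 x = 1 / r *
    measure lborel {t. 0 \<le> t \<and> t * qa \<le> xa \<and> t * qb \<le> xb \<and> t * qc \<le> xc}"
  unfolding base_ratio(2)[symmetric] ps12_Q_def Let_def ps12_pt_simps assms(3)
  by (rule simplex_spline_1[OF base_ratio(1) assms(1,2)]) (rule refl)

lemma ps12_Q_2:
  assumes "bary_comb a b c (xa, xb, xc) x" and "bary_comb a b c (qa, qb, qc) q"
    and "bary_comb a b c (sa, sb, sc) s"
    and "replicate_mset i1 p1 + replicate_mset i2 p2 + replicate_mset i3 p3 + replicate_mset i4 (midpoint p1 p2)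
      + replicate_mset i5 (midpoint p2 p3) + replicate_mset i6 (midpoint p3 p1)
      + replicate_mset i7 ((1/3) *\<^sub>R (p1 + p2 + p3)) = {#a, b, c, q, s#}"
  shows "ps12_Q TYPE(2) p1 p2 p3 i1 i2 i3 i4 i5 i6 i7 x = 1 / r * 2 *
    measure lborel {(t, u). 0 \<le> t \<and> 0 \<le> u \<and> t * qa + u * sa \<le> xa \<and>
      t * qb + u * sb \<le> xb \<and> t * qc + u * sc \<le> xc}"
  unfolding base_ratio(2)[symmetric] ps12_Q_def Let_def ps12_pt_simps assms(4)
  by (rule simplex_spline_2[OF base_ratio(1) assms(1,2,3)]) (rule refl)

lemma ps12_Q_3:
  assumes "bary_comb a b c (xa, xb, xc) x" and "bary_comb a b c (qa, qb, qc) q"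
    and "bary_comb a b c (sa, sb, sc) s" and "bary_comb a b c (ua, ub, uc) u"
    and "replicate_mset i1 p1 + replicate_mset i2 p2 + replicate_mset i3 p3 + replicate_mset i4 (midpoint p1 p2)
      + replicate_mset i5 (midpoint p2 p3) + replicate_mset i6 (midpoint p3 p1)
      + replicate_mset i7 ((1/3) *\<^sub>R (p1 + p2 + p3)) = {#a, b, c, q, s, u#}"
  shows "ps12_Q TYPE(3) p1 p2 p3 i1 i2 i3 i4 i5 i6 i7 x = 1 / r * 6 *
    measure lborel {(t, v, w). 0 \<le> t \<and> 0 \<le> v \<and> 0 \<le> w \<and>
      t * qa + v * sa + w * ua \<le> xa \<and>
      t * qb + v * sb + w * ub \<le> xb \<and> t * qc + v * sc + w * uc \<le> xc}"
  unfolding base_ratio(2)[symmetric] ps12_Q_def Let_def ps12_pt_simps assms(5)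
  by (rule simplex_spline_3[OF base_ratio(1) assms(1,2,3,4)]) (rule refl)

end

lemmas bary_simps = bary_comb_def vec_eq_iff forall_2 midpoint_def

section \<open>The twelve splines up to symmetry\<close>

context
  fixes p1 p2 p3 x :: "real^2" and b1 b2 b3 :: real
  assumes nc: "\<not> collinear {p1, p2, p3}"
    and x: "x = b1 *\<^sub>R p1 + b2 *\<^sub>R p2 + b3 *\<^sub>R p3" and sum1: "b1 + b2 + b3 = 1"
    and nn: "0 \<le> b1" "0 \<le> b2" "0 \<le> b3"
begin

lemma s1a_eq_Q: "1/4 * ps12_Q TYPE(1) p1 p2 p3 2 0 0 1 0 1 0 x = s1a b1 b2 b3"
proof -
  \<comment> \<open>Pattern of all twelve evaluations: a base triangle, its area ratio
    \<open>r\<close>, the coordinates of \<open>x\<close>, then those of the other knots. Here the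
    other knot is itself a base vertex, hence (1, 0, 0); the inequalities with left side 0 hold
    inside the triangle.\<close>
  note * = ps12_Q_1[OF nc, where
      r = "1/4" and x = x and a = "p1" and b = "midpoint p1 p2" and c = "midpoint p3 p1" and
      q = "p1" and xa = "b1 - b2 - b3" and xb = "2 * b2" and xc = "2 * b3" and qa = "1" and
      qb = "0" and qc = "0"]
  have "ps12_Q TYPE(1) p1 p2 p3 2 0 0 1 0 1 0 x = 1 / (1/4) * measure lborel {t. 0 \<le> t \<and>
    t * (1) \<le> b1 - b2 - b3 \<and> t * (0) \<le> 2 * b2 \<and> t * (0) \<le> 2 * b3}"
    by (rule *) (use sum1 in \<open>simp_all add: bary_simps tri_det_def x field_simps eval_nat_numeral
      add_mset_commute\<close>)
  also have "{t. 0 \<le> t \<and> t * (1) \<le> b1 - b2 - b3 \<and> t * (0) \<le> 2 * b2 \<and>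
    t * (0) \<le> 2 * b3} = {t. 0 \<le> t \<and> t \<le> b1 - b2 - b3}"
    using nn by (auto simp: min_def)
  finally show ?thesis
    unfolding length_Icc_max0 using nn by (simp add: s1a_def max_def min_def)
qed

lemma s1b_eq_Q: "1/3 * ps12_Q TYPE(1) p1 p2 p3 1 1 0 1 0 0 1 x = s1b b1 b2 b3"
proof -
  note * = ps12_Q_1[OF nc, where
      r = "1/3" and x = x and a = "p1" and b = "p2" and c = "(1/3) *\<^sub>R (p1 + p2 + p3)" and
      q = "midpoint p1 p2" and xa = "b1 - b3" and xb = "b2 - b3" and xc = "3 * b3" and
      qa = "1/2" and qb = "1/2" and qc = "0"]
  have "ps12_Q TYPE(1) p1 p2 p3 1 1 0 1 0 0 1 x = 1 / (1/3) * measure lborel {t. 0 \<le> t \<and>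
    t * (1/2) \<le> b1 - b3 \<and> t * (1/2) \<le> b2 - b3 \<and> t * (0) \<le> 3 * b3}"
    by (rule *) (use sum1 in \<open>simp_all add: bary_simps tri_det_def x field_simps eval_nat_numeral
      add_mset_commute\<close>)
  also have "{t. 0 \<le> t \<and> t * (1/2) \<le> b1 - b3 \<and> t * (1/2) \<le> b2 - b3 \<and>
    t * (0) \<le> 3 * b3} = {t. 0 \<le> t \<and> t \<le> 2 * (min b1 b2 - b3)}"
    using nn by (auto simp: min_def)
  finally show ?thesis
    unfolding length_Icc_max0 using nn by (simp add: s1b_def max_def min_def)
qed

lemma s1c_eq_Q: "1/3 * ps12_Q TYPE(1) p1 p2 p3 1 0 0 1 0 1 1 x = s1c b1 b2 b3"
proof -
  note * = ps12_Q_1[OF nc, where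
      r = "1/4" and x = x and a = "p1" and b = "midpoint p1 p2" and c = "midpoint p3 p1" and
      q = "(1/3) *\<^sub>R (p1 + p2 + p3)" and xa = "b1 - b2 - b3" and xb = "2 * b2" and
      xc = "2 * b3" and qa = "-1/3" and qb = "2/3" and qc = "2/3"]
  have "ps12_Q TYPE(1) p1 p2 p3 1 0 0 1 0 1 1 x = 1 / (1/4) * measure lborel {t. 0 \<le> t \<and>
    t * (-1/3) \<le> b1 - b2 - b3 \<and> t * (2/3) \<le> 2 * b2 \<and> t * (2/3) \<le> 2 * b3}"
    by (rule *) (use sum1 in \<open>simp_all add: bary_simps tri_det_def x field_simps eval_nat_numeral
      add_mset_commute\<close>)
  \<comment> \<open>The barycentre lies outside the base triangle, so its first coordinate is
    negative and the first inequality bounds \<open>t\<close> from below. The fibre is an interval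
    that may start to the right of 0.\<close>
  also have "{t. 0 \<le> t \<and> t * (-1/3) \<le> b1 - b2 - b3 \<and> t * (2/3) \<le> 2 * b2 \<and>
    t * (2/3) \<le> 2 * b3} = {3 * max 0 (b2 + b3 - b1)..3 * min b2 b3}"
    using nn by (auto simp: max_def min_def)
  finally show ?thesis
    using sum1 by (simp add: measure_def emeasure_lborel_Icc_eq s1c_def max_def min_def)
qed

lemma s1d_eq_Q: "1/4 * ps12_Q TYPE(1) p1 p2 p3 0 0 0 1 1 1 1 x = s1d b1 b2 b3"
proof -
  note * = ps12_Q_1[OF nc, where
      r = "1/4" and x = x and a = "midpoint p1 p2" and b = "midpoint p2 p3" and
      c = "midpoint p3 p1" and q = "(1/3) *\<^sub>R (p1 + p2 + p3)" and xa = "b1 + b2 - b3" and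
      xb = "b2 + b3 - b1" and xc = "b3 + b1 - b2" and qa = "1/3" and qb = "1/3" and qc = "1/3"]
  have "ps12_Q TYPE(1) p1 p2 p3 0 0 0 1 1 1 1 x = 1 / (1/4) * measure lborel {t. 0 \<le> t \<and>
    t * (1/3) \<le> b1 + b2 - b3 \<and> t * (1/3) \<le> b2 + b3 - b1 \<and>
    t * (1/3) \<le> b3 + b1 - b2}"
    by (rule *) (use sum1 in \<open>simp_all add: bary_simps tri_det_def x field_simps eval_nat_numeral
      add_mset_commute\<close>)
  also have "{t. 0 \<le> t \<and> t * (1/3) \<le> b1 + b2 - b3 \<and>
    t * (1/3) \<le> b2 + b3 - b1 \<and> t * (1/3) \<le> b3 + b1 - b2} = {t. 0 \<le> t \<and>
    t \<le> 3 * min (b1 + b2 - b3) (min (b2 + b3 - b1) (b3 + b1 - b2))}"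
    using nn by (auto simp: min_def)
  finally show ?thesis
    unfolding length_Icc_max0 using nn by (simp add: s1d_def max_def min_def)
qed

lemma s2a_eq_Q: "1/4 * ps12_Q TYPE(2) p1 p2 p3 3 0 0 1 0 1 0 x = s2a b1 b2 b3"
proof -
  note * = ps12_Q_2[OF nc, where
      r = "1/4" and x = x and a = "p1" and b = "midpoint p1 p2" and c = "midpoint p3 p1" and
      q = "p1" and s = "p1" and xa = "b1 - b2 - b3" and xb = "2 * b2" and xc = "2 * b3" and
      qa = "1" and qb = "0" and qc = "0" and sa = "1" and sb = "0" and sc = "0"]
  have "ps12_Q TYPE(2) p1 p2 p3 3 0 0 1 0 1 0 x =
    1 / (1/4) * 2 * measure lborel {(t, u). 0 \<le> t \<and> 0 \<le> u \<and>
    t * (1) + u * (1) \<le> b1 - b2 - b3 \<and> t * (0) + u * (0) \<le> 2 * b2 \<and>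
    t * (0) + u * (0) \<le> 2 * b3}"
    by (rule *) (use sum1 in \<open>simp_all add: bary_simps tri_det_def x field_simps eval_nat_numeral
      add_mset_commute\<close>)
  also have "{(t, u). 0 \<le> t \<and> 0 \<le> u \<and> t * (1) + u * (1) \<le> b1 - b2 - b3 \<and>
    t * (0) + u * (0) \<le> 2 * b2 \<and> t * (0) + u * (0) \<le> 2 * b3} = {(t, u). 0 \<le> t \<and>
    0 \<le> u \<and> t + u \<le> b1 - b2 - b3}"
    using nn by (auto simp: min_def)
  finally show ?thesis
    unfolding area_triangle
      using nn by (simp add: s2a_def tpow_nonpos cancel_ab_semigroup_add_class.diff_right_commute[of b1
      b3 b2])
qed

lemma s2b_eq_Q: "1/2 * ps12_Q TYPE(2) p1 p2 p3 2 1 0 1 0 1 0 x = s2b b1 b2 b3"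
proof -
  note * = ps12_Q_2[OF nc, where
      r = "1/2" and x = x and a = "p1" and b = "p2" and c = "midpoint p3 p1" and
      q = "midpoint p1 p2" and s = "p1" and xa = "b1 - b3" and xb = "b2" and xc = "2 * b3" and
      qa = "1/2" and qb = "1/2" and qc = "0" and sa = "1" and sb = "0" and sc = "0"]
  have "ps12_Q TYPE(2) p1 p2 p3 2 1 0 1 0 1 0 x =
    1 / (1/2) * 2 * measure lborel {(t, u). 0 \<le> t \<and> 0 \<le> u \<and>
    t * (1/2) + u * (1) \<le> b1 - b3 \<and> t * (1/2) + u * (0) \<le> b2 \<and>
    t * (0) + u * (0) \<le> 2 * b3}"
    by (rule *) (use sum1 in \<open>simp_all add: bary_simps tri_det_def x field_simps eval_nat_numeral
      add_mset_commute\<close>)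
  also have "{(t, u). 0 \<le> t \<and> 0 \<le> u \<and> t * (1/2) + u * (1) \<le> b1 - b3 \<and>
    t * (1/2) + u * (0) \<le> b2 \<and> t * (0) + u * (0) \<le> 2 * b3} = {(t, u). 0 \<le> t \<and>
    0 \<le> u \<and> t \<le> 2 * b2 \<and> t / 2 + u \<le> b1 - b3}"
    using nn by (auto simp: min_def)
  finally show ?thesis
    unfolding area_trapezoid[OF nn(2)]
      using nn by (simp add: s2b_def tpow_nonpos cancel_ab_semigroup_add_class.diff_right_commute[of b1
      b3 b2])
qed

lemma s2c_eq_Q: "3/4 * ps12_Q TYPE(2) p1 p2 p3 1 1 0 1 1 1 0 x = s2c b1 b2 b3"
proof -
  \<comment> \<open>With this base the midpoint of \<open>p3\<close> and \<open>p1\<close> has the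
    coordinates (1/2, -1/2, 1); the negative one produces the bound on \<open>u - t\<close> in the
    pentagon.\<close>
  note * = ps12_Q_2[OF nc, where
      r = "1/2" and x = x and a = "p1" and b = "p2" and c = "midpoint p2 p3" and
      q = "midpoint p3 p1" and s = "midpoint p1 p2" and xa = "b1" and xb = "b2 - b3" and
      xc = "2 * b3" and qa = "1/2" and qb = "-1/2" and qc = "1" and sa = "1/2" and sb = "1/2" and
      sc = "0"]
  have "ps12_Q TYPE(2) p1 p2 p3 1 1 0 1 1 1 0 x =
    1 / (1/2) * 2 * measure lborel {(t, u). 0 \<le> t \<and> 0 \<le> u \<and>
    t * (1/2) + u * (1/2) \<le> b1 \<and> t * (-1/2) + u * (1/2) \<le> b2 - b3 \<and>
    t * (1) + u * (0) \<le> 2 * b3}"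
    by (rule *) (use sum1 in \<open>simp_all add: bary_simps tri_det_def x field_simps eval_nat_numeral
      add_mset_commute\<close>)
  also have "{(t, u). 0 \<le> t \<and> 0 \<le> u \<and> t * (1/2) + u * (1/2) \<le> b1 \<and>
    t * (-1/2) + u * (1/2) \<le> b2 - b3 \<and> t * (1) + u * (0) \<le> 2 * b3} =
    {(t, u). 0 \<le> t \<and> 0 \<le> u \<and> t \<le> 2 * b3 \<and> u - t \<le> 2 * (b2 - b3) \<and>
    t + u \<le> 2 * b1}"
    using nn by (auto simp: min_def)
  finally show ?thesis
    unfolding area_pentagon[OF nn(3) nn(2)]
      using nn by (simp add: s2c_def tpow_nonpos cancel_ab_semigroup_add_class.diff_right_commute[of b1
      b3 b2])
qed

lemma s3a_eq_Q: "1/4 * ps12_Q TYPE(3) p1 p2 p3 4 0 0 1 0 1 0 x = s3a b1 b2 b3"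
proof -
  note * = ps12_Q_3[OF nc, where
      r = "1/4" and x = x and a = "p1" and b = "midpoint p1 p2" and c = "midpoint p3 p1" and
      q = "p1" and s = "p1" and u = "p1" and xa = "b1 - b2 - b3" and xb = "2 * b2" and
      xc = "2 * b3" and qa = "1" and qb = "0" and qc = "0" and sa = "1" and sb = "0" and
      sc = "0" and ua = "1" and ub = "0" and uc = "0"]
  have "ps12_Q TYPE(3) p1 p2 p3 4 0 0 1 0 1 0 x =
    1 / (1/4) * 6 * measure lborel {(t, u, v). 0 \<le> t \<and> 0 \<le> u \<and> 0 \<le> v \<and>
    t * (1) + u * (1) + v * (1) \<le> b1 - b2 - b3 \<and> t * (0) + u * (0) +
    v * (0) \<le> 2 * b2 \<and> t * (0) + u * (0) + v * (0) \<le> 2 * b3}"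
    by (rule *) (use sum1 in \<open>simp_all add: bary_simps tri_det_def x field_simps eval_nat_numeral
      add_mset_commute\<close>)
  also have "{(t, u, v). 0 \<le> t \<and> 0 \<le> u \<and> 0 \<le> v \<and>
    t * (1) + u * (1) + v * (1) \<le> b1 - b2 - b3 \<and> t * (0) + u * (0) +
    v * (0) \<le> 2 * b2 \<and> t * (0) + u * (0) + v * (0) \<le> 2 * b3} = {(t, u, v). 0 \<le> t \<and>
    0 \<le> u \<and> 0 \<le> v \<and> t + u + v \<le> b1 - b2 - b3}"
    using nn by (auto simp: min_def)
  finally show ?thesis
    unfolding volume_tetrahedron
      using nn by (simp add: s3a_def tpow_nonneg cancel_ab_semigroup_add_class.diff_right_commute[of b1
      b3 b2] field_simps)
qed

lemma s3b_eq_Q: "1/2 * ps12_Q TYPE(3) p1 p2 p3 3 1 0 1 0 1 0 x = s3b b1 b2 b3"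
proof -
  note * = ps12_Q_3[OF nc, where
      r = "1/2" and x = x and a = "p1" and b = "p2" and c = "midpoint p3 p1" and
      q = "midpoint p1 p2" and s = "p1" and u = "p1" and xa = "b1 - b3" and xb = "b2" and
      xc = "2 * b3" and qa = "1/2" and qb = "1/2" and qc = "0" and sa = "1" and sb = "0" and
      sc = "0" and ua = "1" and ub = "0" and uc = "0"]
  have "ps12_Q TYPE(3) p1 p2 p3 3 1 0 1 0 1 0 x =
    1 / (1/2) * 6 * measure lborel {(t, u, v). 0 \<le> t \<and> 0 \<le> u \<and> 0 \<le> v \<and>
    t * (1/2) + u * (1) + v * (1) \<le> b1 - b3 \<and> t * (1/2) + u * (0) + v * (0) \<le> b2 \<and>
    t * (0) + u * (0) + v * (0) \<le> 2 * b3}"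
    by (rule *) (use sum1 in \<open>simp_all add: bary_simps tri_det_def x field_simps eval_nat_numeral
      add_mset_commute\<close>)
  also have "{(t, u, v). 0 \<le> t \<and> 0 \<le> u \<and> 0 \<le> v \<and>
    t * (1/2) + u * (1) + v * (1) \<le> b1 - b3 \<and> t * (1/2) + u * (0) + v * (0) \<le> b2 \<and>
    t * (0) + u * (0) + v * (0) \<le> 2 * b3} = {(t, u, v). 0 \<le> t \<and> 0 \<le> u \<and>
    0 \<le> v \<and> t \<le> 2 * b2 \<and> t / 2 + u + v \<le> b1 - b3}"
    using nn by (auto simp: min_def)
  finally show ?thesis
    unfolding volume_frustum[OF nn(2)]
      using nn by (simp add: s3b_def tpow_nonneg cancel_ab_semigroup_add_class.diff_right_commute[of b1
      b3 b2] field_simps)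
qed

lemma s3c_eq_Q: "ps12_Q TYPE(3) p1 p2 p3 2 2 1 1 0 0 0 x = s3c b1 b2 b3"
proof -
  note * = ps12_Q_3[OF nc, where
      r = "1" and x = x and a = "p1" and b = "p2" and c = "p3" and q = "midpoint p1 p2" and
      s = "p1" and u = "p2" and xa = "b1" and xb = "b2" and xc = "b3" and qa = "1/2" and
      qb = "1/2" and qc = "0" and sa = "1" and sb = "0" and sc = "0" and ua = "0" and ub = "1" and
      uc = "0"]
  have "ps12_Q TYPE(3) p1 p2 p3 2 2 1 1 0 0 0 x =
    1 / (1) * 6 * measure lborel {(t, u, v). 0 \<le> t \<and> 0 \<le> u \<and> 0 \<le> v \<and>
    t * (1/2) + u * (1) + v * (0) \<le> b1 \<and> t * (1/2) + u * (0) + v * (1) \<le> b2 \<and>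
    t * (0) + u * (0) + v * (0) \<le> b3}"
    by (rule *) (use sum1 in \<open>simp_all add: bary_simps tri_det_def x field_simps eval_nat_numeral
      add_mset_commute\<close>)
  also have "{(t, u, v). 0 \<le> t \<and> 0 \<le> u \<and> 0 \<le> v \<and>
    t * (1/2) + u * (1) + v * (0) \<le> b1 \<and> t * (1/2) + u * (0) + v * (1) \<le> b2 \<and>
    t * (0) + u * (0) + v * (0) \<le> b3} = {(t, u, v). 0 \<le> t \<and> 0 \<le> u \<and>
    0 \<le> v \<and> t / 2 + u \<le> b1 \<and> t / 2 + v \<le> b2}"
    using nn by (auto simp: min_def)
  finally show ?thesis
    unfolding volume_wedge[OF nn(1,2)]
      using nn by (simp add: s3c_def tpow_nonneg cancel_ab_semigroup_add_class.diff_right_commute[of b1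
      b3 b2] field_simps)
qed

lemma s3d_eq_Q: "ps12_Q TYPE(3) p1 p2 p3 2 1 1 1 0 1 0 x = s3d b1 b2 b3"
proof -
  note * = ps12_Q_3[OF nc, where
      r = "1" and x = x and a = "p1" and b = "p2" and c = "p3" and q = "midpoint p1 p2" and
      s = "midpoint p3 p1" and u = "p1" and xa = "b1" and xb = "b2" and xc = "b3" and
      qa = "1/2" and qb = "1/2" and qc = "0" and sa = "1/2" and sb = "0" and sc = "1/2" and
      ua = "1" and ub = "0" and uc = "0"]
  have "ps12_Q TYPE(3) p1 p2 p3 2 1 1 1 0 1 0 x =
    1 / (1) * 6 * measure lborel {(t, u, v). 0 \<le> t \<and> 0 \<le> u \<and> 0 \<le> v \<and>
    t * (1/2) + u * (1/2) + v * (1) \<le> b1 \<and> t * (1/2) + u * (0) + v * (0) \<le> b2 \<and>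
    t * (0) + u * (1/2) + v * (0) \<le> b3}"
    by (rule *) (use sum1 in \<open>simp_all add: bary_simps tri_det_def x field_simps eval_nat_numeral
      add_mset_commute\<close>)
  also have "{(t, u, v). 0 \<le> t \<and> 0 \<le> u \<and> 0 \<le> v \<and>
    t * (1/2) + u * (1/2) + v * (1) \<le> b1 \<and> t * (1/2) + u * (0) + v * (0) \<le> b2 \<and>
    t * (0) + u * (1/2) + v * (0) \<le> b3} = {(t, u, v). 0 \<le> t \<and> 0 \<le> u \<and>
    0 \<le> v \<and> t \<le> 2 * b2 \<and> u \<le> 2 * b3 \<and> t / 2 + u / 2 + v \<le> b1}"
    using nn by (auto simp: min_def)
  finally show ?thesis
    unfolding volume_hexahedron[OF nn(2,3)]
      using nn by (simp add: s3d_def tpow_nonneg cancel_ab_semigroup_add_class.diff_right_commute[of b1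
      b3 b2] field_simps)
qed

lemma s3e_eq_Q: "1/4 * ps12_Q TYPE(3) p1 p2 p3 1 1 1 1 1 1 0 x = s3e b1 b2 b3"
proof -
  note * = ps12_Q_3[OF nc, where
      r = "1" and x = x and a = "p1" and b = "p2" and c = "p3" and q = "midpoint p2 p3" and
      s = "midpoint p1 p2" and u = "midpoint p3 p1" and xa = "b1" and xb = "b2" and xc = "b3" and
      qa = "0" and qb = "1/2" and qc = "1/2" and sa = "1/2" and sb = "1/2" and sc = "0" and
      ua = "1/2" and ub = "0" and uc = "1/2"]
  have "ps12_Q TYPE(3) p1 p2 p3 1 1 1 1 1 1 0 x =
    1 / (1) * 6 * measure lborel {(t, u, v). 0 \<le> t \<and> 0 \<le> u \<and> 0 \<le> v \<and>
    t * (0) + u * (1/2) + v * (1/2) \<le> b1 \<and> t * (1/2) + u * (1/2) + v * (0) \<le> b2 \<and>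
    t * (1/2) + u * (0) + v * (1/2) \<le> b3}"
    by (rule *) (use sum1 in \<open>simp_all add: bary_simps tri_det_def x field_simps eval_nat_numeral
      add_mset_commute\<close>)
  also have "{(t, u, v). 0 \<le> t \<and> 0 \<le> u \<and> 0 \<le> v \<and>
    t * (0) + u * (1/2) + v * (1/2) \<le> b1 \<and> t * (1/2) + u * (1/2) + v * (0) \<le> b2 \<and>
    t * (1/2) + u * (0) + v * (1/2) \<le> b3} = {(t, u, v). 0 \<le> t \<and> 0 \<le> u \<and>
    0 \<le> v \<and> u + v \<le> 2 * b1 \<and> u + t \<le> 2 * b2 \<and> t + v \<le> 2 * b3}"
    using nn by (auto simp: min_def)
  also have "1 / (1) * 6 * measure lborel \<dots> = 4 * s3e b1 b2 b3"
  proof -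
    \<comment> \<open>All bounds of the fibre are doubled. Naming the minimum lets each argument be
      written as 2 times an argument of \<open>s3e\<close>, and \<open>tpow_2_mult\<close> extracts
      the factor 2^3.\<close>
    define m where "m = min b2 b3"
    have "min (2 * b2) (2 * b3) = 2 * m" by (simp add: m_def min_def)
    moreover have "2 * b1 - 2 * b2 + 2 * m = 2 * (b1 - b2 + m)" "2 * b1 - 2 * b3 + 2 * m = 2 * (b1 - b3 + m)"
      "2 * b1 - 2 * b2 - 2 * b3 + 2 * (2 * m) = 2 * (b1 - b2 - b3 + 2 * m)"
      "2 * b1 - 2 * b2 = 2 * (b1 - b2)" "2 * b1 - 2 * b3 = 2 * (b1 - b3)" "2 * (b1 - b2) - 2 * b3 =
        2 * (b1 - b2 - b3)"
      by simp_all
    ultimately show ?thesis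
      using nn by (simp only: volume_pairwise_sums[of "2 * b1" "2 * b2" "2 * b3"] mult_nonneg_nonneg
        zero_le_numeral tpow_2_mult s3e_def m_def[symmetric])
        (simp add: field_simps)
  qed
  finally show ?thesis by simp
qed

end

subsection \<open>The recurrence\<close>

definition sparse_entry :: "(nat \<times> real) list list \<Rightarrow> nat \<Rightarrow> nat
  \<Rightarrow> real" where
  "sparse_entry M i j = (case map_of (M ! (i - 1)) j of None \<Rightarrow> 0 | Some r \<Rightarrow> r)"

text \<open>Reduces a claim about all columns to the few listed entries of a row, since an unlisted
  column has the entry 0.\<close>

lemma sparse_entry_nonneg:
  assumes "\<forall>r\<in>snd ` set (M ! (i - 1)). 0 \<le> r * s"
  shows "0 \<le> sparse_entry M i j * s"
  using assms by (force simp: sparse_entry_def split: option.split dest: map_of_SomeD)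

definition basis1 :: "real \<Rightarrow> real \<Rightarrow> real \<Rightarrow> real list" where
  "basis1 a b c = [s1a a b c, s1a b c a, s1a c a b, s1b a b c, s1b b c a, s1b c a b,
     s1c a b c, s1c b c a, s1c c a b, s1d a b c]"

definition basis2 :: "real \<Rightarrow> real \<Rightarrow> real \<Rightarrow> real list" where
  "basis2 a b c = [s2a a b c, s2b a b c, s2c a b c, s2b b a c, s2a b c a, s2b b c a,
     s2c b c a, s2b c b a, s2a c a b, s2b c a b, s2c c a b, s2b a c b]"

definition basis3 :: "real \<Rightarrow> real \<Rightarrow> real \<Rightarrow> real list" where
  "basis3 a b c = [s3a a b c, s3b a b c, s3c a b c, s3b b a c, s3a b c a, s3b b c a,
     s3c b c a, s3b c b a, s3a c a b, s3b c a b, s3c c a b, s3b a c b,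
     s3d a b c, s3d b c a, s3d c a b, s3e a b c]"

lemma atLeastAtMost_literals:
  "{1..10 :: nat} = {1, 2, 3, 4, 5, 6, 7, 8, 9, 10}"
  "{1..12 :: nat} = {1, 2, 3, 4, 5, 6, 7, 8, 9, 10, 11, 12}"
  "{1..16 :: nat} = {1, 2, 3, 4, 5, 6, 7, 8, 9, 10, 11, 12, 13, 14, 15, 16}"
  by (auto; presburger)+

context
  fixes a b c :: real
  assumes nn: "0 \<le> a" "0 \<le> b" "0 \<le> c" and sum1: "a + b + c = 1"
begin

text \<open>Homogenises the entries of the matrices, so that they match the identities and support
  bounds proved above for arbitrary nonnegative numbers.\<close>

lemma gammas: "2 * a - 1 = a - b - c" "2 * b - 1 = b - c - a" "2 * c - 1 = c - a - b"
  using sum1 by auto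

text \<open>\<open>basis1\<close> lists cyclic arguments only. These equations normalise the other
  orders, which appear when a recurrence is instantiated at a transposed triple.\<close>

lemma s1_perm: "s1a a c b = s1a a b c" "s1a b a c = s1a b c a" "s1a c b a = s1a c a b"
  "s1b b a c = s1b a b c" "s1b c b a = s1b b c a" "s1b a c b = s1b c a b"
  "s1c a c b = s1c a b c" "s1c b a c = s1c b c a" "s1c c b a = s1c c a b"
  "s1d b c a = s1d a b c" "s1d c a b = s1d a b c"
  by (auto simp: s1a_def s1b_def s1c_def s1d_def ac_simps)

lemma s2_perm: "s2a a c b = s2a a b c" "s2a b a c = s2a b c a" "s2a c b a = s2a c a b"
  "s2c b a c = s2c a b c" "s2c c b a = s2c b c a" "s2c a c b = s2c c a b"
proof -
  have "a - c - b = a - b - c" "b - a - c = b - c - a" "c - b - a = c - a - b" by auto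
  then show "s2a a c b = s2a a b c" "s2a b a c = s2a b c a" "s2a c b a = s2a c a b"
    by (simp_all only: s2a_def)
  show "s2c b a c = s2c a b c" "s2c c b a = s2c b c a" "s2c a c b = s2c c a b"
    using nn by (simp_all add: s2c_commute[of b a c] s2c_commute[of c b a] s2c_commute[of a c b])
qed

lemma s2_rec:
  "\<forall>j\<in>{1..12}. basis2 a b c ! (j - 1) = (\<Sum>i =
    1..10. basis1 a b c ! (i - 1) * sparse_entry (R2_rows a b c) i j)"
proof -
  note rec = s2a_eq[OF nn(1) nn(2) nn(3)]
    s2a_eq[OF nn(2) nn(3) nn(1)]
    s2a_eq[OF nn(3) nn(1) nn(2)]
    s2b_eq[OF nn(1) nn(2) nn(3)]
    s2b_eq[OF nn(2) nn(3) nn(1)]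
    s2b_eq[OF nn(3) nn(1) nn(2)]
    s2b_eq[OF nn(2) nn(1) nn(3)]
    s2b_eq[OF nn(3) nn(2) nn(1)]
    s2b_eq[OF nn(1) nn(3) nn(2)]
    s2c_eq[OF nn(1) nn(2) nn(3)]
    s2c_eq[OF nn(2) nn(3) nn(1)]
    s2c_eq[OF nn(3) nn(1) nn(2)]
  show ?thesis
    unfolding atLeastAtMost_literals basis1_def basis2_def sparse_entry_def R2_rows_def Let_def gammas
    by (simp add: rec s1_perm) (simp add: field_simps)
qed

lemma s3_rec:
  "\<forall>j\<in>{1..16}. basis3 a b c ! (j - 1) = (\<Sum>i =
    1..12. basis2 a b c ! (i - 1) * sparse_entry (R3_rows a b c) i j)"
proof -
  note rec = s3a_eq[OF nn(1) nn(2) nn(3)]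
    s3a_eq[OF nn(2) nn(3) nn(1)]
    s3a_eq[OF nn(3) nn(1) nn(2)]
    s3b_eq[OF nn(1) nn(2) nn(3)]
    s3b_eq[OF nn(2) nn(3) nn(1)]
    s3b_eq[OF nn(3) nn(1) nn(2)]
    s3b_eq[OF nn(2) nn(1) nn(3)]
    s3b_eq[OF nn(3) nn(2) nn(1)]
    s3b_eq[OF nn(1) nn(3) nn(2)]
    s3c_eq[OF nn(1) nn(2) nn(3)]
    s3c_eq[OF nn(2) nn(3) nn(1)]
    s3c_eq[OF nn(3) nn(1) nn(2)]
    s3d_eq[OF nn(1) nn(2) nn(3)]
    s3d_eq[OF nn(2) nn(3) nn(1)]
    s3d_eq[OF nn(3) nn(1) nn(2)]
    s3e_eq[OF nn(1) nn(2) nn(3)]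
  show ?thesis
    unfolding atLeastAtMost_literals basis2_def basis3_def sparse_entry_def R3_rows_def Let_def gammas
    by (simp add: rec s2_perm) (simp add: field_simps)
qed

lemma s1_support_nonneg:
  assumes "i \<in> {1..10}"
  shows "0 \<le> sparse_entry (R2_rows a b c) i j * basis1 a b c ! (i - 1)"
proof (rule sparse_entry_nonneg)
  note sup = s1_support[OF nn(1) nn(2) nn(3)]
    s1_nonneg[OF nn(1) nn(2) nn(3)] s1_support[OF nn(2) nn(3) nn(1)]
    s1_nonneg[OF nn(2) nn(3) nn(1)] s1_support[OF nn(3) nn(1) nn(2)]
    s1_nonneg[OF nn(3) nn(1) nn(2)]
  \<comment> \<open>The left sides are what the simplifier makes of the negated homogeneous gammas
    in the last row of \<open>R2_rows\<close>; the equations return them to the form in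
    \<open>s1_support\<close>.\<close>
  have "b - (c - a) = a + b - c" "c - (a - b) = b + c - a" "a - (b - c) = c + a - b" by auto
  note sup = this sup
  show "\<forall>r\<in>snd ` set (R2_rows a b c ! (i - 1)). 0 \<le> r * basis1 a b c ! (i - 1)"
    using assms unfolding atLeastAtMost_literals basis1_def R2_rows_def Let_def gammas
    by (elim insertE emptyE) (simp_all add: sup nn s1_perm)
qed

text \<open>The signs in \<open>s2c\<close> hide its positivity. The recurrence exhibits
  \<open>s2b\<close> and \<open>s2c\<close> as sums of terms that are nonnegative by
  \<open>s1_support\<close>.\<close>

lemma s2_nonneg: "0 \<le> s2a a b c" "0 \<le> s2b a b c" "0 \<le> s2c a b c"
proof -
  note sup = s1_support[OF nn] s1_nonneg[OF nn] s1_nonneg[OF nn(2) nn(3) nn(1)]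
  show "0 \<le> s2a a b c" by (simp add: s2a_def tpow_def)
  show "0 \<le> s2b a b c"
    unfolding s2b_eq[OF nn] by (intro add_nonneg_nonneg) (simp_all add: sup nn)
  show "0 \<le> s2c a b c"
    unfolding s2c_eq[OF nn] by (intro add_nonneg_nonneg) (simp_all add: sup nn)
qed

end

text \<open>Stated outside the context because \<open>s2_nonneg\<close> has to be instantiated at
  all six permutations of the coordinates.\<close>

lemma s2_support_nonneg:
  fixes a b c :: real
  assumes nn: "0 \<le> a" "0 \<le> b" "0 \<le> c" and sum1: "a + b + c = 1" and i: "i \<in> {1..12}"
  shows "0 \<le> sparse_entry (R3_rows a b c) i j * basis2 a b c ! (i - 1)"
proof (rule sparse_entry_nonneg)
  have sums: "b + c + a = 1" "c + a + b = 1" "b + a + c = 1" "c + b + a = 1" "a + c + b = 1"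
    using sum1 by auto
  note pos = s2_nonneg[OF nn(1) nn(2) nn(3) sum1]
    s2_nonneg[OF nn(2) nn(3) nn(1) sums(1)]
    s2_nonneg[OF nn(3) nn(1) nn(2) sums(2)]
    s2_nonneg[OF nn(2) nn(1) nn(3) sums(3)]
    s2_nonneg[OF nn(3) nn(2) nn(1) sums(4)]
    s2_nonneg[OF nn(1) nn(3) nn(2) sums(5)]
  note sup = s2b_support[OF nn(1) nn(2) nn(3)]
    s2b_support[OF nn(2) nn(3) nn(1)]
    s2b_support[OF nn(3) nn(1) nn(2)]
    s2b_support[OF nn(2) nn(1) nn(3)]
    s2b_support[OF nn(3) nn(2) nn(1)]
    s2b_support[OF nn(1) nn(3) nn(2)]
  have "0 \<le> (a - b - c) * s2a a b c" "0 \<le> (b - c - a) * s2a b c a" "0 \<le> (c - a - b) * s2a c a b"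
    by (simp_all add: s2a_def tpow_def max_def)
  note sup = this sup
  show "\<forall>r\<in>snd ` set (R3_rows a b c ! (i - 1)). 0 \<le> r * basis2 a b c ! (i - 1)"
    using i unfolding atLeastAtMost_literals basis2_def R3_rows_def Let_def gammas[OF nn sum1]
    by (elim insertE emptyE) (simp_all add: sup pos nn)
qed

section \<open>From identities in coordinates to the splines at a point\<close>

context
  fixes p1 p2 p3 x :: "real^2" and b1 b2 b3 :: real
  assumes nc: "\<not> collinear {p1, p2, p3}"
    and x: "x = b1 *\<^sub>R p1 + b2 *\<^sub>R p2 + b3 *\<^sub>R p3" and sum1: "b1 + b2 + b3 = 1"
    and nn: "0 \<le> b1" "0 \<le> b2" "0 \<le> b3"
begin

lemma rotations:
  "\<not> collinear {p2, p3, p1}" "x = b2 *\<^sub>R p2 + b3 *\<^sub>R p3 + b1 *\<^sub>R p1" "b2 + b3 + b1 = 1"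
  "\<not> collinear {p3, p1, p2}" "x = b3 *\<^sub>R p3 + b1 *\<^sub>R p1 + b2 *\<^sub>R p2" "b3 + b1 + b2 = 1"
  "\<not> collinear {p2, p1, p3}" "x = b2 *\<^sub>R p2 + b1 *\<^sub>R p1 + b3 *\<^sub>R p3" "b2 + b1 + b3 = 1"
  "\<not> collinear {p3, p2, p1}" "x = b3 *\<^sub>R p3 + b2 *\<^sub>R p2 + b1 *\<^sub>R p1" "b3 + b2 + b1 = 1"
  "\<not> collinear {p1, p3, p2}" "x = b1 *\<^sub>R p1 + b3 *\<^sub>R p3 + b2 *\<^sub>R p2" "b1 + b3 + b2 = 1"
  using nc sum1 by (simp_all add: insert_commute x)

lemma Q_permute:
  "ps12_Q D p2 p3 p1 i j k l m n r x = ps12_Q D p1 p2 p3 k i j n l m r x"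
  "ps12_Q D p3 p1 p2 i j k l m n r x = ps12_Q D p1 p2 p3 j k i m n l r x"
  "ps12_Q D p2 p1 p3 i j k l m n r x = ps12_Q D p1 p2 p3 j i k l n m r x"
  "ps12_Q D p3 p2 p1 i j k l m n r x = ps12_Q D p1 p2 p3 k j i m l n r x"
  "ps12_Q D p1 p3 p2 i j k l m n r x = ps12_Q D p1 p2 p3 i k j n m l r x"
  by (rule ps12_Q_rotate[symmetric], rule ps12_Q_rotate, rule ps12_Q_swap,
      rule trans[OF ps12_Q_swap ps12_Q_rotate[symmetric]], rule trans[OF ps12_Q_swap ps12_Q_rotate])

lemma ps12_s1_eq: "ps12_s1 p1 p2 p3 x = basis1 b1 b2 b3"
proof -
  note Q = s1a_eq_Q[OF nc x sum1 nn(1) nn(2) nn(3)]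
    s1a_eq_Q[OF rotations(1) rotations(2) rotations(3) nn(2) nn(3) nn(1), unfolded Q_permute]
    s1a_eq_Q[OF rotations(4) rotations(5) rotations(6) nn(3) nn(1) nn(2), unfolded Q_permute]
    s1b_eq_Q[OF nc x sum1 nn(1) nn(2) nn(3)]
    s1b_eq_Q[OF rotations(1) rotations(2) rotations(3) nn(2) nn(3) nn(1), unfolded Q_permute]
    s1b_eq_Q[OF rotations(4) rotations(5) rotations(6) nn(3) nn(1) nn(2), unfolded Q_permute]
    s1c_eq_Q[OF nc x sum1 nn(1) nn(2) nn(3)]
    s1c_eq_Q[OF rotations(1) rotations(2) rotations(3) nn(2) nn(3) nn(1), unfolded Q_permute]
    s1c_eq_Q[OF rotations(4) rotations(5) rotations(6) nn(3) nn(1) nn(2), unfolded Q_permute]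
    s1d_eq_Q[OF nc x sum1 nn(1) nn(2) nn(3)]
  show ?thesis
    by (simp only: ps12_s1_def Let_def basis1_def Q)
qed

lemma ps12_s2_eq: "ps12_s2 p1 p2 p3 x = basis2 b1 b2 b3"
proof -
  note Q = s2a_eq_Q[OF nc x sum1 nn(1) nn(2) nn(3)]
    s2a_eq_Q[OF rotations(1) rotations(2) rotations(3) nn(2) nn(3) nn(1), unfolded Q_permute]
    s2a_eq_Q[OF rotations(4) rotations(5) rotations(6) nn(3) nn(1) nn(2), unfolded Q_permute]
    s2b_eq_Q[OF nc x sum1 nn(1) nn(2) nn(3)]
    s2b_eq_Q[OF rotations(1) rotations(2) rotations(3) nn(2) nn(3) nn(1), unfolded Q_permute]
    s2b_eq_Q[OF rotations(4) rotations(5) rotations(6) nn(3) nn(1) nn(2), unfolded Q_permute]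
    s2b_eq_Q[OF rotations(7) rotations(8) rotations(9) nn(2) nn(1) nn(3), unfolded Q_permute]
    s2b_eq_Q[OF rotations(10) rotations(11) rotations(12) nn(3) nn(2) nn(1), unfolded Q_permute]
    s2b_eq_Q[OF rotations(13) rotations(14) rotations(15) nn(1) nn(3) nn(2), unfolded Q_permute]
    s2c_eq_Q[OF nc x sum1 nn(1) nn(2) nn(3)]
    s2c_eq_Q[OF rotations(1) rotations(2) rotations(3) nn(2) nn(3) nn(1), unfolded Q_permute]
    s2c_eq_Q[OF rotations(4) rotations(5) rotations(6) nn(3) nn(1) nn(2), unfolded Q_permute]
  show ?thesis
    by (simp only: ps12_s2_def Let_def basis2_def Q)
qed

lemma ps12_s3_eq: "ps12_s3 p1 p2 p3 x = basis3 b1 b2 b3"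
proof -
  note Q = s3a_eq_Q[OF nc x sum1 nn(1) nn(2) nn(3)]
    s3a_eq_Q[OF rotations(1) rotations(2) rotations(3) nn(2) nn(3) nn(1), unfolded Q_permute]
    s3a_eq_Q[OF rotations(4) rotations(5) rotations(6) nn(3) nn(1) nn(2), unfolded Q_permute]
    s3b_eq_Q[OF nc x sum1 nn(1) nn(2) nn(3)]
    s3b_eq_Q[OF rotations(1) rotations(2) rotations(3) nn(2) nn(3) nn(1), unfolded Q_permute]
    s3b_eq_Q[OF rotations(4) rotations(5) rotations(6) nn(3) nn(1) nn(2), unfolded Q_permute]
    s3b_eq_Q[OF rotations(7) rotations(8) rotations(9) nn(2) nn(1) nn(3), unfolded Q_permute]
    s3b_eq_Q[OF rotations(10) rotations(11) rotations(12) nn(3) nn(2) nn(1), unfolded Q_permute]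
    s3b_eq_Q[OF rotations(13) rotations(14) rotations(15) nn(1) nn(3) nn(2), unfolded Q_permute]
    s3c_eq_Q[OF nc x sum1 nn(1) nn(2) nn(3)]
    s3c_eq_Q[OF rotations(1) rotations(2) rotations(3) nn(2) nn(3) nn(1), unfolded Q_permute]
    s3c_eq_Q[OF rotations(4) rotations(5) rotations(6) nn(3) nn(1) nn(2), unfolded Q_permute]
    s3d_eq_Q[OF nc x sum1 nn(1) nn(2) nn(3)]
    s3d_eq_Q[OF rotations(1) rotations(2) rotations(3) nn(2) nn(3) nn(1), unfolded Q_permute]
    s3d_eq_Q[OF rotations(4) rotations(5) rotations(6) nn(3) nn(1) nn(2), unfolded Q_permute]
    s3e_eq_Q[OF nc x sum1 nn(1) nn(2) nn(3)]
  show ?thesis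
    by (simp only: ps12_s3_def Let_def basis3_def Q)
qed

lemma ps12_R_eq:
  "ps12_R p1 p2 p3 1 i j x = sparse_entry (R1_rows b1 b2 b3) i j"
  "ps12_R p1 p2 p3 2 i j x = sparse_entry (R2_rows b1 b2 b3) i j"
  "ps12_R p1 p2 p3 3 i j x = sparse_entry (R3_rows b1 b2 b3) i j"
proof -
  have "barycentric p1 p2 p3 x = (b1, b2, b3)"
    using x sum1 by (intro barycentric_eq[OF nc]) (simp add: bary_comb_def)
  then show "ps12_R p1 p2 p3 1 i j x = sparse_entry (R1_rows b1 b2 b3) i j"
    "ps12_R p1 p2 p3 2 i j x = sparse_entry (R2_rows b1 b2 b3) i j"
    "ps12_R p1 p2 p3 3 i j x = sparse_entry (R3_rows b1 b2 b3) i j"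
    by (simp_all add: ps12_R_def sparse_entry_def)
qed

lemma ps12_S_eq:
  "ps12_S p1 p2 p3 T 1 j x = basis1 b1 b2 b3 ! (j - 1)"
  "ps12_S p1 p2 p3 T 2 j x = basis2 b1 b2 b3 ! (j - 1)"
  "ps12_S p1 p2 p3 T 3 j x = basis3 b1 b2 b3 ! (j - 1)"
  by (simp_all add: ps12_S_def ps12_s1_eq ps12_s2_eq ps12_s3_eq)

text \<open>Coordinates are affine, so membership in a subtriangle becomes a nonnegative combination
  of the corner coordinates. A homogeneous linear inequality that holds at the three corners then
  follows by linear arithmetic.\<close>

lemma in_triangle_coords:
  assumes "x \<in> convex hull {A, B, C}"
    and "bary_comb p1 p2 p3 (A1, A2, A3) A" "bary_comb p1 p2 p3 (B1, B2, B3) B" "bary_comb p1 p2 p3 (C1, C2, C3) C"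
  obtains u v w where "0 \<le> u" "0 \<le> v" "0 \<le> w" "b1 = u * A1 + v * B1 + w * C1"
    "b2 = u * A2 + v * B2 + w * C2" "b3 = u * A3 + v * B3 + w * C3"
proof -
  obtain u v w where uvw: "0 \<le> u" "0 \<le> v" "0 \<le> w" "u + v + w = 1"
    and xx: "x = u *\<^sub>R A + v *\<^sub>R B + w *\<^sub>R C"
    using assms(1) unfolding convex_hull_3 by blast
  have "(u * A1 + v * B1 + w * C1) + (u * A2 + v * B2 + w * C2) + (u * A3 + v * B3 + w * C3)
      = u * (A1 + A2 + A3) + v * (B1 + B2 + B3) + w * (C1 + C2 + C3)"
    by (simp add: algebra_simps)
  also have "\<dots> = b1 + b2 + b3"
    using assms(2-4) uvw(4) sum1 by (simp add: bary_comb_def)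
  finally have s: "b1 + b2 + b3 = (u * A1 + v * B1 + w * C1) + (u * A2 + v * B2 + w * C2) + (u * A3 +
    v * B3 + w * C3)"
    by simp
  have "b1 *\<^sub>R p1 + b2 *\<^sub>R p2 + b3 *\<^sub>R p3 = (u * A1 + v * B1 + w * C1) *\<^sub>R p1
      + (u * A2 + v * B2 + w * C2) *\<^sub>R p2 + (u * A3 + v * B3 + w * C3) *\<^sub>R p3"
    unfolding x[symmetric] xx using assms(2-4) by (simp add: bary_comb_def algebra_simps)
  from noncollinear_cong[OF nc s this] that[OF uvw(1-3)] show thesis by blast
qed

lemma bary_comb_pts:
  "bary_comb p1 p2 p3 (1, 0, 0) (ps12_pt p1 p2 p3 1)"
  "bary_comb p1 p2 p3 (0, 1, 0) (ps12_pt p1 p2 p3 2)"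
  "bary_comb p1 p2 p3 (0, 0, 1) (ps12_pt p1 p2 p3 3)"
  "bary_comb p1 p2 p3 (1/2, 1/2, 0) (ps12_pt p1 p2 p3 4)"
  "bary_comb p1 p2 p3 (0, 1/2, 1/2) (ps12_pt p1 p2 p3 5)"
  "bary_comb p1 p2 p3 (1/2, 0, 1/2) (ps12_pt p1 p2 p3 6)"
  "bary_comb p1 p2 p3 (1/2, 1/4, 1/4) (ps12_pt p1 p2 p3 7)"
  "bary_comb p1 p2 p3 (1/4, 1/2, 1/4) (ps12_pt p1 p2 p3 8)"
  "bary_comb p1 p2 p3 (1/4, 1/4, 1/2) (ps12_pt p1 p2 p3 9)"
  "bary_comb p1 p2 p3 (1/3, 1/3, 1/3) (ps12_pt p1 p2 p3 10)"
  by (simp_all add: ps12_pt_simps bary_simps field_simps)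

text \<open>On a subtriangle only the hat functions at its three corners survive, and row
  \<open>k\<close> lists the barycentric coordinates of \<open>x\<close> with respect to these
  corners. For \<open>k \<le> 6\<close> two inequalities describe the subtriangle, its third side
  lying on the boundary of the whole triangle; for the others three are used. They decide every
  maximum and minimum.\<close>

lemma s1_rec_subtriangle:
  assumes "k \<in> {1..12}" and "x \<in> ps12_subtriangle p1 p2 p3 k"
  shows "\<forall>j\<in>{1..10}. basis1 b1 b2 b3 ! (j - 1) = sparse_entry (R1_rows b1 b2 b3) k j"
proof -
  note defs = atLeastAtMost_literals basis1_def sparse_entry_def R1_rows_def Let_def gammas[OF nn sum1]
    s1a_def s1b_def s1c_def s1d_def
  consider "k = 1" | "k = 2" | "k = 3" | "k = 4" | "k = 5" | "k = 6" | "k = 7" | "k = 8" | "k =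
    9" | "k = 10" | "k = 11" | "k = 12"
    using assms(1) unfolding atLeastAtMost_literals by blast
  then show ?thesis
  proof cases
    case 1
    then have "x \<in> convex hull {ps12_pt p1 p2 p3 1, ps12_pt p1 p2 p3 6, ps12_pt p1 p2 p3 7}"
      using assms(2) by (simp add: ps12_subtriangle_def)
    then have "b2 + b3 \<le> b1" "b2 \<le> b3"
      by (rule in_triangle_coords[OF _ bary_comb_pts(1) bary_comb_pts(6) bary_comb_pts(7)]; linarith)+
    then show ?thesis
      unfolding defs 1 using nn by (simp add: region_simps)
  next
    case 2
    then have "x \<in> convex hull {ps12_pt p1 p2 p3 1, ps12_pt p1 p2 p3 4, ps12_pt p1 p2 p3 7}"
      using assms(2) by (simp add: ps12_subtriangle_def)
    then have "b2 + b3 \<le> b1" "b3 \<le> b2"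
      by (rule in_triangle_coords[OF _ bary_comb_pts(1) bary_comb_pts(4) bary_comb_pts(7)]; linarith)+
    then show ?thesis
      unfolding defs 2 using nn by (simp add: region_simps)
  next
    case 3
    then have "x \<in> convex hull {ps12_pt p1 p2 p3 2, ps12_pt p1 p2 p3 4, ps12_pt p1 p2 p3 8}"
      using assms(2) by (simp add: ps12_subtriangle_def)
    then have "b1 + b3 \<le> b2" "b3 \<le> b1"
      by (rule in_triangle_coords[OF _ bary_comb_pts(2) bary_comb_pts(4) bary_comb_pts(8)]; linarith)+
    then show ?thesis
      unfolding defs 3 using nn by (simp add: region_simps)
  next
    case 4
    then have "x \<in> convex hull {ps12_pt p1 p2 p3 2, ps12_pt p1 p2 p3 5, ps12_pt p1 p2 p3 8}"
      using assms(2) by (simp add: ps12_subtriangle_def)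
    then have "b1 + b3 \<le> b2" "b1 \<le> b3"
      by (rule in_triangle_coords[OF _ bary_comb_pts(2) bary_comb_pts(5) bary_comb_pts(8)]; linarith)+
    then show ?thesis
      unfolding defs 4 using nn by (simp add: region_simps)
  next
    case 5
    then have "x \<in> convex hull {ps12_pt p1 p2 p3 3, ps12_pt p1 p2 p3 5, ps12_pt p1 p2 p3 9}"
      using assms(2) by (simp add: ps12_subtriangle_def)
    then have "b1 + b2 \<le> b3" "b1 \<le> b2"
      by (rule in_triangle_coords[OF _ bary_comb_pts(3) bary_comb_pts(5) bary_comb_pts(9)]; linarith)+
    then show ?thesis
      unfolding defs 5 using nn by (simp add: region_simps)
  next
    case 6
    then have "x \<in> convex hull {ps12_pt p1 p2 p3 3, ps12_pt p1 p2 p3 6, ps12_pt p1 p2 p3 9}"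
      using assms(2) by (simp add: ps12_subtriangle_def)
    then have "b1 + b2 \<le> b3" "b2 \<le> b1"
      by (rule in_triangle_coords[OF _ bary_comb_pts(3) bary_comb_pts(6) bary_comb_pts(9)]; linarith)+
    then show ?thesis
      unfolding defs 6 using nn by (simp add: region_simps)
  next
    case 7
    then have "x \<in> convex hull {ps12_pt p1 p2 p3 6, ps12_pt p1 p2 p3 7, ps12_pt p1 p2 p3 10}"
      using assms(2) by (simp add: ps12_subtriangle_def)
    then have "b1 \<le> b2 + b3" "b2 \<le> b3" "b3 \<le> b1"
      by (rule in_triangle_coords[OF _ bary_comb_pts(6) bary_comb_pts(7) bary_comb_pts(10)]; linarith)+
    then show ?thesis
      unfolding defs 7 using nn by (simp add: region_simps)
  next
    case 8
    then have "x \<in> convex hull {ps12_pt p1 p2 p3 4, ps12_pt p1 p2 p3 7, ps12_pt p1 p2 p3 10}"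
      using assms(2) by (simp add: ps12_subtriangle_def)
    then have "b1 \<le> b2 + b3" "b3 \<le> b2" "b2 \<le> b1"
      by (rule in_triangle_coords[OF _ bary_comb_pts(4) bary_comb_pts(7) bary_comb_pts(10)]; linarith)+
    then show ?thesis
      unfolding defs 8 using nn by (simp add: region_simps)
  next
    case 9
    then have "x \<in> convex hull {ps12_pt p1 p2 p3 4, ps12_pt p1 p2 p3 8, ps12_pt p1 p2 p3 10}"
      using assms(2) by (simp add: ps12_subtriangle_def)
    then have "b2 \<le> b1 + b3" "b3 \<le> b1" "b1 \<le> b2"
      by (rule in_triangle_coords[OF _ bary_comb_pts(4) bary_comb_pts(8) bary_comb_pts(10)]; linarith)+
    then show ?thesis
      unfolding defs 9 using nn by (simp add: region_simps)
  next
    case 10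
    then have "x \<in> convex hull {ps12_pt p1 p2 p3 5, ps12_pt p1 p2 p3 8, ps12_pt p1 p2 p3 10}"
      using assms(2) by (simp add: ps12_subtriangle_def)
    then have "b2 \<le> b1 + b3" "b1 \<le> b3" "b3 \<le> b2"
      by (rule in_triangle_coords[OF _ bary_comb_pts(5) bary_comb_pts(8) bary_comb_pts(10)]; linarith)+
    then show ?thesis
      unfolding defs 10 using nn by (simp add: region_simps)
  next
    case 11
    then have "x \<in> convex hull {ps12_pt p1 p2 p3 5, ps12_pt p1 p2 p3 9, ps12_pt p1 p2 p3 10}"
      using assms(2) by (simp add: ps12_subtriangle_def)
    then have "b3 \<le> b1 + b2" "b1 \<le> b2" "b2 \<le> b3"
      by (rule in_triangle_coords[OF _ bary_comb_pts(5) bary_comb_pts(9) bary_comb_pts(10)]; linarith)+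
    then show ?thesis
      unfolding defs 11 using nn by (simp add: region_simps)
  next
    case 12
    then have "x \<in> convex hull {ps12_pt p1 p2 p3 6, ps12_pt p1 p2 p3 9, ps12_pt p1 p2 p3 10}"
      using assms(2) by (simp add: ps12_subtriangle_def)
    then have "b3 \<le> b1 + b2" "b2 \<le> b1" "b1 \<le> b3"
      by (rule in_triangle_coords[OF _ bary_comb_pts(6) bary_comb_pts(9) bary_comb_pts(10)]; linarith)+
    then show ?thesis
      unfolding defs 12 using nn by (simp add: region_simps)
  qed
qed

text \<open>For d = 1 exactly one indicator is 1 at \<open>x\<close>, so the sum collapses to the
  row of the subtriangle that owns \<open>x\<close>. For d = 2, 3 the claims are
  \<open>s2_rec\<close>, \<open>s3_rec\<close> and the two support lemmas.\<close>

lemma ps12_at_point: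
  assumes T: "ps12_partition p1 p2 p3 T"
  shows "\<forall>d\<in>{1, 2, 3}. \<forall>j\<in>{1..ps12_dim d}. ps12_S p1 p2 p3 T d j x =
      (\<Sum>i = 1..ps12_dim (d - 1). ps12_S p1 p2 p3 T (d - 1) i x * ps12_R p1 p2 p3 d i j x)"
    and "\<forall>d\<in>{1, 2, 3}. \<forall>i\<in>{1..ps12_dim (d - 1)}. \<forall>j\<in>{1..ps12_dim d}.
      0 \<le> ps12_R p1 p2 p3 d i j x * ps12_S p1 p2 p3 T (d - 1) i x"
proof -
  have ball3: "(\<forall>d\<in>{1, 2, 3}. P d) \<longleftrightarrow> P 1 \<and> P 2 \<and>
    P 3" for P :: "nat \<Rightarrow> bool"
    by simp
  have pred: "(1::nat) - 1 = 0" "(2::nat) - 1 = 1" "(3::nat) - 1 = 2"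
    by simp_all
  note T' = T[unfolded ps12_partition_def]
  note sub = T'[THEN conjunct1, rule_format] and disj = T'[THEN conjunct2, THEN conjunct1]
    and un = T'[THEN conjunct2, THEN conjunct2]
  have dims: "ps12_dim 0 = 12" "ps12_dim 1 = 10" "ps12_dim 2 = 12" "ps12_dim 3 = 16"
    by (simp_all add: ps12_dim_def)
  have S0: "ps12_S p1 p2 p3 T 0 i x = indicator (T i) x" if "i \<in> {1..12}" for i
  proof -
    have "map (\<lambda>k. indicator (T k) x :: real) [1..<13] ! (i - 1) = indicator (T (1 + (i - 1))) x"
      using that by (intro nth_map_upt) auto
    then show ?thesis using that by (simp add: ps12_S_def ps12_s0_def)
  qed
  have "x \<in> convex hull {p1, p2, p3}"
    unfolding convex_hull_3 using x nn sum1 by blast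
  then obtain k where k: "k \<in> {1..12}" "x \<in> T k"
    unfolding un[symmetric] by (rule UN_E)
  have other: "indicator (T i) x = (if i = k then 1 else 0 :: real)" if "i \<in> {1..12}" for i
    using disjoint_family_onD[OF disj that k(1)] k(2) by (cases "i = k") (auto simp: indicator_def)
  have row: "\<forall>j\<in>{1..10}. basis1 b1 b2 b3 ! (j - 1) = sparse_entry (R1_rows b1 b2 b3) k j"
    by (rule s1_rec_subtriangle[OF k(1) subsetD[OF sub[OF k(1)] k(2)]])
  have "\<forall>j\<in>{1..10}. basis1 b1 b2 b3 ! (j - 1) =
      (\<Sum>i = 1..12. ps12_S p1 p2 p3 T 0 i x * sparse_entry (R1_rows b1 b2 b3) i j)"
  proof
    fix j :: nat assume j: "j \<in> {1..10}"
    have "(\<Sum>i = 1..12. ps12_S p1 p2 p3 T 0 i x * sparse_entry (R1_rows b1 b2 b3) i j)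
      = (\<Sum>i = 1..12. if i = k then sparse_entry (R1_rows b1 b2 b3) k j else 0)"
      by (intro sum.cong) (auto simp: S0 other)
    also have "\<dots> = sparse_entry (R1_rows b1 b2 b3) k j" using k by simp
    finally show "basis1 b1 b2 b3 ! (j - 1) =
      (\<Sum>i = 1..12. ps12_S p1 p2 p3 T 0 i x * sparse_entry (R1_rows b1 b2 b3) i j)"
      using row j by simp
  qed
  then show "\<forall>d\<in>{1, 2, 3}. \<forall>j\<in>{1..ps12_dim d}. ps12_S p1 p2 p3 T d j x =
      (\<Sum>i = 1..ps12_dim (d - 1). ps12_S p1 p2 p3 T (d - 1) i x * ps12_R p1 p2 p3 d i j x)"
    unfolding ball3 pred dims ps12_S_eq ps12_R_eq
    by (intro conjI s2_rec[OF nn sum1] s3_rec[OF nn sum1])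
  have nonneg1: "0 \<le> basis1 b1 b2 b3 ! (j - 1)" if "j \<in> {1..10}" for j
    using that s1_nonneg[OF nn] s1_nonneg[OF nn(2) nn(3) nn(1)] s1_nonneg[OF nn(3) nn(1) nn(2)]
    unfolding atLeastAtMost_literals basis1_def by (elim insertE emptyE) simp_all
  \<comment> \<open>Entries of the first matrix can be negative at \<open>x\<close>, but only in
    rows whose indicator is 0 there. In the remaining row the entry equals the value of a hat
    function.\<close>
  have "0 \<le> sparse_entry (R1_rows b1 b2 b3) i j * ps12_S p1 p2 p3 T 0 i x"
    if "i \<in> {1..12}" "j \<in> {1..10}" for i j
    using nonneg1[OF that(2)] row that by (cases "i = k") (simp_all add: S0 other)
  then show "\<forall>d\<in>{1, 2, 3}. \<forall>i\<in>{1..ps12_dim (d - 1)}. \<forall>j\<in>{1..ps12_dim d}.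
      0 \<le> ps12_R p1 p2 p3 d i j x * ps12_S p1 p2 p3 T (d - 1) i x"
    unfolding ball3 pred dims ps12_S_eq ps12_R_eq
    by (intro conjI ballI s1_support_nonneg[OF nn sum1] s2_support_nonneg[OF nn sum1])
qed

end

theorem theorem3p1:
  fixes p1 p2 p3 :: "real^2" and T :: "nat \<Rightarrow> (real^2) set"
  assumes nondegenerate: "\<not> collinear {p1, p2, p3}"
    and half_open: "ps12_partition p1 p2 p3 T"
  shows "(\<forall>d\<in>{1, 2, 3}. \<forall>x\<in>convex hull {p1, p2, p3}. \<forall>j\<in>{1..ps12_dim d}.
            ps12_S p1 p2 p3 T d j x =
              (\<Sum>i = 1..ps12_dim (d - 1). ps12_S p1 p2 p3 T (d - 1) i x * ps12_R p1 p2 p3 d i j x)) \<and>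
         (\<forall>d\<in>{1, 2, 3}. \<forall>i\<in>{1..ps12_dim (d - 1)}. \<forall>j\<in>{1..ps12_dim d}.
            \<forall>x\<in>convex hull {p1, p2, p3}.
              ps12_R p1 p2 p3 d i j x * ps12_S p1 p2 p3 T (d - 1) i x \<ge> 0)"
proof (intro conjI ballI)
  have coords: "\<exists>b1 b2 b3. x = b1 *\<^sub>R p1 + b2 *\<^sub>R p2 + b3 *\<^sub>R p3 \<and>
    b1 + b2 + b3 = 1 \<and> 0 \<le> b1 \<and> 0 \<le> b2 \<and> 0 \<le> b3"
    if "x \<in> convex hull {p1, p2, p3}" for x
    using that unfolding convex_hull_3 by blast
  fix d x assume d: "d \<in> {1, 2, 3 :: nat}" and x: "x \<in> convex hull {p1, p2, p3}"
  from coords[OF x] obtain b1 b2 b3 where "x = b1 *\<^sub>R p1 + b2 *\<^sub>R p2 + b3 *\<^sub>R p3"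
    "b1 + b2 + b3 = 1" "0 \<le> b1" "0 \<le> b2" "0 \<le> b3"
    by (elim exE conjE)
  note * = ps12_at_point[OF nondegenerate this half_open, rule_format, OF d]
  show "ps12_S p1 p2 p3 T d j x =
      (\<Sum>i = 1..ps12_dim (d - 1). ps12_S p1 p2 p3 T (d - 1) i x * ps12_R p1 p2 p3 d i j x)"
    if "j \<in> {1..ps12_dim d}" for j
    by (rule *(1)[OF that])
  show "0 \<le> ps12_R p1 p2 p3 d i j x * ps12_S p1 p2 p3 T (d - 1) i x"
    if "i \<in> {1..ps12_dim (d - 1)}" "j \<in> {1..ps12_dim d}" for i j
    by (rule *(2)[OF that])
qed

end
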